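(* Let $d\geq 2$, let $\mathbb{T}^d=\mathbb{R}^d/\mathbb{Z}^d$, fix $\alpha>0$, and let $0<\nu_1<\frac{2}{7d+4}$. Then there exists $0<\hbar_0\leq 1/2$ such that, given for each $0<\hbar\leq\hbar_0$ any orthonormal basis $(\psi_\hbar^j)_{j=1,\ldots,N(\hbar)}$ of $\mathcal{H}_\hbar=\mathbf{1}_{[1-\alpha\hbar,1+\alpha\hbar]}(-\hbar^2\Delta)L^2(\mathbb{T}^d)$ made of eigenfunctions of $-\hbar^2\Delta$, one can find subsets $\Lambda_{\nu_1}(\hbar)\subset\{1,\ldots,N(\hbar)\}$, $0<\hbar\leq\hbar_0$, of full density, i.e. $$\lim_{\hbar\to 0}\frac{|\Lambda_{\nu_1}(\hbar)|}{N(\hbar)}=1,$$ such that $$\forall\, 0<\hbar\leq\hbar_0,\ \forall x\in\mathbb{T}^d,\ \forall j\in\Lambda_{\nu_1}(\hbar):\qquad a_1\leq\frac{\int_{B(x,\hbar^{\nu_1})}|\psi_\hbar^j(y)|^2\,dy}{\operatorname{Vol}(B(x,\hbar^{\nu_1}))}\leq a_2,$$ where the constants $a_1,a_2>0$ are independent of $\hbar$, $x$ and $j$, and $B(x,\hbar^{\nu_1})$ denotes the geodesic ball of radius $\hbar^{\nu_1}$ centered at $x$.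
   Context: $\mathbb{T}^d=\mathbb{R}^d/\mathbb{Z}^d$ carries the standard flat metric, $\Delta$ is its Laplacian, and $dx$ is the normalized volume measure, with $\operatorname{Vol}$ the corresponding volume. The number $\alpha>0$ is fixed once and for all. For $0<\hbar\leq 1$, $\mathcal{H}_\hbar:=\mathbf{1}_{[1-\alpha\hbar,1+\alpha\hbar]}(-\hbar^2\Delta)L^2(\mathbb{T}^d)$ is the range of the spectral projector of $-\hbar^2\Delta$ onto $[1-\alpha\hbar,1+\alpha\hbar]$, i.e. the (finite-dimensional) span of the eigenfunctions of $-\hbar^2\Delta$ with eigenvalue in this interval, and $N(\hbar):=\dim\mathcal{H}_\hbar$. An orthonormal basis made of eigenfunctions means that each $\psi_\hbar^j$ satisfies $-\hbar^2\Delta\psi_\hbar^j=E_j(\hbar)\psi_\hbar^j$ for some $E_j(\hbar)\in[1-\alpha\hbar,1+\alpha\hbar]$. *)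

theory Defs
  imports "HOL-Analysis.Analysis" "HOL-Library.Function_Algebras"
begin

section \<open>The flat torus\<close>

definition torus_rel :: "real ^ 'n \<Rightarrow> real ^ 'n \<Rightarrow> bool"
  where "torus_rel x y \<longleftrightarrow> (\<forall>i. x $ i - y $ i \<in> \<int>)"

quotient_type 'n torus = "real ^ ('n::finite)" / torus_rel
proof (rule equivpI)
  show "reflp torus_rel"
    by (auto simp: reflp_def torus_rel_def)
  show "symp torus_rel"
    unfolding symp_def torus_rel_def by (metis Ints_minus minus_diff_eq)
  show "transp torus_rel"
    unfolding transp_def torus_rel_def by (metis Ints_add diff_add_cancel add_diff_eq)
qed

text \<open>
  The covering map is \<^const>\<open>abs_torus\<close>. The geodesic distance of the flat metric is the Euclidean
  distance between the two fibres of this map.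
\<close>

abbreviation torus_fibre :: "('n::finite) torus \<Rightarrow> (real ^ 'n) set"
  where "torus_fibre X \<equiv> abs_torus -` {X}"

lemma mem_torus_fibre_iff: "y \<in> torus_fibre (abs_torus x) \<longleftrightarrow> (\<forall>i. y $ i - x $ i \<in> \<int>)"
  by (simp add: torus.abs_eq_iff torus_rel_def)

lemma torus_exhaust:
  obtains x where "X = abs_torus x"
  by (induction X rule: torus.abs_induct) auto

lemma torus_fibre_nonempty: "torus_fibre X \<noteq> {}"
  by (cases X rule: torus_exhaust) auto

lemma closed_torus_fibre: "closed (torus_fibre X)"
proof (cases X rule: torus_exhaust)
  case (1 x)
  have "torus_fibre (abs_torus x) = (\<Inter>i. (\<lambda>y. y $ i - x $ i) -` \<int>)"
    using mem_torus_fibre_iff[of _ x] by (auto simp del: vimage_singleton_eq)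
  moreover have "closed ((\<lambda>y. y $ i - x $ i) -` (\<int> :: real set))" for i
    by (rule closed_vimage[OF closed_Ints]) (auto intro!: continuous_intros)
  ultimately show ?thesis
    using 1 by (auto intro!: closed_INT)
qed

lemma setdist_torus_fibre:
  "setdist (torus_fibre (abs_torus x)) (torus_fibre Y) = setdist {x} (torus_fibre Y)"
proof (rule antisym)
  show "setdist (torus_fibre (abs_torus x)) (torus_fibre Y) \<le> setdist {x} (torus_fibre Y)"
    by (rule setdist_le_sing) simp
  have "setdist {x} (torus_fibre Y) \<le> dist x' y"
    if x': "x' \<in> torus_fibre (abs_torus x)" and y: "y \<in> torus_fibre Y" for x' y
  proof -
    have "abs_torus (y + (x - x')) = abs_torus y"
      using x' unfolding mem_torus_fibre_iff
      by (simp add: torus.abs_eq_iff torus_rel_def) (metis Ints_minus minus_diff_eq)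
    then have "y + (x - x') \<in> torus_fibre Y"
      using y by simp
    then have "setdist {x} (torus_fibre Y) \<le> dist x (y + (x - x'))"
      by (intro setdist_le_dist) auto
    also have "\<dots> = dist x' y"
      by (simp add: dist_norm algebra_simps)
    finally show ?thesis .
  qed
  then show "setdist {x} (torus_fibre Y) \<le> setdist (torus_fibre (abs_torus x)) (torus_fibre Y)"
    by (intro le_setdistI) (auto simp: torus_fibre_nonempty)
qed

instantiation torus :: (finite) metric_space
begin

definition dist_torus :: "'a torus \<Rightarrow> 'a torus \<Rightarrow> real"
  where "dist_torus X Y = setdist (torus_fibre X) (torus_fibre Y)"

definition uniformity_torus :: "('a torus \<times> 'a torus) filter"
  where "uniformity_torus = (INF e\<in>{0<..}. principal {(x, y). dist x y < e})"

definition open_torus :: "'a torus set \<Rightarrow> bool"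
  where "open_torus U \<longleftrightarrow> (\<forall>x\<in>U. eventually (\<lambda>(x', y). x' = x \<longrightarrow> y \<in> U) uniformity)"

instance
proof
  fix X Y Z :: "'a torus"
  show "dist X Y = 0 \<longleftrightarrow> X = Y"
  proof (cases X rule: torus_exhaust)
    case (1 x)
    have "dist X Y = setdist {x} (torus_fibre Y)"
      unfolding dist_torus_def 1 by (rule setdist_torus_fibre)
    then have "dist X Y = 0 \<longleftrightarrow> x \<in> torus_fibre Y"
      using closed_torus_fibre[of Y] torus_fibre_nonempty[of Y] by (simp add: setdist_eq_0_sing_1)
    then show ?thesis
      using 1 by auto
  qed
  show "dist X Y \<le> dist X Z + dist Y Z"
  proof (cases Z rule: torus_exhaust)
    case (1 z)
    have "setdist (torus_fibre X) (torus_fibre Y)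
        \<le> setdist (torus_fibre X) {z} + setdist {z} (torus_fibre Y)"
      by (rule setdist_triangle)
    also have "\<dots> = dist X Z + dist Y Z"
      unfolding dist_torus_def 1
      using setdist_torus_fibre[of z X] setdist_torus_fibre[of z Y] by (simp add: setdist_sym)
    finally show ?thesis
      by (simp add: dist_torus_def)
  qed
qed (simp_all add: uniformity_torus_def open_torus_def)

end

lemma dist_abs_torus_le: "dist (abs_torus x) (abs_torus y) \<le> dist x y"
  unfolding dist_torus_def by (rule setdist_le_dist) auto

lemma continuous_on_abs_torus: "continuous_on A abs_torus"
  unfolding continuous_on_iff by (metis dist_abs_torus_le le_less_trans)

text \<open>The Riemannian volume (of total mass 1), transported from a fundamental domain.\<close>

definition torus_vol :: "('n::finite) torus measure"
  where "torus_vol =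
    distr (restrict_space lborel {x. \<forall>i. 0 \<le> x $ i \<and> x $ i < 1}) borel abs_torus"

lemma measurable_abs_torus:
  "abs_torus \<in> measurable (restrict_space lborel {x. \<forall>i. 0 \<le> x $ i \<and> x $ i < 1}) borel"
  by (intro measurable_restrict_space1) (simp add: borel_measurable_continuous_onI continuous_on_abs_torus)


section \<open>The Laplacian and its spectral subspaces\<close>

definition cscale :: "complex \<Rightarrow> ('a \<Rightarrow> complex) \<Rightarrow> 'a \<Rightarrow> complex"
  where "cscale c f = (\<lambda>x. c * f x)"

global_interpretation cfun: vector_space cscale
  by standard (auto simp: cscale_def fun_eq_iff algebra_simps)

definition partial_deriv :: "'n::finite \<Rightarrow> (real ^ 'n \<Rightarrow> complex) \<Rightarrow> real ^ 'n \<Rightarrow> complex"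
  where "partial_deriv i F x = frechet_derivative F (at x) (axis i 1)"

definition C2_torus :: "('n::finite torus \<Rightarrow> complex) \<Rightarrow> bool"
  where "C2_torus f \<longleftrightarrow>
    (let F = f \<circ> abs_torus in
      F differentiable_on UNIV \<and>
      (\<forall>i. partial_deriv i F differentiable_on UNIV) \<and>
      (\<forall>i j. continuous_on UNIV (partial_deriv j (partial_deriv i F))))"

text \<open>
  The value below does not depend on the chosen representative of \<open>X\<close>, because the lift of \<open>f\<close>
  is periodic.
\<close>

definition laplacian :: "('n::finite torus \<Rightarrow> complex) \<Rightarrow> 'n torus \<Rightarrow> complex"
  where "laplacian f X =
    (\<Sum>i\<in>UNIV. partial_deriv i (partial_deriv i (f \<circ> abs_torus)) (rep_torus X))"

text \<open>
  Eigenfunctions in \<open>L\<^sup>2\<close> of the Laplacian are represented by their unique continuous (in fact smooth)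
  representatives, so that no quotient by null sets is needed.
\<close>

definition eigenfunction :: "real \<Rightarrow> real \<Rightarrow> ('n::finite torus \<Rightarrow> complex) \<Rightarrow> bool"
  where "eigenfunction h E f \<longleftrightarrow>
    C2_torus f \<and> f \<noteq> 0 \<and> (\<forall>X. - (complex_of_real (h\<^sup>2) * laplacian f X) = complex_of_real E * f X)"

text \<open>
  The range of the spectral projector of \<open>- h\<^sup>2 \<Delta>\<close> onto \<open>[1 - \<alpha> h, 1 + \<alpha> h]\<close>: the spectrum is
  discrete, so this is the complex span of the eigenfunctions with eigenvalue in that interval.
\<close>

definition spectral_space :: "real \<Rightarrow> real \<Rightarrow> ('n::finite torus \<Rightarrow> complex) set"
  where "spectral_space \<alpha> h =
    cfun.span {f. \<exists>E\<in>{1 - \<alpha> * h .. 1 + \<alpha> * h}. eigenfunction h E f}"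

definition L2_inner :: "('n::finite torus \<Rightarrow> complex) \<Rightarrow> ('n torus \<Rightarrow> complex) \<Rightarrow> complex"
  where "L2_inner f g = (LINT X|torus_vol. f X * cnj (g X))"

definition orthonormal_eigenbasis ::
    "real \<Rightarrow> real \<Rightarrow> (nat \<Rightarrow> 'n::finite torus \<Rightarrow> complex) \<Rightarrow> bool"
  where "orthonormal_eigenbasis \<alpha> h \<psi> \<longleftrightarrow>
    (let H = spectral_space \<alpha> h :: ('n torus \<Rightarrow> complex) set; N = cfun.dim H in
      (\<forall>j\<in>{1..N}. \<exists>E\<in>{1 - \<alpha> * h .. 1 + \<alpha> * h}. eigenfunction h E (\<psi> j)) \<and>
      (\<forall>j\<in>{1..N}. \<forall>k\<in>{1..N}. L2_inner (\<psi> j) (\<psi> k) = (if j = k then 1 else 0)) \<and>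
      cfun.span (\<psi> ` {1..N}) = H)"

end

theory Submission
  imports Defs
begin

text \<open>
  Eigenfunctions are trigonometric polynomials with frequencies on a single sphere. So if \<open>a\<close> is the
  indicator function of a cube \<open>Q\<close>, Bessel's inequality for the \<open>\<psi>\<^sub>j\<close> bounds the sum over \<open>j\<close> of
  \<open>|\<langle>a \<psi>\<^sub>j, \<psi>\<^sub>j\<rangle> - Vol Q|\<^sup>2\<close> by the sum of \<open>|\<hat>a(n - m)|\<^sup>2\<close> over distinct frequencies \<open>m, n\<close> of the
  spectral window with \<open>|m| = |n|\<close>. For a fixed difference \<open>k = n - m\<close> these \<open>m\<close> lie in a thin
  spherical shell of radius \<open>R \<sim> 1/h\<close> and on a hyperplane, so there are at most \<open>C R\<^bsup>d - 1 - \<delta>\<^esup>\<close> of them,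
  with \<open>\<delta> = 1/2\<close> if \<open>d = 2\<close> and \<open>\<delta> = 3/4\<close> otherwise, and Bessel's inequality for the characters bounds
  the variance by \<open>C R\<^bsup>d - 1 - \<delta>\<^esup> Vol Q\<close>. By Chebyshev's inequality, summed over the \<open>h\<^bsup>- d \<nu>\<^esup>\<close> cubes of
  side \<open>h\<^bsup>\<nu>\<^esup>\<close>, all but \<open>C h\<^bsup>- 2 d \<nu>\<^esup> R\<^bsup>d - 1 - \<delta>\<^esup>\<close> indices are good for every cube. This is negligible, as the
  shell contains at least \<open>c R\<^bsup>d - 1\<^esup>\<close> lattice points and \<open>2 d \<nu> < \<delta>\<close>. Finally, a ball of radius \<open>h\<^bsup>\<nu>\<^esup>\<close>
  contains a cube and is covered by boundedly many.
\<close>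

section \<open>Characters and integration on the torus\<close>

text \<open>The hypothesis on \<nu> gives 2 d \<nu> < 4 d / (7 d + 4). This bound is at most 1/2 for
  d <= 4, but it tends to 4/7. On the hyperplane, fixing all but two coordinates leaves a line, and
  the shell meets it in at most C R^(1/2) lattice points; this saves only 1/2, which does not cover
  large d. The worst case occurs only for lines nearly tangent to the sphere. From d = 3 on there is
  one more coordinate, and near tangency is again a quadratic inequality in it, so such lines are
  rare. This is the origin of the saving 3/4.

  The count must be uniform in the difference k, because the squared Fourier coefficients of the
  cube are controlled only through their sum. It is uniform because every quadratic polynomial that
  occurs has leading coefficient at least 1. For the same reason a discontinuous indicator function
  serves as well as a smooth one.

  The variance is bounded by a Hilbert-Schmidt norm that depends only on the set of frequencies,
  hence the bound is the same for every eigenbasis.\<close>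

definition tchar :: "('n::finite \<Rightarrow> int) \<Rightarrow> 'n torus \<Rightarrow> complex"
  where "tchar n X = cis (2 * pi * (\<Sum>i\<in>UNIV. of_int (n i) * rep_torus X $ i))"

text \<open>The lift of \<open>tchar n\<close> to R^d, where derivatives and integrals are computed.
  Periodicity makes the choice of representative in \<open>tchar\<close> harmless.\<close>

definition lchar :: "('n::finite \<Rightarrow> int) \<Rightarrow> real ^ 'n \<Rightarrow> complex"
  where "lchar n x = cis (2 * pi * (\<Sum>i\<in>UNIV. of_int (n i) * x $ i))"

lemma rep_torus_abs_torus: "rep_torus (abs_torus x) $ i - x $ i \<in> \<int>"
  using Quotient3_abs_rep[OF Quotient3_torus, of "abs_torus x"]
  unfolding torus.abs_eq_iff torus_rel_def by blast

lemma abs_torus_rep [simp]: "abs_torus (rep_torus X) = X"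
  using Quotient3_torus by (rule Quotient3_abs_rep)

lemma abs_torus_eqI: "(\<And>i. x $ i - y $ i \<in> \<int>) \<Longrightarrow> abs_torus x = abs_torus y"
  by (simp add: torus.abs_eq_iff torus_rel_def)

lemma lchar_periodic:
  assumes "\<And>i. x $ i - y $ i \<in> \<int>"
  shows "lchar n x = lchar n y"
proof -
  have "(\<Sum>i\<in>UNIV. of_int (n i) * (x $ i - y $ i)) \<in> \<int>"
    using assms by (intro Ints_sum Ints_mult) auto
  then obtain k where k: "(\<Sum>i\<in>UNIV. of_int (n i) * (x $ i - y $ i)) = of_int k"
    by (elim Ints_cases)
  have "2 * pi * (\<Sum>i\<in>UNIV. of_int (n i) * x $ i)
      = 2 * pi * (\<Sum>i\<in>UNIV. of_int (n i) * y $ i) + 2 * pi * of_int k"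
    unfolding k[symmetric] by (simp add: algebra_simps sum_subtractf)
  then have "lchar n x = lchar n y * cis (2 * pi * of_int k)"
    unfolding lchar_def by (simp only: cis_mult)
  also have "cis (2 * pi * of_int k) = 1"
    by (simp add: cis_multiple_2pi)
  finally show ?thesis by simp
qed

lemma tchar_abs_torus [simp]: "tchar n (abs_torus x) = lchar n x"
  unfolding tchar_def lchar_def[symmetric] by (rule lchar_periodic) (rule rep_torus_abs_torus)

lemma tchar_comp_abs_torus [simp]: "tchar n \<circ> abs_torus = lchar n"
  by auto

lemma norm_tchar [simp]: "cmod (tchar n X) = 1"
  by (simp add: tchar_def)

lemma tchar_add: "tchar (m + n) X = tchar m X * tchar n X"
  by (simp add: tchar_def cis_mult sum.distrib algebra_simps)

lemma cnj_tchar: "cnj (tchar n X) = tchar (- n) X"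
  by (simp add: tchar_def cis_cnj sum_negf)

lemma tchar_0 [simp]: "tchar 0 X = 1"
  by (simp add: tchar_def)

lemma tchar_mult_cnj: "tchar m X * cnj (tchar n X) = tchar (m - n) X"
  by (simp add: cnj_tchar flip: tchar_add)

lemma has_derivative_lchar:
  fixes n :: "'n::finite \<Rightarrow> int"
  shows "(lchar n has_derivative (\<lambda>v. complex_of_real (2 * pi * (\<Sum>i\<in>UNIV. of_int (n i) * v $ i)) * \<i> * lchar n x)) (at x)"
proof -
  have "bounded_linear (\<lambda>x :: real ^ 'n. \<i> * complex_of_real (2 * pi * (\<Sum>i\<in>UNIV. of_int (n i) * x $ i)))"
    by (intro bounded_linear_const_mult bounded_linear_compose[OF bounded_linear_of_real] bounded_linear_sum
        bounded_linear_vec_nth)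
  from has_derivative_compose[OF bounded_linear_imp_has_derivative[OF this]
      DERIV_exp[unfolded has_field_derivative_def], of x UNIV]
  show ?thesis
    by (simp add: lchar_def[abs_def] cis_conv_exp mult_ac)
qed

lemma continuous_on_lchar [continuous_intros]: "continuous_on A (lchar n)"
  by (intro continuous_at_imp_continuous_on ballI has_derivative_continuous[OF has_derivative_lchar])

lemma differentiable_lchar: "lchar n differentiable (at x)"
  using has_derivative_lchar unfolding differentiable_def by blast

text \<open>The factor c allows iteration: the derivative is again a constant times
  \<open>lchar n\<close>, so second derivatives follow from the same rule.\<close>

lemma partial_deriv_lchar:
  "partial_deriv i (\<lambda>x. c * lchar n x) x = (c * complex_of_real (2 * pi * of_int (n i)) * \<i>) * lchar n x"
proof -
  have "((\<lambda>x. c * lchar n x) has_derivative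
    (\<lambda>v. c * (complex_of_real (2 * pi * (\<Sum>i\<in>UNIV. of_int (n i) * v $ i)) * \<i> * lchar n x))) (at x)"
    by (intro derivative_intros has_derivative_lchar)
  then have "frechet_derivative (\<lambda>x. c * lchar n x) (at x)
    = (\<lambda>v. c * (complex_of_real (2 * pi * (\<Sum>i\<in>UNIV. of_int (n i) * v $ i)) * \<i> * lchar n x))"
    by (rule frechet_derivative_at[symmetric])
  moreover have "(\<Sum>j\<in>UNIV. of_int (n j) * axis i 1 $ j) = (of_int (n i) :: real)"
    by (simp add: axis_def if_distrib sum.delta cong: if_cong)
  ultimately show ?thesis
    unfolding partial_deriv_def by (simp only: mult_ac)
qed

section \<open>Distance, continuity and compactness on the quotient\<close>

lemma dist_abs_torus_attained:
  obtains y where "Y = abs_torus y" "dist (abs_torus x) Y = dist x y"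
proof -
  have *: "dist (abs_torus x) Y = setdist {x} (torus_fibre Y)"
    by (simp only: dist_torus_def setdist_torus_fibre)
  \<comment> \<open>The fibre is closed, so its distance to x is attained. Thus every torus point
    has a representative that realises the geodesic distance to a given x.\<close>
  obtain y where y: "y \<in> torus_fibre Y" "infdist x (torus_fibre Y) = dist x y"
    by (rule infdist_attains_inf[OF closed_torus_fibre torus_fibre_nonempty])
  show ?thesis
  proof (rule that)
    show "Y = abs_torus y" using y(1) by simp
    show "dist (abs_torus x) Y = dist x y" unfolding * y(2)[symmetric] by (rule infdist_eq_setdist[symmetric])
  qed
qed

text \<open>A point near \<open>abs_torus x\<close> has a representative equally near to x, so a
  modulus of continuity of the lift at x serves on the torus as well.\<close>

lemma continuous_on_torus_lift:
  fixes f :: "'n::finite torus \<Rightarrow> 'b::metric_space"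
  assumes "continuous_on UNIV (f \<circ> abs_torus)"
  shows "continuous_on UNIV f"
  unfolding continuous_on_iff
proof (intro ballI allI impI)
  fix X :: "'n torus" and e :: real
  assume "e > 0"
  obtain x where X: "X = abs_torus x" by (cases X rule: torus_exhaust)
  obtain d where d: "d > 0" "\<And>y. dist y x < d \<Longrightarrow> dist (f (abs_torus y)) (f (abs_torus x)) < e"
    using assms \<open>e > 0\<close> unfolding continuous_on_iff by (auto simp: o_def) blast
  have "dist (f Y) (f X) < e" if "dist Y X < d" for Y
  proof -
    obtain y where y: "Y = abs_torus y" "dist (abs_torus x) Y = dist x y"
      by (rule dist_abs_torus_attained)
    then show ?thesis
      using d(2)[of y] that unfolding X y(1) by (simp add: dist_commute)
  qed
  then show "\<exists>d>0. \<forall>Y\<in>UNIV. dist Y X < d \<longrightarrow> dist (f Y) (f X) < e"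
    using d(1) by auto
qed

lemma continuous_on_tchar [continuous_intros]: "continuous_on A (tchar n)"
proof (rule continuous_on_subset[OF continuous_on_torus_lift])
  show "continuous_on UNIV (tchar n \<circ> abs_torus)"
    unfolding tchar_comp_abs_torus by (rule continuous_on_lchar)
qed (rule subset_UNIV)

text \<open>\<open>rep_torus\<close> is an arbitrary choice of representative, not confined to the
  unit cell; fractional parts normalise it.\<close>

definition frac_vec :: "real ^ 'n \<Rightarrow> real ^ 'n"
  where "frac_vec x = (\<chi> i. frac (x $ i))"

lemma abs_torus_frac_vec: "abs_torus (frac_vec x) = abs_torus x"
  by (rule abs_torus_eqI) (simp add: frac_vec_def frac_def)

lemma compact_torus: "compact (UNIV :: 'n::finite torus set)"
proof -
  have "X \<in> abs_torus ` cbox 0 1" for X :: "'n torus"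
  proof (cases X rule: torus_exhaust)
    case (1 x)
    have "frac_vec x \<in> cbox 0 1"
      by (auto simp: mem_box_cart frac_vec_def less_imp_le frac_lt_1)
    then show ?thesis
      using 1 abs_torus_frac_vec[of x] by (metis imageI)
  qed
  then have "(UNIV :: 'n torus set) = abs_torus ` cbox 0 1"
    by auto
  then show ?thesis
    by (metis compact_continuous_image continuous_on_abs_torus compact_cbox)
qed

section \<open>The volume measure and integration over the unit cube\<close>

abbreviation unit_cell :: "(real ^ 'n::finite) set"
  where "unit_cell \<equiv> {x. \<forall>i. 0 \<le> x $ i \<and> x $ i < 1}"

lemma half_open_cell_borel: "{x :: real ^ 'n::finite. \<forall>i. a $ i \<le> x $ i \<and> x $ i < b $ i} \<in> sets borel"
  by measurable

text \<open>The half-open cell lies between the open and the closed box, which have equal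
  measure.\<close>

lemma emeasure_half_open_cell:
  fixes a b :: "real ^ 'n::finite"
  assumes "\<And>i. a $ i \<le> b $ i"
  shows "emeasure lborel {x. \<forall>i. a $ i \<le> x $ i \<and> x $ i < b $ i} = ennreal (\<Prod>i\<in>UNIV. b $ i - a $ i)"
proof -
  let ?H = "{x. \<forall>i. a $ i \<le> x $ i \<and> x $ i < b $ i}"
  have ne: "cbox a b \<noteq> {}"
    using assms by (simp add: interval_ne_empty_cart)
  have c: "emeasure lborel (cbox a b) = ennreal (\<Prod>i\<in>UNIV. b $ i - a $ i)"
    using content_cbox_cart[OF ne] emeasure_eq_ennreal_measure[of lborel "cbox a b"]
      emeasure_lborel_cbox_finite[of a b] by simp
  have o: "emeasure lborel (box a b) = emeasure lborel (cbox a b)"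
    by (simp add: emeasure_lborel_box_eq emeasure_lborel_cbox_eq)
  have "emeasure lborel ?H \<le> emeasure lborel (cbox a b)"
    by (intro emeasure_mono) (auto simp: mem_box_cart less_imp_le)
  moreover have "emeasure lborel (box a b) \<le> emeasure lborel ?H"
    using half_open_cell_borel[of a b] by (intro emeasure_mono) (auto simp: mem_box_cart less_imp_le)
  ultimately show ?thesis
    using c o by auto
qed

lemma sets_torus_vol [simp, measurable_cong]: "sets torus_vol = sets borel"
  by (simp add: torus_vol_def)

lemma space_torus_vol [simp]: "space torus_vol = UNIV"
  by (simp add: torus_vol_def)

lemma emeasure_torus_vol:
  assumes "A \<in> sets borel"
  shows "emeasure torus_vol A = emeasure lborel ((abs_torus -` A) \<inter> unit_cell)"
proof -
  have "emeasure torus_vol A = emeasure (restrict_space lborel unit_cell) (abs_torus -` A \<inter> unit_cell)"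
    unfolding torus_vol_def using assms measurable_abs_torus
    by (subst emeasure_distr) (auto simp: space_restrict_space)
  also have "\<dots> = emeasure lborel ((abs_torus -` A) \<inter> unit_cell)"
    by (rule emeasure_restrict_space) auto
  finally show ?thesis .
qed

lemma emeasure_torus_vol_UNIV: "emeasure torus_vol (UNIV :: 'n::finite torus set) = 1"
  using emeasure_half_open_cell[of "0 :: real ^ 'n" 1] by (simp add: emeasure_torus_vol)

lemma measure_torus_vol_UNIV [simp]: "measure torus_vol (UNIV :: 'n::finite torus set) = 1"
  by (simp add: measure_def emeasure_torus_vol_UNIV)

interpretation TV: finite_measure "torus_vol :: 'n::finite torus measure"
  by standard (simp add: emeasure_torus_vol_UNIV)

lemma measurable_torus_vol_eq [simp]: "measurable torus_vol N = measurable borel N"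
  by (rule measurable_cong_sets) auto

lemma integrable_torus_vol:
  fixes f :: "'n::finite torus \<Rightarrow> 'b::{banach, second_countable_topology}"
  assumes "continuous_on UNIV f"
  shows "integrable torus_vol f"
proof -
  have "bounded (range f)"
    using compact_torus assms compact_continuous_image compact_imp_bounded by blast
  then obtain B where "\<And>X. norm (f X) \<le> B"
    by (auto simp: bounded_iff)
  then show ?thesis
    using assms by (intro TV.integrable_const_bound[of _ B]) (auto intro: borel_measurable_continuous_onI)
qed

text \<open>The fundamental domain differs from the closed cube by a null set. On the closed cube
  the gauge integral is at hand, for which translation, splitting and the Leibniz rule are applied
  below.\<close>

lemma integral_torus_vol:
  fixes f :: "'n::finite torus \<Rightarrow> 'b::euclidean_space"
  assumes "continuous_on UNIV f"
  shows "(LINT X|torus_vol. f X) = integral (cbox 0 1) (f \<circ> abs_torus)"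
proof -
  let ?F = "f \<circ> abs_torus"
  have cont: "continuous_on A ?F" for A
    by (rule continuous_on_compose[OF continuous_on_abs_torus]) (rule continuous_on_subset[OF assms], simp)
  have "(LINT X|torus_vol. f X) = (LINT x|restrict_space lborel unit_cell. ?F x)"
    unfolding torus_vol_def using assms
    by (subst integral_distr[OF measurable_abs_torus]) (simp_all add: o_def borel_measurable_continuous_onI)
  also have "\<dots> = (LINT x:unit_cell|lborel. ?F x)"
    by (subst integral_restrict_space) (auto simp: set_lebesgue_integral_def)
  also have "\<dots> = (LINT x:cbox 0 1|lborel. ?F x)"
  proof -
    have sub: "unit_cell \<subseteq> cbox 0 (1 :: real ^ 'n)"
      by (auto simp: mem_box_cart less_imp_le)
    have "emeasure lborel (cbox 0 (1 :: real ^ 'n) - unit_cell) = 0"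
    proof -
      have "emeasure lborel (cbox 0 (1 :: real ^ 'n)) = 1"
        using content_cbox_cart[of "0 :: real ^ 'n" 1] emeasure_eq_ennreal_measure[of lborel "cbox 0 (1 :: real ^ 'n)"]
          emeasure_lborel_cbox_finite[of 0 "1 :: real ^ 'n"] by (simp add: interval_ne_empty_cart)
      moreover have "emeasure lborel (unit_cell :: (real ^ 'n) set) = 1"
        using emeasure_half_open_cell[of "0 :: real ^ 'n" 1] by simp
      ultimately show ?thesis
        using sub by (subst emeasure_Diff) auto
    qed
    then have "AE x in lborel. x \<in> unit_cell \<longleftrightarrow> x \<in> cbox 0 (1 :: real ^ 'n)"
      using sub by (intro AE_I[where N = "cbox 0 1 - unit_cell"]) auto
    then show ?thesis
      unfolding set_lebesgue_integral_def
      using borel_measurable_continuous_onI[OF cont]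
      by (intro integral_cong_AE borel_measurable_scaleR borel_measurable_indicator)
        (auto simp: indicator_def o_def)
  qed
  also have "\<dots> = integral (cbox 0 1) ?F"
    using cont by (intro set_borel_integral_eq_integral(2) borel_integrable_compact[unfolded set_integrable_def[symmetric]]) (auto simp: set_integrable_def intro!: borel_integrable_compact)
  finally show ?thesis .
qed

section \<open>Translation invariance and vanishing integrals of derivatives\<close>

lemma integral_cube_shift:
  fixes F :: "real ^ 'n::finite \<Rightarrow> 'b::banach"
  assumes cont: "continuous_on UNIV F" and per: "\<And>x. F (x + axis i 1) = F x"
    and t: "0 \<le> t" "t \<le> 1"
  shows "integral (cbox 0 1) (\<lambda>x. F (x + t *\<^sub>R axis i 1)) = integral (cbox 0 1) F"
proof -
  let ?e = "axis i 1 :: real ^ 'n" and ?v = "t *\<^sub>R axis i 1 :: real ^ 'n"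
  have e: "?e \<in> Basis" by simp
  have in_e: "x \<bullet> ?e = x $ i" for x by (simp add: inner_axis)
  have int: "F integrable_on cbox a b" for a b
    by (rule integrable_continuous) (rule continuous_on_subset[OF cont], simp)
  have v: "?v $ j = (if j = i then t else 0)" "?e $ j = (if j = i then 1 else 0)" for j
    by (auto simp: axis_def)
  have "integral (cbox 0 1) (\<lambda>x. F (x + ?v)) = integral (cbox ?v (1 + ?v)) F"
    using integral_shift_cbox_plus[of 0 1 F ?v] by (simp add: o_def add.commute)
  \<comment> \<open>The shifted cube is cut at x_i = 1. The slab beyond the cut, moved back by one
    period, fills exactly the part of the unit cube that the shift has left uncovered.\<close>
  also have "\<dots> = integral (cbox ?v (1 + ?v) \<inter> {x. x \<bullet> ?e \<le> 1}) F
      + integral (cbox ?v (1 + ?v) \<inter> {x. x \<bullet> ?e \<ge> 1}) F"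
    by (rule integral_split[OF int e])
  also have "cbox ?v (1 + ?v) \<inter> {x. x \<bullet> ?e \<le> 1} = cbox 0 1 \<inter> {x. x \<bullet> ?e \<ge> t}"
  proof (intro set_eqI)
    fix x
    show "x \<in> cbox ?v (1 + ?v) \<inter> {x. x \<bullet> ?e \<le> 1} \<longleftrightarrow> x \<in> cbox 0 1 \<inter> {x. x \<bullet> ?e \<ge> t}"
      using t unfolding Int_iff mem_box_cart mem_Collect_eq in_e vector_add_component v one_index zero_index
      by (smt (verit))
  qed
  also have "cbox ?v (1 + ?v) \<inter> {x. x \<bullet> ?e \<ge> 1} = cbox ?e (1 + ?v)"
  proof (intro set_eqI)
    fix x
    show "x \<in> cbox ?v (1 + ?v) \<inter> {x. x \<bullet> ?e \<ge> 1} \<longleftrightarrow> x \<in> cbox ?e (1 + ?v)"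
      using t unfolding Int_iff mem_box_cart mem_Collect_eq in_e vector_add_component v one_index
      by (smt (verit))
  qed
  also have "cbox ?e (1 + ?v) = cbox (0 + ?e) ((1 + ?v - ?e) + ?e)" by simp
  also have "integral \<dots> F = integral (cbox 0 (1 + ?v - ?e)) (F \<circ> ((+) ?e))"
    by (rule integral_shift_cbox_plus[symmetric])
  also have "F \<circ> ((+) ?e) = F"
    using per by (auto simp: add.commute)
  also have "cbox 0 (1 + ?v - ?e) = cbox 0 1 \<inter> {x. x \<bullet> ?e \<le> t}"
  proof (intro set_eqI)
    fix x
    show "x \<in> cbox 0 (1 + ?v - ?e) \<longleftrightarrow> x \<in> cbox 0 1 \<inter> {x. x \<bullet> ?e \<le> t}"
      using t unfolding Int_iff mem_box_cart mem_Collect_eq in_e vector_add_component vector_minus_component v one_index zero_index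
      by (smt (verit))
  qed
  also have "integral (cbox 0 1 \<inter> {x. x \<bullet> ?e \<ge> t}) F + integral (cbox 0 1 \<inter> {x. x \<bullet> ?e \<le> t}) F
    = integral (cbox 0 1) F"
    using integral_split[OF int e, of 0 1 t] by (simp add: add.commute)
  finally show ?thesis .
qed

text \<open>The function t -> integral of G(x + t e_i) is constant by periodicity, and by the
  Leibniz rule its derivative at t = 0 is the integral in question. No boundary terms
  appear.\<close>

lemma integral_partial_deriv_eq_0:
  fixes G :: "real ^ 'n::finite \<Rightarrow> complex"
  assumes der: "\<And>x. (G has_derivative G' x) (at x)"
    and cont: "continuous_on UNIV (\<lambda>x. G' x (axis i 1))"
    and per: "\<And>x. G (x + axis i 1) = G x"
  shows "integral (cbox 0 1) (\<lambda>x. G' x (axis i 1)) = 0"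
proof -
  let ?e = "axis i 1 :: real ^ 'n"
  have contG: "continuous_on A G" for A
    by (intro continuous_at_imp_continuous_on ballI has_derivative_continuous[OF der])
  have "((\<lambda>t. integral (cbox 0 1) (\<lambda>x. G (x + t *\<^sub>R ?e))) has_vector_derivative
      integral (cbox 0 1) (\<lambda>x. G' (x + 0 *\<^sub>R ?e) ?e)) (at 0 within {0..1})"
  proof (rule leibniz_rule_vector_derivative)
    fix t x
    have "((\<lambda>t. x + t *\<^sub>R ?e) has_derivative (\<lambda>t. 0 + t *\<^sub>R ?e)) (at t within {0..1})"
      by (intro has_derivative_add has_derivative_const has_derivative_scaleR_left has_derivative_ident)
    from has_derivative_compose[OF this[unfolded add_0_left] der]
    have "((\<lambda>t. G (x + t *\<^sub>R ?e)) has_derivative (\<lambda>s. G' (x + t *\<^sub>R ?e) (s *\<^sub>R ?e))) (at t within {0..1})" .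
    moreover have "G' (x + t *\<^sub>R ?e) (s *\<^sub>R ?e) = s *\<^sub>R G' (x + t *\<^sub>R ?e) ?e" for s
      using der[THEN has_derivative_bounded_linear] by (rule linear_simps(5))
    ultimately show "((\<lambda>t. G (x + t *\<^sub>R ?e)) has_vector_derivative G' (x + t *\<^sub>R ?e) ?e) (at t within {0..1})"
      by (simp add: has_vector_derivative_def)
    show "(\<lambda>x. G (x + t *\<^sub>R ?e)) integrable_on cbox 0 1"
      by (rule integrable_continuous) (rule continuous_on_compose2[OF contG[of UNIV]], auto intro!: continuous_intros)
  next
    show "continuous_on ({0..1} \<times> cbox 0 1) (\<lambda>(t, x). G' (x + t *\<^sub>R ?e) ?e)"
      unfolding split_beta by (rule continuous_on_compose2[OF cont]) (auto intro!: continuous_intros)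
  qed auto
  moreover have "((\<lambda>t. integral (cbox 0 1) (\<lambda>x. G (x + t *\<^sub>R ?e))) has_vector_derivative 0) (at 0 within {0..1})"
  proof (rule has_vector_derivative_transform)
    show "((\<lambda>t::real. integral (cbox 0 1) G) has_vector_derivative 0) (at 0 within {0..1})"
      by (rule has_vector_derivative_const)
  next
    fix t :: real assume "t \<in> {0..1}"
    then show "integral (cbox 0 1) (\<lambda>x. G (x + t *\<^sub>R ?e)) = integral (cbox 0 1) G"
      using integral_cube_shift[OF contG per] by auto
  qed auto
  ultimately have "integral (cbox 0 1) (\<lambda>x. G' (x + 0 *\<^sub>R ?e) ?e) = 0"
    by (intro vector_derivative_unique_within) (auto simp: at_within_Icc_at_right)
  then show ?thesis by simp
qed

text \<open>If n_i is nonzero, then the partial derivative of the character in direction i is the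
  character times the nonzero constant 2 pi n_i \<i>, and the integral of a derivative
  vanishes.\<close>

lemma integral_tchar:
  "(LINT X|torus_vol. tchar n X) = (if n = 0 then 1 else 0)"
proof (cases "n = 0")
  case True
  then show ?thesis by simp
next
  case False
  then obtain i where i: "n i \<noteq> 0" by (auto simp: fun_eq_iff)
  define c where "c = complex_of_real (2 * pi * of_int (n i)) * \<i>"
  have s: "(\<Sum>j\<in>UNIV. of_int (n j) * axis i 1 $ j) = (of_int (n i) :: real)"
    by (simp add: axis_def if_distrib sum.delta cong: if_cong)
  have per: "lchar n (x + axis i 1) = lchar n x" for x
    by (rule lchar_periodic) (auto simp: axis_def)
  have "continuous_on UNIV (\<lambda>x. c * lchar n x)"
    by (intro continuous_on_mult continuous_on_const continuous_on_lchar)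
  then have "integral (cbox 0 1) (\<lambda>x. c * lchar n x) = 0"
    using integral_partial_deriv_eq_0[OF has_derivative_lchar[of n], of i] per
    unfolding s c_def by simp
  moreover have "c \<noteq> 0" using i by (simp add: c_def)
  ultimately show ?thesis
    using False by (simp add: integral_torus_vol continuous_on_tchar)
qed

section \<open>Completeness of the characters\<close>

definition trig_span :: "('n::finite torus \<Rightarrow> complex) set"
  where "trig_span = cfun.span (range tchar)"

lemma tchar_in_trig_span: "tchar n \<in> trig_span"
  unfolding trig_span_def by (rule cfun.span_base) simp

lemma trig_span_add:
  "f \<in> trig_span \<Longrightarrow> g \<in> trig_span \<Longrightarrow> (\<lambda>X. f X + g X) \<in> trig_span"
  unfolding trig_span_def using cfun.span_add[of f _ g] by (simp add: plus_fun_def)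

lemma trig_span_scale: "f \<in> trig_span \<Longrightarrow> (\<lambda>X. c * f X) \<in> trig_span"
  unfolding trig_span_def using cfun.span_scale[of f _ c] by (simp add: cscale_def)

text \<open>The zero function has no case of its own: it is covered by scaling
  \<open>tchar 0\<close> with the factor 0.\<close>

lemma trig_span_induct [consumes 1, case_names tchar add scale]:
  assumes "f \<in> trig_span"
    and "\<And>n. P (tchar n)"
    and add: "\<And>f g. P f \<Longrightarrow> P g \<Longrightarrow> P (\<lambda>X. f X + g X)"
    and scale: "\<And>c f. P f \<Longrightarrow> P (\<lambda>X. c * f X)"
  shows "P f"
  using assms(1) unfolding trig_span_def
proof (rule cfun.span_induct)
  show "cfun.subspace {f. P f}"
    unfolding cfun.subspace_def
    using scale[of "tchar 0" 0] assms(2) add scale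
    by (auto simp: plus_fun_def zero_fun_def cscale_def)
qed (use assms(2) in auto)

lemma trig_span_mult:
  assumes "f \<in> trig_span" "g \<in> trig_span"
  shows "(\<lambda>X. f X * g X) \<in> trig_span"
  using assms(1)
proof (induction rule: trig_span_induct)
  case (tchar m)
  show ?case
    using assms(2)
  proof (induction rule: trig_span_induct)
    case (tchar n)
    show ?case using tchar_in_trig_span[of "m + n"] by (simp add: tchar_add[abs_def])
  next
    case (add f g)
    then show ?case using trig_span_add by (simp add: distrib_left)
  next
    case (scale c f)
    from trig_span_scale[OF this, of c] show ?case by (simp add: mult.left_commute)
  qed
next
  case (add f1 f2)
  then show ?case using trig_span_add by (simp add: distrib_right)
next
  case (scale c f)
  from trig_span_scale[OF this, of c] show ?case by (simp add: mult.assoc)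
qed

lemma continuous_on_trig_span:
  assumes "f \<in> trig_span" shows "continuous_on A f"
  using assms
proof (induction rule: trig_span_induct)
  case (tchar n)
  show ?case by (rule continuous_on_tchar)
next
  case (add f g)
  then show ?case by (rule continuous_on_add)
next
  case (scale c f)
  then show ?case by (intro continuous_on_mult continuous_on_const)
qed

text \<open>Stone-Weierstrass is applied to a real algebra, so the trigonometric polynomials enter
  through those that are real-valued.\<close>

definition real_trig :: "('n::finite torus \<Rightarrow> real) set"
  where "real_trig = {g. (\<lambda>X. complex_of_real (g X)) \<in> trig_span}"

lemma Re_tchar_real_trig: "(\<lambda>X. Re (tchar n X)) \<in> real_trig"
proof -
  have "(\<lambda>X. (1 / 2) * (tchar n X + tchar (- n) X)) \<in> trig_span"
    by (intro trig_span_scale trig_span_add tchar_in_trig_span)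
  moreover have "(1 / 2) * (tchar n X + tchar (- n) X) = complex_of_real (Re (tchar n X))" for X
    by (simp add: complex_add_cnj flip: cnj_tchar)
  ultimately show ?thesis by (simp add: real_trig_def)
qed

lemma Im_tchar_real_trig: "(\<lambda>X. Im (tchar n X)) \<in> real_trig"
proof -
  have "(\<lambda>X. (- \<i> / 2) * (tchar n X + (- 1) * tchar (- n) X)) \<in> trig_span"
    by (intro trig_span_scale trig_span_add tchar_in_trig_span)
  moreover have "(- \<i> / 2) * (tchar n X + (- 1) * tchar (- n) X) = complex_of_real (Im (tchar n X))" for X
    by (simp add: complex_eq_iff flip: cnj_tchar)
  ultimately show ?thesis by (simp add: real_trig_def)
qed

interpretation real_trig: function_ring_on "real_trig :: ('n::finite torus \<Rightarrow> real) set" UNIV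
proof
  show "compact (UNIV :: 'n torus set)" by (rule compact_torus)
next
  fix f :: "'n torus \<Rightarrow> real" assume "f \<in> real_trig"
  then have "continuous_on UNIV (\<lambda>X. Re (complex_of_real (f X)))"
    unfolding real_trig_def by (intro continuous_on_Re continuous_on_trig_span) simp
  then show "continuous_on UNIV f" by simp
next
  fix f g :: "'n torus \<Rightarrow> real" assume "f \<in> real_trig" "g \<in> real_trig"
  then show "(\<lambda>x. f x + g x) \<in> real_trig" "(\<lambda>x. f x * g x) \<in> real_trig"
    unfolding real_trig_def using trig_span_add trig_span_mult by (simp_all add: trig_span_add trig_span_mult)
next
  fix c :: real
  show "(\<lambda>_. c) \<in> (real_trig :: ('n torus \<Rightarrow> real) set)"
    unfolding real_trig_def using trig_span_scale[OF tchar_in_trig_span[of 0], of "complex_of_real c"] by simp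
next
  fix X Y :: "'n torus" assume "X \<noteq> Y"
  obtain x y where xy: "X = abs_torus x" "Y = abs_torus y"
    by (cases X rule: torus_exhaust, cases Y rule: torus_exhaust) auto
  obtain i where i: "x $ i - y $ i \<notin> \<int>"
    using \<open>X \<noteq> Y\<close> abs_torus_eqI[of x y] xy by auto
  \<comment> \<open>The unit frequency in a direction where x and y differ modulo 1: equal sine and
    cosine of 2 pi x_i and 2 pi y_i would force x_i - y_i to be an integer.\<close>
  define n :: "'n \<Rightarrow> int" where "n = (\<lambda>j. if j = i then 1 else 0)"
  have *: "tchar n (abs_torus z) = cis (2 * pi * z $ i)" for z
    by (simp add: lchar_def n_def if_distrib[of real_of_int] if_distrib[of "\<lambda>a. a * _"] cong: if_cong)
  show "\<exists>f\<in>real_trig. f X \<noteq> f Y"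
  proof (rule ccontr)
    assume "\<not> ?thesis"
    then have "sin (2 * pi * x $ i) = sin (2 * pi * y $ i) \<and> cos (2 * pi * x $ i) = cos (2 * pi * y $ i)"
      using Re_tchar_real_trig[of n] Im_tchar_real_trig[of n] unfolding xy
      by (metis (no_types, lifting) * cis.sel)
    then obtain k :: int where "2 * pi * x $ i = 2 * pi * y $ i + 2 * pi * k"
      unfolding sin_cos_eq_iff by blast
    then have "2 * pi * (x $ i - y $ i) = 2 * pi * k" by (simp add: algebra_simps)
    then show False using i by simp
  qed
qed

text \<open>With g uniformly within e of u, orthogonality turns the integral of u^2 into that of u
  (u - g), which is at most e times the integral of |u|. As e is arbitrary, the continuous function
  u^2 has integral 0 and vanishes.\<close>

lemma eq_0_if_orthogonal_real_trig:
  fixes u :: "'n::finite torus \<Rightarrow> real"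
  assumes cont: "continuous_on UNIV u"
    and orth: "\<And>g. g \<in> real_trig \<Longrightarrow> (LINT X|torus_vol. u X * g X) = 0"
  shows "u X = 0"
proof -
  let ?I = "LINT X|torus_vol. u X * u X"
  have cuu: "continuous_on UNIV (\<lambda>X. u X * u X)"
    using cont by (intro continuous_on_mult)
  have le: "?I \<le> e * (LINT X|torus_vol. \<bar>u X\<bar>)" if "e > 0" for e
  proof -
    obtain g where g: "g \<in> real_trig" "\<And>X. \<bar>u X - g X\<bar> < e"
      using real_trig.Stone_Weierstrass_basic[OF cont \<open>e > 0\<close>] by auto
    have cg: "continuous_on UNIV g"
      using g(1) by (rule real_trig.continuous)
    have "?I = (LINT X|torus_vol. u X * u X) - (LINT X|torus_vol. u X * g X)"
      using orth[OF g(1)] by simp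
    also have "\<dots> = (LINT X|torus_vol. u X * u X - u X * g X)"
      using cont cg by (intro Bochner_Integration.integral_diff[symmetric] integrable_torus_vol continuous_on_mult)
    also have "\<dots> \<le> (LINT X|torus_vol. e * \<bar>u X\<bar>)"
    proof (rule integral_mono)
      fix X
      have "u X * u X - u X * g X \<le> \<bar>u X\<bar> * \<bar>u X - g X\<bar>"
        by (metis abs_ge_self abs_mult right_diff_distrib)
      also have "\<dots> \<le> \<bar>u X\<bar> * e" using g(2)[of X] by (intro mult_left_mono) auto
      finally show "u X * u X - u X * g X \<le> e * \<bar>u X\<bar>" by (simp add: mult.commute)
    qed (use cont cg in \<open>auto intro!: integrable_torus_vol continuous_on_mult continuous_on_diff continuous_on_const continuous_on_rabs\<close>)
    finally show ?thesis by simp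
  qed
  have "?I \<le> 0"
  proof (rule ccontr)
    assume "\<not> ?I \<le> 0"
    \<comment> \<open>The choice e = ?I / (2 (A + 1)) gives e A < ?I; the added 1 covers the case A
      = 0.\<close>
    define A where "A = (LINT X|torus_vol. \<bar>u X\<bar>)"
    have "A \<ge> 0" unfolding A_def by simp
    then have "A / (2 * (A + 1)) < 1" by simp
    then have "?I * (A / (2 * (A + 1))) < ?I * 1"
      using \<open>\<not> ?I \<le> 0\<close> by (intro mult_strict_left_mono) auto
    then have "(?I / (2 * (A + 1))) * A < ?I" by simp
    then show False
      using le[of "?I / (2 * (A + 1))"] \<open>\<not> ?I \<le> 0\<close> \<open>A \<ge> 0\<close> unfolding A_def by auto
  qed
  moreover have "?I \<ge> 0" by simp
  ultimately have "integral (cbox 0 1) ((\<lambda>X. u X * u X) \<circ> abs_torus) = 0"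
    using integral_torus_vol[OF cuu] by simp
  moreover have cont': "continuous_on (cbox 0 1) ((\<lambda>X. u X * u X) \<circ> abs_torus)"
    by (rule continuous_on_compose[OF continuous_on_abs_torus]) (rule continuous_on_subset[OF cuu], simp)
  ultimately have "(((\<lambda>X. u X * u X) \<circ> abs_torus) has_integral 0) (cbox 0 1)"
    using integrable_continuous by (metis has_integral_iff)
  then have z: "((\<lambda>X. u X * u X) \<circ> abs_torus) x = 0" if "x \<in> cbox 0 1" for x
    using has_integral_0_cbox_imp_0[OF cont', of x] that
    by (simp add: interval_ne_empty_cart)
  obtain x where "X = abs_torus x" by (cases X rule: torus_exhaust)
  moreover have "frac_vec x \<in> cbox 0 1"
    by (auto simp: mem_box_cart frac_vec_def less_imp_le frac_lt_1)
  ultimately show ?thesis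
    using z[of "frac_vec x"] by (simp add: abs_torus_frac_vec)
qed

text \<open>Since \<open>trig_span\<close> contains \<open>tchar (- n)\<close> along with
  \<open>tchar n\<close>, the orthogonality can be written without conjugation. Testing with real g
  then separates real and imaginary parts of f.\<close>

lemma eq_0_if_fourier_coeffs_0:
  fixes f :: "'n::finite torus \<Rightarrow> complex"
  assumes cont: "continuous_on UNIV f" and coeff: "\<And>n. L2_inner f (tchar n) = 0"
  shows "f = 0"
proof -
  have orth: "integrable torus_vol (\<lambda>X. f X * p X) \<and> (LINT X|torus_vol. f X * p X) = 0" if "p \<in> trig_span" for p
    using that
  proof (induction rule: trig_span_induct)
    case (tchar n)
    have "integrable torus_vol (\<lambda>X. f X * tchar n X)"
      by (intro integrable_torus_vol continuous_on_mult cont continuous_on_tchar)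
    then show ?case using coeff[of "- n"] by (simp add: L2_inner_def cnj_tchar)
  next
    case (add p q)
    then show ?case by (simp add: distrib_left)
  next
    case (scale c p)
    then show ?case by (simp add: mult.left_commute[of _ c])
  qed
  have Re: "(LINT X|torus_vol. Re (f X) * g X) = 0" and Im: "(LINT X|torus_vol. Im (f X) * g X) = 0"
    if "g \<in> real_trig" for g
  proof -
    have *: "integrable torus_vol (\<lambda>X. f X * complex_of_real (g X))"
      "(LINT X|torus_vol. f X * complex_of_real (g X)) = 0"
      using orth that unfolding real_trig_def by auto
    show "(LINT X|torus_vol. Re (f X) * g X) = 0"
      using integral_Re[OF *(1)] *(2) by simp
    show "(LINT X|torus_vol. Im (f X) * g X) = 0"
      using integral_Im[OF *(1)] *(2) by simp
  qed
  have "Re (f X) = 0" for X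
    by (rule eq_0_if_orthogonal_real_trig[OF continuous_on_Re[OF cont] Re])
  moreover have "Im (f X) = 0" for X
    by (rule eq_0_if_orthogonal_real_trig[OF continuous_on_Im[OF cont] Im])
  ultimately show ?thesis
    by (simp add: fun_eq_iff complex_eq_iff)
qed

section \<open>Eigenfunctions are trigonometric polynomials\<close>

definition nsq :: "('n::finite \<Rightarrow> int) \<Rightarrow> real"
  where "nsq n = (\<Sum>i\<in>UNIV. (of_int (n i))\<^sup>2)"

lemma card_Pi_UNIV:
  fixes A :: "'n::finite \<Rightarrow> 'b set"
  assumes "\<And>i. finite (A i)"
  shows "finite {f. \<forall>i. f i \<in> A i}" "card {f. \<forall>i. f i \<in> A i} = (\<Prod>i\<in>UNIV. card (A i))"
proof -
  have "{f. \<forall>i. f i \<in> A i} = PiE UNIV A"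
    by (auto simp: PiE_UNIV_domain)
  then show "finite {f. \<forall>i. f i \<in> A i}" "card {f. \<forall>i. f i \<in> A i} = (\<Prod>i\<in>UNIV. card (A i))"
    using assms by (simp_all add: finite_PiE card_PiE)
qed

lemma abs_le_sqrt_nsq: "\<bar>real_of_int (n i)\<bar> \<le> sqrt (nsq n)"
proof -
  have "(real_of_int (n i))\<^sup>2 \<le> nsq n"
    unfolding nsq_def by (rule member_le_sum) auto
  then show ?thesis
    using real_le_rsqrt by fastforce
qed

lemma finite_nsq_le: "finite {n :: 'n::finite \<Rightarrow> int. nsq n \<le> B}"
proof (rule finite_subset)
  show "{n :: 'n \<Rightarrow> int. nsq n \<le> B} \<subseteq> {n. \<forall>i. n i \<in> {- \<lceil>sqrt B\<rceil>..\<lceil>sqrt B\<rceil>}}"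
  proof clarify
    fix n :: "'n \<Rightarrow> int" and i
    assume "nsq n \<le> B"
    then have "\<bar>real_of_int (n i)\<bar> \<le> sqrt B"
      using abs_le_sqrt_nsq[of n i] real_sqrt_le_mono[of "nsq n" B] by linarith
    also have "\<dots> \<le> of_int \<lceil>sqrt B\<rceil>" by simp
    finally show "n i \<in> {- \<lceil>sqrt B\<rceil>..\<lceil>sqrt B\<rceil>}"
      unfolding atLeastAtMost_iff by linarith
  qed
  show "finite {n :: 'n \<Rightarrow> int. \<forall>i. n i \<in> {- \<lceil>sqrt B\<rceil>..\<lceil>sqrt B\<rceil>}}"
    by (rule card_Pi_UNIV) simp
qed

lemma C2_torus_lift_deriv:
  assumes "C2_torus f"
  shows "((f \<circ> abs_torus) has_derivative frechet_derivative (f \<circ> abs_torus) (at x)) (at x)"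
    and "(partial_deriv i (f \<circ> abs_torus) has_derivative
      frechet_derivative (partial_deriv i (f \<circ> abs_torus)) (at x)) (at x)"
    and "continuous_on A (partial_deriv j (partial_deriv i (f \<circ> abs_torus)))"
proof -
  note * = assms[unfolded C2_torus_def Let_def]
  show "((f \<circ> abs_torus) has_derivative frechet_derivative (f \<circ> abs_torus) (at x)) (at x)"
    "(partial_deriv i (f \<circ> abs_torus) has_derivative
      frechet_derivative (partial_deriv i (f \<circ> abs_torus)) (at x)) (at x)"
    using * unfolding differentiable_on_def frechet_derivative_works[symmetric] by auto
  show "continuous_on A (partial_deriv j (partial_deriv i (f \<circ> abs_torus)))"
    using * by (blast intro: continuous_on_subset)
qed

lemma partial_deriv_periodic:
  assumes der: "\<And>x. F differentiable (at x)" and per: "\<And>x. F (x + v) = F x"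
  shows "partial_deriv i F (x + v) = partial_deriv i F x"
proof -
  have "(F has_derivative frechet_derivative F (at (x + v))) (at (x + v))"
    using der frechet_derivative_works by blast
  moreover have "((\<lambda>x. x + v) has_derivative (\<lambda>y. y)) (at x)"
    by (rule has_derivative_add_const[OF has_derivative_ident])
  ultimately have "((\<lambda>x. F (x + v)) has_derivative frechet_derivative F (at (x + v))) (at x)"
    using has_derivative_compose[of "\<lambda>x. x + v" "\<lambda>y. y" x UNIV F] by simp
  then have "frechet_derivative F (at (x + v)) = frechet_derivative F (at x)"
    unfolding per by (rule frechet_derivative_at)
  then show ?thesis
    by (simp add: partial_deriv_def)
qed

lemma C2_torus_periodic:
  assumes f: "C2_torus f" and v: "\<And>i. v $ i \<in> \<int>"
  shows "(f \<circ> abs_torus) (x + v) = (f \<circ> abs_torus) x"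
    and "partial_deriv i (f \<circ> abs_torus) (x + v) = partial_deriv i (f \<circ> abs_torus) x"
    and "partial_deriv j (partial_deriv i (f \<circ> abs_torus)) (x + v)
      = partial_deriv j (partial_deriv i (f \<circ> abs_torus)) x"
proof -
  have 1: "(f \<circ> abs_torus) (x + v) = (f \<circ> abs_torus) x" for x
    using abs_torus_eqI[of "x + v" x] v by simp
  have 2: "partial_deriv i (f \<circ> abs_torus) (x + v) = partial_deriv i (f \<circ> abs_torus) x" for x
    by (rule partial_deriv_periodic[where F = "f \<circ> abs_torus", OF _ 1])
      (use C2_torus_lift_deriv(1)[OF f] in \<open>auto simp: differentiable_def\<close>)
  have 3: "partial_deriv j (partial_deriv i (f \<circ> abs_torus)) (x + v)
      = partial_deriv j (partial_deriv i (f \<circ> abs_torus)) x"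
    by (rule partial_deriv_periodic[where F = "partial_deriv i (f \<circ> abs_torus)", OF _ 2])
      (use C2_torus_lift_deriv(2)[OF f] in \<open>auto simp: differentiable_def\<close>)
  show "(f \<circ> abs_torus) (x + v) = (f \<circ> abs_torus) x"
    "partial_deriv i (f \<circ> abs_torus) (x + v) = partial_deriv i (f \<circ> abs_torus) x"
    "partial_deriv j (partial_deriv i (f \<circ> abs_torus)) (x + v)
      = partial_deriv j (partial_deriv i (f \<circ> abs_torus)) x"
    by (rule 1 2 3)+
qed

lemma laplacian_abs_torus:
  assumes "C2_torus f"
  shows "laplacian f (abs_torus x) = (\<Sum>i\<in>UNIV. partial_deriv i (partial_deriv i (f \<circ> abs_torus)) x)"
proof -
  let ?v = "rep_torus (abs_torus x) - x"
  have "partial_deriv i (partial_deriv i (f \<circ> abs_torus)) (x + ?v)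
      = partial_deriv i (partial_deriv i (f \<circ> abs_torus)) x" for i
    by (rule C2_torus_periodic(3)[OF assms]) (simp add: rep_torus_abs_torus)
  then show ?thesis
    unfolding laplacian_def by simp
qed

lemma continuous_on_C2_torus:
  assumes "C2_torus f" shows "continuous_on UNIV f"
  by (intro continuous_on_torus_lift continuous_at_imp_continuous_on ballI
      has_derivative_continuous[OF C2_torus_lift_deriv(1)[OF assms]])

text \<open>Green's identity in one step: for the lift F and the character e, the function (d_i F) e
  - F (d_i e) is periodic, and in its i-th derivative the mixed terms cancel. Only one derivative of
  d_i F is required, as \<open>C2_torus\<close> provides.\<close>

lemma integral_second_deriv_lchar:
  assumes f: "C2_torus f"
  shows "integral (cbox 0 1) (\<lambda>x. partial_deriv i (partial_deriv i (f \<circ> abs_torus)) x * lchar m x)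
    = - complex_of_real ((2 * pi * of_int (m i))\<^sup>2) * integral (cbox 0 1) (\<lambda>x. (f \<circ> abs_torus) x * lchar m x)"
proof -
  define c where "c = complex_of_real (2 * pi * of_int (m i)) * \<i>"
  define F where "F = f \<circ> abs_torus"
  define F1 where "F1 = partial_deriv i F"
  define F2 where "F2 = partial_deriv i F1"
  define L where "L = (\<lambda>x v. complex_of_real (2 * pi * (\<Sum>i\<in>UNIV. of_int (m i) * v $ i)) * \<i> * lchar m x)"
  have F: "(F has_derivative frechet_derivative F (at x)) (at x)"
    and F1: "(F1 has_derivative frechet_derivative F1 (at x)) (at x)"
    and F2: "continuous_on A F2" for x A
    unfolding F2_def F1_def F_def by (rule C2_torus_lift_deriv[OF f])+
  have contF: "continuous_on A F" for A
    by (intro continuous_at_imp_continuous_on ballI has_derivative_continuous[OF F])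
  define G' where "G' = (\<lambda>x v. (F1 x * L x v + frechet_derivative F1 (at x) v * lchar m x)
      - (F x * (c * L x v) + frechet_derivative F (at x) v * (c * lchar m x)))"
  have s: "(\<Sum>j\<in>UNIV. of_int (m j) * axis i 1 $ j) = (of_int (m i) :: real)"
    by (simp add: axis_def if_distrib sum.delta cong: if_cong)
  have Le: "L x (axis i 1) = c * lchar m x" for x
    unfolding L_def s c_def by simp
  have dL: "(lchar m has_derivative L x) (at x)" for x
    unfolding L_def by (rule has_derivative_lchar)
  have G'e: "G' x (axis i 1) = F2 x * lchar m x + complex_of_real ((2 * pi * of_int (m i))\<^sup>2) * (F x * lchar m x)" for x
  proof -
    have cc: "c * c = - complex_of_real ((2 * pi * of_int (m i))\<^sup>2)"
      by (simp add: c_def power2_eq_square algebra_simps)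
    have "G' x (axis i 1) = F1 x * (c * lchar m x) + F2 x * lchar m x - (F x * (c * (c * lchar m x)) + F1 x * (c * lchar m x))"
      unfolding G'_def Le F2_def F1_def by (simp add: partial_deriv_def[of i F] partial_deriv_def[of i "partial_deriv i F"])
    also have "\<dots> = F2 x * lchar m x - (c * c) * (F x * lchar m x)"
      by (simp add: algebra_simps)
    finally show ?thesis unfolding cc by simp
  qed
  have "integral (cbox 0 1) (\<lambda>x. G' x (axis i 1)) = 0"
  proof (rule integral_partial_deriv_eq_0)
    fix x
    show "((\<lambda>x. F1 x * lchar m x - F x * (c * lchar m x)) has_derivative G' x) (at x)"
      unfolding G'_def
      by (intro has_derivative_diff has_derivative_mult F F1 has_derivative_mult_right dL)
    have v: "axis i 1 $ j \<in> (\<int> :: real set)" for j by (simp add: axis_def)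
    have "lchar m (x + axis i 1) = lchar m x"
      by (rule lchar_periodic) (simp add: v)
    then show "F1 (x + axis i 1) * lchar m (x + axis i 1) - F (x + axis i 1) * (c * lchar m (x + axis i 1))
      = F1 x * lchar m x - F x * (c * lchar m x)"
      unfolding F1_def F_def C2_torus_periodic(1,2)[OF f v] by simp
  next
    show "continuous_on UNIV (\<lambda>x. G' x (axis i 1))"
      unfolding G'e by (intro continuous_on_add continuous_on_mult continuous_on_const contF F2 continuous_on_lchar)
  qed
  moreover have "integral (cbox 0 1) (\<lambda>x. G' x (axis i 1)) = integral (cbox 0 1) (\<lambda>x. F2 x * lchar m x)
     + integral (cbox 0 1) (\<lambda>x. complex_of_real ((2 * pi * of_int (m i))\<^sup>2) * (F x * lchar m x))"
    unfolding G'e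
    by (intro Henstock_Kurzweil_Integration.integral_add integrable_continuous continuous_on_mult continuous_on_const contF F2 continuous_on_lchar)
  ultimately show ?thesis
    unfolding F2_def F1_def F_def by (simp add: add_eq_0_iff2)
qed

text \<open>Moving the Laplacian onto the character multiplies the coefficient by 4 pi^2 h^2 |n|^2,
  while the eigenvalue equation multiplies it by E. So coefficients off one sphere vanish.\<close>

lemma eigenfunction_coeff:
  assumes "eigenfunction h E f"
  shows "complex_of_real (4 * pi\<^sup>2 * h\<^sup>2 * nsq n - E) * L2_inner f (tchar n) = 0"
proof -
  define F where "F = f \<circ> abs_torus"
  define I where "I = integral (cbox 0 1) (\<lambda>x. F x * lchar (- n) x)"
  define F2 where "F2 = (\<lambda>i. partial_deriv i (partial_deriv i F))"
  have f: "C2_torus f" and eq: "- (complex_of_real (h\<^sup>2) * laplacian f X) = complex_of_real E * f X" for X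
    using assms by (auto simp: eigenfunction_def)
  have cf: "continuous_on UNIV f" by (rule continuous_on_C2_torus[OF f])
  have cF2: "continuous_on A (F2 i)" for A i
    unfolding F2_def F_def by (rule C2_torus_lift_deriv(3)[OF f])
  have "L2_inner f (tchar n) = (LINT X|torus_vol. f X * tchar (- n) X)"
    by (simp add: L2_inner_def cnj_tchar)
  also have "\<dots> = I"
    by (subst integral_torus_vol) (auto simp: I_def F_def o_def intro!: continuous_on_mult cf continuous_on_tchar)
  finally have I: "L2_inner f (tchar n) = I" .
  have "complex_of_real E * I = integral (cbox 0 1) (\<lambda>x. complex_of_real E * F x * lchar (- n) x)"
    unfolding I_def by (simp add: mult.assoc)
  also have "(\<lambda>x. complex_of_real E * F x * lchar (- n) x)
      = (\<lambda>x. - complex_of_real (h\<^sup>2) * (\<Sum>i\<in>UNIV. F2 i x * lchar (- n) x))"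
  proof
    fix x
    have "complex_of_real E * F x = - (complex_of_real (h\<^sup>2) * (\<Sum>i\<in>UNIV. F2 i x))"
      using eq[of "abs_torus x"] unfolding laplacian_abs_torus[OF f] F2_def F_def by simp
    then show "complex_of_real E * F x * lchar (- n) x = - complex_of_real (h\<^sup>2) * (\<Sum>i\<in>UNIV. F2 i x * lchar (- n) x)"
      by (simp add: sum_distrib_right mult.assoc)
  qed
  also have "integral (cbox 0 1) (\<lambda>x. - complex_of_real (h\<^sup>2) * (\<Sum>i\<in>UNIV. F2 i x * lchar (- n) x))
      = - complex_of_real (h\<^sup>2) * (\<Sum>i\<in>UNIV. integral (cbox 0 1) (\<lambda>x. F2 i x * lchar (- n) x))"
    by (subst integral_mult_right, subst Henstock_Kurzweil_Integration.integral_sum)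
      (auto intro!: integrable_continuous continuous_on_mult cF2 continuous_on_lchar)
  also have "(\<Sum>i\<in>UNIV. integral (cbox 0 1) (\<lambda>x. F2 i x * lchar (- n) x))
     = (\<Sum>i\<in>UNIV. - complex_of_real ((2 * pi * of_int (n i))\<^sup>2) * I)"
    unfolding F2_def F_def I_def integral_second_deriv_lchar[OF f] by simp
  also have "\<dots> = - complex_of_real (4 * pi\<^sup>2 * nsq n) * I"
    by (simp add: nsq_def sum_distrib_left sum_distrib_right power_mult_distrib sum_negf)
  finally have "complex_of_real E * I = complex_of_real (4 * pi\<^sup>2 * h\<^sup>2 * nsq n) * I"
    by (simp add: mult_ac)
  then show ?thesis
    unfolding I of_real_diff left_diff_distrib by auto
qed

lemma L2_inner_tchar:
  assumes "continuous_on UNIV f"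
  shows "L2_inner (\<lambda>X. f X - (\<Sum>m\<in>S. c m * tchar m X)) (tchar n)
    = L2_inner f (tchar n) - (\<Sum>m\<in>S. c m * (if m = n then 1 else 0))"
proof -
  have int: "integrable torus_vol (\<lambda>X. c m * tchar (m - n) X)" for m
    by (intro integrable_torus_vol continuous_on_mult continuous_on_const continuous_on_tchar)
  have "L2_inner (\<lambda>X. f X - (\<Sum>m\<in>S. c m * tchar m X)) (tchar n)
    = (LINT X|torus_vol. f X * cnj (tchar n X) - (\<Sum>m\<in>S. c m * tchar (m - n) X))"
    unfolding L2_inner_def by (simp add: left_diff_distrib sum_distrib_right mult.assoc tchar_mult_cnj)
  also have "\<dots> = L2_inner f (tchar n) - (LINT X|torus_vol. (\<Sum>m\<in>S. c m * tchar (m - n) X))"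
    unfolding L2_inner_def cnj_tchar
  proof (rule Bochner_Integration.integral_diff)
    show "integrable torus_vol (\<lambda>X. f X * tchar (- n) X)"
      by (intro integrable_torus_vol continuous_on_mult assms continuous_on_tchar)
    show "integrable torus_vol (\<lambda>X. \<Sum>m\<in>S. c m * tchar (m - n) X)"
      by (intro Bochner_Integration.integrable_sum int)
  qed
  also have "(LINT X|torus_vol. (\<Sum>m\<in>S. c m * tchar (m - n) X)) = (\<Sum>m\<in>S. c m * (if m = n then 1 else 0))"
    using int by (simp add: Bochner_Integration.integral_sum integral_tchar)
  finally show ?thesis .
qed

text \<open>The remainder is continuous with vanishing Fourier coefficients, hence zero. S may be
  larger than the sphere of f, so that one set of frequencies serves all functions of an
  eigenbasis.\<close>

lemma eigenfunction_expansion: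
  assumes f: "eigenfunction h E f" and S: "finite S" "{n. 4 * pi\<^sup>2 * h\<^sup>2 * nsq n = E} \<subseteq> S"
  shows "f X = (\<Sum>n\<in>S. L2_inner f (tchar n) * tchar n X)"
proof -
  define g where "g = (\<lambda>X. f X - (\<Sum>m\<in>S. L2_inner f (tchar m) * tchar m X))"
  have cont: "continuous_on UNIV f"
    using f by (auto simp: eigenfunction_def intro: continuous_on_C2_torus)
  have "g = 0"
  proof (rule eq_0_if_fourier_coeffs_0)
    show "continuous_on UNIV g"
      unfolding g_def
      by (intro continuous_on_diff cont continuous_on_sum continuous_on_mult continuous_on_const continuous_on_tchar)
    fix n
    have "L2_inner f (tchar n) = 0" if "n \<notin> S"
      using eigenfunction_coeff[OF f, of n] S(2) that by (auto simp del: of_real_mult of_real_diff)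
    then show "L2_inner g (tchar n) = 0"
      unfolding g_def L2_inner_tchar[OF cont] using S(1)
      by (simp add: if_distrib[of "\<lambda>a. _ * a"] sum.delta cong: if_cong)
  qed
  then show ?thesis
    by (simp add: g_def fun_eq_iff)
qed

lemma partial_deriv_lchar_fun:
  "partial_deriv i (\<lambda>x. c * lchar n x) = (\<lambda>x. (c * complex_of_real (2 * pi * of_int (n i)) * \<i>) * lchar n x)"
  by (rule ext) (rule partial_deriv_lchar)

lemma eigenfunction_tchar: "eigenfunction h (4 * pi\<^sup>2 * h\<^sup>2 * nsq n) (tchar n)"
proof -
  have d1: "partial_deriv i (lchar n) = (\<lambda>x. (complex_of_real (2 * pi * of_int (n i)) * \<i>) * lchar n x)" for i
    using partial_deriv_lchar_fun[of i 1 n] by simp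
  have diff: "(\<lambda>x. c * lchar n x) differentiable_on UNIV" for c
    unfolding differentiable_on_def using differentiable_lchar by (auto intro: differentiable_mult)
  have C2: "C2_torus (tchar n)"
    unfolding C2_torus_def Let_def tchar_comp_abs_torus d1 partial_deriv_lchar_fun
    using diff diff[of 1] by (auto intro!: continuous_on_mult continuous_on_const continuous_on_lchar)
  have "laplacian (tchar n) X = - complex_of_real (4 * pi\<^sup>2 * nsq n) * tchar n X" for X
  proof -
    obtain x where X: "X = abs_torus x" by (cases X rule: torus_exhaust)
    have "laplacian (tchar n) X = (\<Sum>i\<in>UNIV. - complex_of_real (4 * pi\<^sup>2 * (of_int (n i))\<^sup>2) * lchar n x)"
      unfolding X laplacian_abs_torus[OF C2] tchar_comp_abs_torus d1 partial_deriv_lchar_fun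
      by (intro sum.cong) (auto simp: power2_eq_square)
    also have "\<dots> = - complex_of_real (4 * pi\<^sup>2 * nsq n) * tchar n X"
      by (simp add: X nsq_def sum_distrib_left sum_distrib_right sum_negf)
    finally show ?thesis .
  qed
  moreover have "tchar n \<noteq> 0"
  proof
    assume "tchar n = 0"
    then show False using norm_tchar[of n undefined] by simp
  qed
  ultimately show ?thesis
    using C2 by (simp add: eigenfunction_def)
qed

section \<open>The variance estimate\<close>

text \<open>A class that contains both indicators of cells and continuous functions, is closed under
  products, and consists of integrable functions; integrability conditions thus reduce to
  membership.\<close>

definition bdd_borel :: "('n::finite torus \<Rightarrow> complex) \<Rightarrow> bool"
  where "bdd_borel f \<longleftrightarrow> f \<in> borel_measurable borel \<and> (\<exists>B. \<forall>X. cmod (f X) \<le> B)"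

lemma bdd_borel_mult:
  assumes "bdd_borel f" "bdd_borel g"
  shows "bdd_borel (\<lambda>X. f X * g X)"
proof -
  obtain A B where AB: "\<And>X. cmod (f X) \<le> A" "\<And>X. cmod (g X) \<le> B"
    using assms unfolding bdd_borel_def by blast
  have "cmod (f X * g X) \<le> A * B" for X
    unfolding norm_mult by (rule mult_mono') (auto simp: AB)
  moreover have "(\<lambda>X. f X * g X) \<in> borel_measurable borel"
    using assms unfolding bdd_borel_def by (intro borel_measurable_times) auto
  ultimately show ?thesis
    unfolding bdd_borel_def by blast
qed

lemma bdd_borel_cnj: "bdd_borel f \<Longrightarrow> bdd_borel (\<lambda>X. cnj (f X))"
  unfolding bdd_borel_def complex_mod_cnj
  using borel_measurable_continuous_on[OF continuous_on_cnj[OF continuous_on_id], of f borel] by auto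

lemma bdd_borel_diff:
  assumes "bdd_borel f" "bdd_borel g"
  shows "bdd_borel (\<lambda>X. f X - g X)"
proof -
  obtain A B where AB: "\<And>X. cmod (f X) \<le> A" "\<And>X. cmod (g X) \<le> B"
    using assms unfolding bdd_borel_def by blast
  have "cmod (f X - g X) \<le> A + B" for X
    using norm_triangle_ineq4[of "f X" "g X"] AB[of X] by linarith
  moreover have "(\<lambda>X. f X - g X) \<in> borel_measurable borel"
    using assms unfolding bdd_borel_def by (intro borel_measurable_diff) auto
  ultimately show ?thesis
    unfolding bdd_borel_def by blast
qed

lemma bdd_borel_const: "bdd_borel (\<lambda>X. c)"
  unfolding bdd_borel_def by auto

lemma bdd_borel_add:
  assumes "bdd_borel f" "bdd_borel g"
  shows "bdd_borel (\<lambda>X. f X + g X)"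
  using bdd_borel_diff[OF assms(1) bdd_borel_mult[OF bdd_borel_const[of "-1"] assms(2)]] by simp

lemma bdd_borel_sum: "(\<And>j. j \<in> J \<Longrightarrow> bdd_borel (f j)) \<Longrightarrow> bdd_borel (\<lambda>X. \<Sum>j\<in>J. f j X)"
  by (induction J rule: infinite_finite_induct) (auto intro: bdd_borel_const bdd_borel_add)

lemma bdd_borel_continuous:
  assumes "continuous_on UNIV f"
  shows "bdd_borel f"
proof -
  have "bounded (range f)"
    using compact_torus assms compact_continuous_image compact_imp_bounded by blast
  then show ?thesis
    using assms unfolding bdd_borel_def bounded_iff by (auto intro: borel_measurable_continuous_onI)
qed

lemma bdd_borel_tchar: "bdd_borel (tchar n)"
  by (rule bdd_borel_continuous) (rule continuous_on_tchar)

lemma integrable_bdd_borel: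
  assumes "bdd_borel f" shows "integrable torus_vol f"
proof -
  obtain B where "f \<in> borel_measurable borel" "\<And>X. cmod (f X) \<le> B"
    using assms unfolding bdd_borel_def by blast
  then show ?thesis by (intro TV.integrable_const_bound[of _ B]) simp_all
qed

lemmas bdd_borel_intros = bdd_borel_mult bdd_borel_cnj bdd_borel_diff bdd_borel_const bdd_borel_add
  bdd_borel_sum bdd_borel_tchar

lemma L2_inner_diff_sum_left:
  assumes "bdd_borel f" "\<And>j. j \<in> J \<Longrightarrow> bdd_borel (\<phi> j)" "bdd_borel g"
  shows "L2_inner (\<lambda>X. f X - (\<Sum>j\<in>J. c j * \<phi> j X)) g
    = L2_inner f g - (\<Sum>j\<in>J. c j * L2_inner (\<phi> j) g)"
proof -
  have 1: "integrable torus_vol (\<lambda>X. c j * (\<phi> j X * cnj (g X)))" if "j \<in> J" for j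
    by (intro integrable_bdd_borel bdd_borel_intros assms that)
  have 2: "integrable torus_vol (\<lambda>X. f X * cnj (g X))"
    by (intro integrable_bdd_borel bdd_borel_intros assms)
  have "L2_inner (\<lambda>X. f X - (\<Sum>j\<in>J. c j * \<phi> j X)) g
    = (LINT X|torus_vol. f X * cnj (g X) - (\<Sum>j\<in>J. c j * (\<phi> j X * cnj (g X))))"
    unfolding L2_inner_def by (simp add: left_diff_distrib sum_distrib_right mult.assoc)
  also have "\<dots> = L2_inner f g - (\<Sum>j\<in>J. c j * L2_inner (\<phi> j) g)"
    unfolding L2_inner_def using 1 2
    by (subst Bochner_Integration.integral_diff) (auto simp: Bochner_Integration.integral_sum)
  finally show ?thesis .
qed

lemma cnj_L2_inner: "cnj (L2_inner f g) = L2_inner g f"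
proof -
  have "cnj (L2_inner f g) = (LINT X|torus_vol. cnj (f X * cnj (g X)))"
    unfolding L2_inner_def by (rule Bochner_Integration.integral_cnj[symmetric])
  then show ?thesis
    by (simp add: L2_inner_def mult.commute)
qed

lemma L2_inner_self: "L2_inner f f = complex_of_real (LINT X|torus_vol. (cmod (f X))\<^sup>2)"
  unfolding L2_inner_def integral_complex_of_real[symmetric] complex_norm_square ..

text \<open>The remainder g is orthogonal to all \<phi>_j, so the square of its norm is the
  difference of the two sides. The lemma is applied both to eigenfunctions and to
  characters.\<close>

lemma bessel_inequality:
  assumes f: "bdd_borel f" and \<phi>: "\<And>j. j \<in> J \<Longrightarrow> bdd_borel (\<phi> j)" and J: "finite J"
    and orth: "\<And>j k. j \<in> J \<Longrightarrow> k \<in> J \<Longrightarrow> L2_inner (\<phi> j) (\<phi> k) = (if j = k then 1 else 0)"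
  shows "(\<Sum>j\<in>J. (cmod (L2_inner f (\<phi> j)))\<^sup>2) \<le> (LINT X|torus_vol. (cmod (f X))\<^sup>2)"
proof -
  define c where "c = (\<lambda>j. L2_inner f (\<phi> j))"
  define g where "g = (\<lambda>X. f X - (\<Sum>j\<in>J. c j * \<phi> j X))"
  have g: "bdd_borel g"
    unfolding g_def by (intro bdd_borel_intros f \<phi>)
  have "L2_inner g (\<phi> k) = 0" if k: "k \<in> J" for k
  proof -
    have "L2_inner g (\<phi> k) = c k - (\<Sum>j\<in>J. c j * L2_inner (\<phi> j) (\<phi> k))"
      unfolding g_def c_def by (rule L2_inner_diff_sum_left) (auto intro: f \<phi> k)
    also have "(\<Sum>j\<in>J. c j * L2_inner (\<phi> j) (\<phi> k)) = (\<Sum>j\<in>J. if j = k then c j else 0)"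
      by (rule sum.cong) (auto simp: orth k)
    finally show ?thesis using J k by (simp add: sum.delta)
  qed
  then have "L2_inner (\<phi> k) g = 0" if "k \<in> J" for k
    using cnj_L2_inner[of g "\<phi> k"] that by simp
  moreover have "L2_inner g g = L2_inner f g - (\<Sum>j\<in>J. c j * L2_inner (\<phi> j) g)"
    by (subst g_def, rule L2_inner_diff_sum_left) (auto intro: f \<phi> g)
  ultimately have "L2_inner g g = L2_inner f g"
    by simp
  also have "\<dots> = cnj (L2_inner g f)" by (simp add: cnj_L2_inner)
  also have "L2_inner g f = L2_inner f f - (\<Sum>j\<in>J. c j * L2_inner (\<phi> j) f)"
    unfolding g_def by (rule L2_inner_diff_sum_left) (auto intro: f \<phi>)
  also have "(\<Sum>j\<in>J. c j * L2_inner (\<phi> j) f) = complex_of_real (\<Sum>j\<in>J. (cmod (c j))\<^sup>2)"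
    by (simp add: c_def complex_norm_square cnj_L2_inner del: of_real_power)
  finally have "(LINT X|torus_vol. (cmod (g X))\<^sup>2) = (LINT X|torus_vol. (cmod (f X))\<^sup>2) - (\<Sum>j\<in>J. (cmod (c j))\<^sup>2)"
    unfolding L2_inner_self complex_cnj_complex_of_real complex_cnj_diff of_real_diff[symmetric] of_real_eq_iff .
  moreover have "(LINT X|torus_vol. (cmod (g X))\<^sup>2) \<ge> 0" by simp
  ultimately show ?thesis by (simp add: c_def)
qed

section \<open>Trigonometric polynomials in the L2 inner product\<close>

lemma L2_inner_tchar_tchar: "L2_inner (tchar m) (tchar n) = (if m = n then 1 else 0)"
  by (simp add: L2_inner_def tchar_mult_cnj integral_tchar)

text \<open>In the basis of characters, multiplication by w is a Toeplitz matrix: its entries depend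
  on n - m only. The case w = 1 yields Parseval, an indicator w yields the mass on a cell.\<close>

lemma weighted_trig_inner:
  assumes "bdd_borel w"
  shows "(LINT X|torus_vol. w X * ((\<Sum>n\<in>S. c n * tchar n X) * cnj (\<Sum>m\<in>S. d m * tchar m X)))
    = (\<Sum>m\<in>S. cnj (d m) * (\<Sum>n\<in>S. (LINT X|torus_vol. w X * tchar (n - m) X) * c n))"
proof -
  have int: "integrable torus_vol (\<lambda>X. w X * tchar k X)" for k
    by (intro integrable_bdd_borel bdd_borel_intros assms)
  then have int2: "integrable torus_vol (\<lambda>X. a * (w X * tchar k X))" for a k
    by (rule integrable_mult_right)
  have eq: "w X * ((\<Sum>n\<in>S. c n * tchar n X) * cnj (\<Sum>m\<in>S. d m * tchar m X))
    = (\<Sum>m\<in>S. \<Sum>n\<in>S. cnj (d m) * c n * (w X * tchar (n - m) X))" for X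
  proof -
    have "w X * ((\<Sum>n\<in>S. c n * tchar n X) * cnj (\<Sum>m\<in>S. d m * tchar m X))
      = (\<Sum>m\<in>S. \<Sum>n\<in>S. w X * ((c n * tchar n X) * cnj (d m * tchar m X)))"
      by (subst cnj_sum, subst sum_product, subst sum.swap) (simp only: sum_distrib_left)
    then show ?thesis
      by (simp add: mult_ac flip: tchar_mult_cnj)
  qed
  show ?thesis
    unfolding eq
    by (simp add: Bochner_Integration.integral_sum int2) (simp add: sum_distrib_left mult_ac)
qed

lemma trig_parseval:
  assumes "finite S"
  shows "(LINT X|torus_vol. (cmod (\<Sum>n\<in>S. c n * tchar n X))\<^sup>2) = (\<Sum>n\<in>S. (cmod (c n))\<^sup>2)"
proof -
  have "complex_of_real (LINT X|torus_vol. (cmod (\<Sum>n\<in>S. c n * tchar n X))\<^sup>2)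
     = (\<Sum>m\<in>S. cnj (c m) * (\<Sum>n\<in>S. (if n = m then 1 else 0) * c n))"
    using weighted_trig_inner[OF bdd_borel_const[of 1], of c S c]
    unfolding L2_inner_self[symmetric] by (simp add: L2_inner_def integral_tchar)
  also have "\<dots> = (\<Sum>m\<in>S. cnj (c m) * c m)"
    using assms by (intro sum.cong refl) (simp add: if_distrib[of "\<lambda>a. a * _"] sum.delta cong: if_cong)
  also have "\<dots> = complex_of_real (\<Sum>n\<in>S. (cmod (c n))\<^sup>2)"
    by (simp add: complex_norm_square mult.commute del: of_real_power)
  finally show ?thesis by (simp only: of_real_eq_iff)
qed

lemma inj_tchar: "inj tchar"
proof (rule injI)
  fix m n :: "'n::finite \<Rightarrow> int"
  assume eq: "tchar m = tchar n"
  show "m = n"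
    using L2_inner_tchar_tchar[of m n] L2_inner_tchar_tchar[of n n] eq by (auto split: if_splits)
qed

lemma sum_fun_apply: "(\<Sum>j\<in>J. f j) x = (\<Sum>j\<in>J. f j x)"
  by (induction J rule: infinite_finite_induct) auto

lemma independent_tchar:
  assumes "finite S" shows "cfun.independent (tchar ` S)"
proof (rule cfun.independent_if_scalars_zero)
  show "finite (tchar ` S)" using assms by simp
  fix c v
  assume zero: "(\<Sum>x\<in>tchar ` S. cscale (c x) x) = 0" and "v \<in> tchar ` S"
  then obtain m where m: "m \<in> S" "v = tchar m" by auto
  have "(\<Sum>n\<in>S. c (tchar n) * tchar n X) = 0" for X
  proof -
    have "(\<Sum>n\<in>S. c (tchar n) * tchar n X) = (\<Sum>x\<in>tchar ` S. cscale (c x) x) X"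
      by (simp add: sum.reindex inj_on_subset[OF inj_tchar] sum_fun_apply cscale_def)
    then show ?thesis by (simp add: zero)
  qed
  then have "(\<Sum>n\<in>S. (cmod (c (tchar n)))\<^sup>2) = 0"
    using trig_parseval[OF assms, of "\<lambda>n. c (tchar n)"] by simp
  then show "c v = 0"
    using m assms by (simp add: sum_nonneg_eq_0_iff)
qed

text \<open>As u_j is supported on one sphere, the deviation D_j equals the inner product of B u_j
  with u_j, for a matrix B that does not depend on j. Cauchy-Schwarz with |u_j| = 1 gives D_j^2 <=
  |B u_j|^2, and for an orthonormal family the sum of |B u_j|^2 is at most the squared
  Hilbert-Schmidt norm of B. Along each difference k that norm counts at most K pairs.\<close>

lemma eigenbasis_variance:
  fixes \<psi> :: "'j \<Rightarrow> 'n::finite torus \<Rightarrow> complex" and a :: "'n torus \<Rightarrow> real"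
    and S :: "('n \<Rightarrow> int) set"
  assumes h: "h > 0" and J: "finite J"
    and S: "finite S" "{n. 4 * pi\<^sup>2 * h\<^sup>2 * nsq n \<in> I} \<subseteq> S"
    and eig: "\<And>j. j \<in> J \<Longrightarrow> \<exists>E\<in>I. eigenfunction h E (\<psi> j)"
    and orth: "\<And>j k. j \<in> J \<Longrightarrow> k \<in> J \<Longrightarrow> L2_inner (\<psi> j) (\<psi> k) = (if j = k then 1 else 0)"
    and K: "\<And>k. k \<noteq> 0 \<Longrightarrow> real (card {m \<in> S. m + k \<in> S \<and> nsq (m + k) = nsq m}) \<le> K"
    and a: "bdd_borel (\<lambda>X. complex_of_real (a X))"
  shows "(\<Sum>j\<in>J. ((LINT X|torus_vol. a X * (cmod (\<psi> j X))\<^sup>2) - (LINT X|torus_vol. a X))\<^sup>2)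
    \<le> K * (LINT X|torus_vol. (a X)\<^sup>2)"
proof -
  define u where "u = (\<lambda>j n. L2_inner (\<psi> j) (tchar n))"
  define A where "A = (\<lambda>k. LINT X|torus_vol. complex_of_real (a X) * tchar k X)"
  \<comment> \<open>Multiplication by a, with the diagonal removed and restricted to pairs of equal
    norm. The restriction changes nothing on a vector supported on one sphere, and the diagonal
    contributes exactly the mean of a.\<close>
  define B where "B = (\<lambda>m n. if n \<noteq> m \<and> nsq n = nsq m then A (n - m) else 0)"
  define w where "w = (\<lambda>j m. \<Sum>n\<in>S. B m n * u j n)"
  define D where "D = (\<lambda>j. (LINT X|torus_vol. a X * (cmod (\<psi> j X))\<^sup>2) - (LINT X|torus_vol. a X))"
  have expand: "\<psi> j X = (\<Sum>n\<in>S. u j n * tchar n X)" if j: "j \<in> J" for j X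
  proof -
    obtain E where E: "E \<in> I" "eigenfunction h E (\<psi> j)" using eig[OF j] by blast
    have "{n. 4 * pi\<^sup>2 * h\<^sup>2 * nsq n = E} \<subseteq> S" using S(2) E(1) by blast
    then show ?thesis unfolding u_def by (rule eigenfunction_expansion[OF E(2) S(1)])
  qed
  have bdd: "bdd_borel (\<psi> j)" if "j \<in> J" for j
  proof -
    have "\<psi> j = (\<lambda>X. \<Sum>n\<in>S. u j n * tchar n X)"
      by (rule ext) (rule expand[OF that])
    then show ?thesis
      using bdd_borel_sum[OF bdd_borel_mult[OF bdd_borel_const bdd_borel_tchar]] by simp
  qed
  have usum: "(\<Sum>n\<in>S. (cmod (u j n))\<^sup>2) = 1" if "j \<in> J" for j
  proof -
    have "complex_of_real (\<Sum>n\<in>S. (cmod (u j n))\<^sup>2) = L2_inner (\<psi> j) (\<psi> j)"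
      using expand[OF that] trig_parseval[OF S(1), of "u j"] unfolding L2_inner_self by simp
    also have "\<dots> = 1" using orth[OF that that] by simp
    finally show ?thesis by (simp only: of_real_eq_1_iff)
  qed
  have same: "nsq n = nsq m" if j: "j \<in> J" and u: "u j n \<noteq> 0" "u j m \<noteq> 0" for j m n
  proof -
    obtain E where E: "eigenfunction h E (\<psi> j)" using eig[OF j] by blast
    have "4 * pi\<^sup>2 * h\<^sup>2 * nsq n = E" "4 * pi\<^sup>2 * h\<^sup>2 * nsq m = E"
      using eigenfunction_coeff[OF E, of n] eigenfunction_coeff[OF E, of m] u
      unfolding u_def by (auto simp del: of_real_mult of_real_diff)
    then have "4 * pi\<^sup>2 * h\<^sup>2 * nsq n = 4 * pi\<^sup>2 * h\<^sup>2 * nsq m" by simp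
    then show ?thesis using h by simp
  qed
  have D: "complex_of_real (D j) = (\<Sum>m\<in>S. cnj (u j m) * w j m)" if j: "j \<in> J" for j
  proof -
    have "complex_of_real (LINT X|torus_vol. a X * (cmod (\<psi> j X))\<^sup>2)
       = (LINT X|torus_vol. complex_of_real (a X) * (\<psi> j X * cnj (\<psi> j X)))"
      unfolding integral_complex_of_real[symmetric] of_real_mult complex_norm_square ..
    also have "\<dots> = (\<Sum>m\<in>S. cnj (u j m) * (\<Sum>n\<in>S. A (n - m) * u j n))"
      unfolding expand[OF j] A_def by (rule weighted_trig_inner[OF a])
    also have "\<dots> = (\<Sum>m\<in>S. cnj (u j m) * (w j m + A 0 * u j m))"
    proof (intro sum.cong refl)
      fix m assume m: "m \<in> S"
      \<comment> \<open>If one of the two coefficients is 0, both sides vanish; otherwise n and m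
        lie on the same sphere and the restriction in \<open>B\<close> is void.\<close>
      have t: "cnj (u j m) * (A (n - m) * u j n)
          = cnj (u j m) * (B m n * u j n + (if n = m then A 0 * u j n else 0))" for n
        using same[OF j, of n m] by (cases "u j n = 0 \<or> u j m = 0") (auto simp: B_def)
      have "cnj (u j m) * (\<Sum>n\<in>S. A (n - m) * u j n)
        = cnj (u j m) * (\<Sum>n\<in>S. (B m n * u j n + (if n = m then A 0 * u j n else 0)))"
        unfolding sum_distrib_left by (intro sum.cong refl t)
      then show "cnj (u j m) * (\<Sum>n\<in>S. A (n - m) * u j n) = cnj (u j m) * (w j m + A 0 * u j m)"
        using m S(1) by (simp add: w_def sum.distrib sum.delta)
    qed
    also have "\<dots> = (\<Sum>m\<in>S. cnj (u j m) * w j m) + A 0 * complex_of_real (\<Sum>m\<in>S. (cmod (u j m))\<^sup>2)"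
      by (simp add: distrib_left sum.distrib sum_distrib_left complex_norm_square mult_ac del: of_real_power)
    also have "A 0 = complex_of_real (LINT X|torus_vol. a X)"
      by (simp add: A_def)
    finally show ?thesis
      using usum[OF j] by (simp add: D_def)
  qed
  have D2: "(D j)\<^sup>2 \<le> (\<Sum>m\<in>S. (cmod (w j m))\<^sup>2)" if j: "j \<in> J" for j
  proof -
    have "\<bar>D j\<bar> \<le> (\<Sum>m\<in>S. cmod (u j m) * cmod (w j m))"
      using norm_sum[of "\<lambda>m. cnj (u j m) * w j m" S] unfolding D[OF j, symmetric] by (simp add: norm_mult)
    then have "(D j)\<^sup>2 \<le> (\<Sum>m\<in>S. cmod (u j m) * cmod (w j m))\<^sup>2"
      using power_mono[of "\<bar>D j\<bar>" _ 2] by simp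
    also have "\<dots> \<le> (\<Sum>m\<in>S. (cmod (u j m))\<^sup>2) * (\<Sum>m\<in>S. (cmod (w j m))\<^sup>2)"
      by (rule Cauchy_Schwarz_ineq_sum)
    finally show ?thesis using usum[OF j] by simp
  qed
  \<comment> \<open>For fixed m, \<open>w j m\<close> is up to conjugation the inner product of the
    m-th row of \<open>B\<close>, read as a trigonometric polynomial, with \<psi>_j. Bessel bounds
    the sum over j by the norm of that row.\<close>
  have W: "(\<Sum>j\<in>J. (cmod (w j m))\<^sup>2) \<le> (\<Sum>n\<in>S. (cmod (B m n))\<^sup>2)" if "m \<in> S" for m
  proof -
    define g where "g = (\<lambda>X. \<Sum>n\<in>S. cnj (B m n) * tchar n X)"
    have "w j m = cnj (L2_inner g (\<psi> j))" if "j \<in> J" for j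
    proof -
      have "L2_inner (\<psi> j) g = (\<Sum>n\<in>S. B m n * u j n)"
      proof -
        have "L2_inner (\<psi> j) g = (LINT X|torus_vol. 1 * ((\<Sum>n\<in>S. u j n * tchar n X) * cnj (\<Sum>n\<in>S. cnj (B m n) * tchar n X)))"
          unfolding L2_inner_def g_def expand[OF that] by simp
        also have "\<dots> = (\<Sum>k\<in>S. B m k * (\<Sum>n\<in>S. (if n = k then 1 else 0) * u j n))"
          by (subst weighted_trig_inner[OF bdd_borel_const]) (simp add: integral_tchar)
        also have "\<dots> = (\<Sum>n\<in>S. B m n * u j n)"
          using S(1) by (intro sum.cong refl) (simp add: if_distrib[of "\<lambda>a. a * _"] sum.delta cong: if_cong)
        finally show ?thesis .
      qed
      then show ?thesis by (simp add: w_def cnj_L2_inner)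
    qed
    then have "(\<Sum>j\<in>J. (cmod (w j m))\<^sup>2) = (\<Sum>j\<in>J. (cmod (L2_inner g (\<psi> j)))\<^sup>2)"
      by simp
    also have "\<dots> \<le> (LINT X|torus_vol. (cmod (g X))\<^sup>2)"
      by (rule bessel_inequality[OF _ bdd J orth]) (auto simp: g_def intro!: bdd_borel_intros)
    also have "\<dots> = (\<Sum>n\<in>S. (cmod (B m n))\<^sup>2)"
      unfolding g_def trig_parseval[OF S(1)] by simp
    finally show ?thesis .
  qed
  \<comment> \<open>\<open>P\<close> contains the index pairs where \<open>B\<close> can be nonzero.
    Its entries depend on the difference only, so the double sum is regrouped over the set
    \<open>T\<close> of differences.\<close>
  define P where "P = {(m, n). m \<in> S \<and> n \<in> S \<and> n \<noteq> m \<and> nsq n = nsq m}"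
  define T where "T = (\<lambda>(m, n). n - m) ` P"
  have "P \<subseteq> S \<times> S" by (auto simp: P_def)
  then have P: "finite P" using S(1) finite_subset by blast
  then have T: "finite T" "0 \<notin> T" by (auto simp: T_def P_def)
  have "(\<Sum>j\<in>J. (D j)\<^sup>2) \<le> (\<Sum>j\<in>J. \<Sum>m\<in>S. (cmod (w j m))\<^sup>2)"
    by (rule sum_mono) (rule D2)
  also have "\<dots> = (\<Sum>m\<in>S. \<Sum>j\<in>J. (cmod (w j m))\<^sup>2)" by (rule sum.swap)
  also have "\<dots> \<le> (\<Sum>m\<in>S. \<Sum>n\<in>S. (cmod (B m n))\<^sup>2)"
    by (rule sum_mono) (rule W)
  also have "\<dots> = (\<Sum>(m, n)\<in>S \<times> S. (cmod (B m n))\<^sup>2)"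
    by (rule sum.cartesian_product)
  also have "\<dots> = (\<Sum>(m, n)\<in>P. (cmod (A (n - m)))\<^sup>2)"
    using S(1) by (intro sum.mono_neutral_cong_right) (auto simp: P_def B_def split: if_splits)
  also have "\<dots> = (\<Sum>k\<in>T. \<Sum>(m, n)\<in>{p \<in> P. (\<lambda>(m, n). n - m) p = k}. (cmod (A (n - m)))\<^sup>2)"
    by (rule sum.group[symmetric]) (auto simp: P T T_def)
  also have "\<dots> = (\<Sum>k\<in>T. real (card {p \<in> P. (\<lambda>(m, n). n - m) p = k}) * (cmod (A k))\<^sup>2)"
  proof (rule sum.cong[OF refl])
    fix k
    have "(\<Sum>(m, n)\<in>{p \<in> P. (\<lambda>(m, n). n - m) p = k}. (cmod (A (n - m)))\<^sup>2)
        = (\<Sum>p\<in>{p \<in> P. (\<lambda>(m, n). n - m) p = k}. (cmod (A k))\<^sup>2)"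
      by (rule sum.cong) auto
    then show "(\<Sum>(m, n)\<in>{p \<in> P. (\<lambda>(m, n). n - m) p = k}. (cmod (A (n - m)))\<^sup>2)
        = real (card {p \<in> P. (\<lambda>(m, n). n - m) p = k}) * (cmod (A k))\<^sup>2"
      by simp
  qed
  also have "\<dots> \<le> (\<Sum>k\<in>T. K * (cmod (A k))\<^sup>2)"
  proof (intro sum_mono mult_right_mono)
    fix k assume "k \<in> T"
    then have "k \<noteq> 0" using T(2) by auto
    have "{p \<in> P. (\<lambda>(m, n). n - m) p = k}
        \<subseteq> (\<lambda>m. (m, m + k)) ` {m \<in> S. m + k \<in> S \<and> nsq (m + k) = nsq m}"
      by (auto simp: P_def image_iff)
    then have "card {p \<in> P. (\<lambda>(m, n). n - m) p = k} \<le> card {m \<in> S. m + k \<in> S \<and> nsq (m + k) = nsq m}"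
      using S(1) by (intro surj_card_le) auto
    then show "real (card {p \<in> P. (\<lambda>(m, n). n - m) p = k}) \<le> K"
      using K[OF \<open>k \<noteq> 0\<close>] by linarith
  qed auto
  also have "\<dots> = K * (\<Sum>k\<in>T. (cmod (L2_inner (\<lambda>X. complex_of_real (a X)) (tchar (- k))))\<^sup>2)"
    by (simp add: sum_distrib_left L2_inner_def A_def cnj_tchar)
  also have "\<dots> \<le> K * (LINT X|torus_vol. (cmod (complex_of_real (a X)))\<^sup>2)"
  proof (rule mult_left_mono)
    show "(\<Sum>k\<in>T. (cmod (L2_inner (\<lambda>X. complex_of_real (a X)) (tchar (- k))))\<^sup>2)
        \<le> (LINT X|torus_vol. (cmod (complex_of_real (a X)))\<^sup>2)"
      by (rule bessel_inequality[OF a bdd_borel_tchar T(1)]) (simp add: L2_inner_tchar_tchar)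
    \<comment> \<open>Any nonzero difference, here the all-ones vector, shows K >= 0, because a
      cardinality is at most K.\<close>
    have "real (card {m \<in> S. m + 1 \<in> S \<and> nsq (m + 1) = nsq m}) \<le> K"
      by (rule K) (simp add: fun_eq_iff)
    then show "K \<ge> 0" using of_nat_0_le_iff order_trans by blast
  qed
  finally show ?thesis
    by (simp add: D_def)
qed

section \<open>Lattice points in thin shells\<close>

text \<open>The width L refers to |n|^2. For \<rho> = R^2 and L = a R this is a spherical shell of
  radius R and thickness about a.\<close>

definition shell :: "real \<Rightarrow> real \<Rightarrow> ('n::finite \<Rightarrow> int) set"
  where "shell \<rho> L = {n. \<bar>nsq n - \<rho>\<bar> \<le> L}"

lemma finite_shell: "finite (shell \<rho> L)"
  by (rule finite_subset[OF _ finite_nsq_le[of "\<rho> + L"]]) (auto simp: shell_def)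

section \<open>Integers at which a quadratic polynomial is nearly constant\<close>

lemma int_set_card_le:
  fixes J :: "int set"
  assumes diff: "\<And>a b. a \<in> J \<Longrightarrow> b \<in> J \<Longrightarrow> real_of_int (a - b) \<le> D" and "D \<ge> 0"
  shows "finite J" "real (card J) \<le> D + 1"
proof -
  have fd: "a - b \<le> \<lfloor>D\<rfloor>" if "a \<in> J" "b \<in> J" for a b
    using diff[OF that] by (simp add: le_floor_iff)
  show fin: "finite J"
  proof (cases "J = {}")
    case False
    then obtain a where a: "a \<in> J" by blast
    have "J \<subseteq> {a - \<lfloor>D\<rfloor>..a + \<lfloor>D\<rfloor>}"
      using fd[OF a] fd[OF _ a] by fastforce
    then show ?thesis by (rule finite_subset) simp
  qed simp
  show "real (card J) \<le> D + 1"
  proof (cases "J = {}")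
    case False
    have "J \<subseteq> {Min J..Min J + \<lfloor>D\<rfloor>}"
      using fd[OF _ Min_in[OF fin False]] fin by fastforce
    then have "card J \<le> card {Min J..Min J + \<lfloor>D\<rfloor>}"
      by (intro card_mono) auto
    then have "card J \<le> nat (\<lfloor>D\<rfloor> + 1)"
      by simp
    then have "real (card J) \<le> real_of_int (\<lfloor>D\<rfloor> + 1)"
      using \<open>D \<ge> 0\<close> by (simp add: le_nat_iff)
    then show ?thesis
      using of_int_floor_le[of D] by linarith
  qed (use \<open>D \<ge> 0\<close> in simp)
qed

text \<open>The solutions are split at the vertex \<open>t\<^sub>0\<close>. On either side the
  hypothesis, applied to the distances from the vertex, bounds the diameter by D, and a set of
  integers of diameter D has at most D + 1 elements.\<close>

lemma quadratic_card_le: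
  fixes A B L t\<^sub>0 D :: real
  assumes sep: "\<And>u v. 0 \<le> v \<Longrightarrow> v < u \<Longrightarrow> \<bar>A * u\<^sup>2 - B\<bar> \<le> L \<Longrightarrow> \<bar>A * v\<^sup>2 - B\<bar> \<le> L \<Longrightarrow> u - v \<le> D"
    and D: "D \<ge> 0"
  shows "finite {t :: int. \<bar>A * (of_int t - t\<^sub>0)\<^sup>2 - B\<bar> \<le> L}" (is "finite ?T")
    and "real (card {t :: int. \<bar>A * (of_int t - t\<^sub>0)\<^sup>2 - B\<bar> \<le> L}) \<le> 2 * (D + 1)"
proof -
  let ?T1 = "{t \<in> ?T. t\<^sub>0 \<le> of_int t}" and ?T2 = "{t \<in> ?T. of_int t < t\<^sub>0}"
  have 1: "real_of_int (a - b) \<le> D" if "a \<in> ?T1" "b \<in> ?T1" for a b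
    using sep[of "of_int b - t\<^sub>0" "of_int a - t\<^sub>0"] that D by (cases "b < a") auto
  have 2: "real_of_int (a - b) \<le> D" if "a \<in> ?T2" "b \<in> ?T2" for a b
    using sep[of "t\<^sub>0 - of_int a" "t\<^sub>0 - of_int b"] that D
    by (cases "b < a") (auto simp: power2_commute[of t\<^sub>0])
  have T: "?T = ?T1 \<union> ?T2" by auto
  have fin1: "finite ?T1" and card1: "real (card ?T1) \<le> D + 1"
    by (rule int_set_card_le[OF _ D], rule 1, assumption+)+
  have fin2: "finite ?T2" and card2: "real (card ?T2) \<le> D + 1"
    by (rule int_set_card_le[OF _ D], rule 2, assumption+)+
  show "finite ?T" by (subst T) (rule finite_UnI[OF fin1 fin2])
  have "card ?T \<le> card ?T1 + card ?T2"
    by (subst T) (rule card_Un_le)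
  then have "real (card ?T) \<le> real (card ?T1) + real (card ?T2)"
    by (simp only: of_nat_le_iff flip: of_nat_add)
  also have "\<dots> \<le> (D + 1) + (D + 1)"
    by (rule add_mono[OF card1 card2])
  finally show "real (card ?T) \<le> 2 * (D + 1)"
    by simp
qed

text \<open>The worst case over all B, which includes solutions at the vertex: for 0 <= v < u one
  has (u - v)^2 <= u^2 - v^2 <= 2 L.\<close>

lemma quadratic_card_sqrt:
  fixes A B L t\<^sub>0 :: real
  assumes "A \<ge> 1" "L \<ge> 0"
  shows "finite {t :: int. \<bar>A * (of_int t - t\<^sub>0)\<^sup>2 - B\<bar> \<le> L}"
    and "real (card {t :: int. \<bar>A * (of_int t - t\<^sub>0)\<^sup>2 - B\<bar> \<le> L}) \<le> 2 * (sqrt (2 * L) + 1)"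
proof -
  have sep: "u - v \<le> sqrt (2 * L)" if "0 \<le> v" "v < u" "\<bar>A * u\<^sup>2 - B\<bar> \<le> L" "\<bar>A * v\<^sup>2 - B\<bar> \<le> L" for u v
  proof (rule real_le_rsqrt)
    have "(u - v)\<^sup>2 \<le> (u - v) * (u + v)"
      unfolding power2_eq_square using that by (intro mult_left_mono) auto
    also have "\<dots> = u\<^sup>2 - v\<^sup>2" by (simp add: power2_eq_square algebra_simps)
    also have "\<dots> \<le> A * (u\<^sup>2 - v\<^sup>2)"
      using that assms mult_right_mono[of 1 A "u\<^sup>2 - v\<^sup>2"] by (simp add: power_mono)
    also have "\<dots> \<le> 2 * L" using that by (simp add: right_diff_distrib)
    finally show "(u - v)\<^sup>2 \<le> 2 * L" .
  qed
  show "finite {t :: int. \<bar>A * (of_int t - t\<^sub>0)\<^sup>2 - B\<bar> \<le> L}"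
    "real (card {t :: int. \<bar>A * (of_int t - t\<^sub>0)\<^sup>2 - B\<bar> \<le> L}) \<le> 2 * (sqrt (2 * L) + 1)"
    using quadratic_card_le[of A B L "sqrt (2 * L)" t\<^sub>0, OF sep] assms by auto
qed

text \<open>Solutions at distance v from the vertex satisfy A v^2 >= T / 2, so the parabola has
  slope 2 A v >= sqrt T there, and a band of height 2 L is crossed within 2 L / sqrt T.\<close>

lemma quadratic_card_away:
  fixes A B L t\<^sub>0 T :: real
  assumes "A \<ge> 1" "L \<ge> 0" "T > 0" "2 * L \<le> T" "T < \<bar>B\<bar>"
  shows "real (card {t :: int. \<bar>A * (of_int t - t\<^sub>0)\<^sup>2 - B\<bar> \<le> L}) \<le> 2 * (2 * L / sqrt T + 1)"
proof -
  have sep: "u - v \<le> 2 * L / sqrt T" if "0 \<le> v" "v < u" "\<bar>A * u\<^sup>2 - B\<bar> \<le> L" "\<bar>A * v\<^sup>2 - B\<bar> \<le> L" for u v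
  proof -
    have "A * u\<^sup>2 \<ge> 0" using assms by simp
    \<comment> \<open>The alternative B < - T is impossible, because A u^2 is nonnegative and within
      L < T of B.\<close>
    then have "B \<ge> T" using assms that by linarith
    then have "T / 2 \<le> A * v\<^sup>2" using that assms by linarith
    also have "\<dots> \<le> (A * v)\<^sup>2"
      using assms mult_right_mono[of 1 A "A * v\<^sup>2"] by (simp add: power2_eq_square mult_ac)
    finally have "T \<le> (2 * (A * v))\<^sup>2" using \<open>T > 0\<close> by (simp add: power2_eq_square)
    then have "sqrt T \<le> 2 * (A * v)"
      using that assms by (intro real_le_lsqrt) auto
    also have "\<dots> \<le> A * (u + v)" using that assms by simp
    finally have "(u - v) * sqrt T \<le> (u - v) * (A * (u + v))"
      using that by (intro mult_left_mono) auto
    also have "\<dots> = A * u\<^sup>2 - A * v\<^sup>2" by (simp add: power2_eq_square algebra_simps)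
    also have "\<dots> \<le> 2 * L" using that by linarith
    finally show ?thesis using \<open>T > 0\<close> by (simp add: pos_le_divide_eq)
  qed
  show ?thesis
    using quadratic_card_le(2)[of A B L "2 * L / sqrt T" t\<^sub>0, OF sep] assms by auto
qed

section \<open>Counting by fibres over boxes; elimination of coordinates on a hyperplane\<close>

lemma card_le_fibres:
  assumes B: "finite B" and im: "\<pi> ` P \<subseteq> B"
    and fib: "\<And>b. b \<in> B \<Longrightarrow> finite {x \<in> P. \<pi> x = b}" "\<And>b. b \<in> B \<Longrightarrow> real (card {x \<in> P. \<pi> x = b}) \<le> K"
  shows "real (card P) \<le> real (card B) * K"
proof -
  have P: "P = (\<Union>b\<in>B. {x \<in> P. \<pi> x = b})" using im by auto
  have "card P \<le> (\<Sum>b\<in>B. card {x \<in> P. \<pi> x = b})"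
    by (subst P) (rule card_UN_le[OF B])
  then have "real (card P) \<le> (\<Sum>b\<in>B. real (card {x \<in> P. \<pi> x = b}))"
    by (metis of_nat_le_iff of_nat_sum)
  also have "\<dots> \<le> real (card B) * K"
    by (rule sum_bounded_above) (rule fib(2))
  finally show ?thesis .
qed

text \<open>Coordinates in I are frozen at 0: the box is a range for projections that forget these
  coordinates by setting them to 0.\<close>

definition int_box :: "'n set \<Rightarrow> nat \<Rightarrow> ('n::finite \<Rightarrow> int) set"
  where "int_box I b = {g. \<forall>j. g j \<in> (if j \<in> I then {0} else {- int b..int b})}"

lemma finite_int_box: "finite (int_box I b)"
  unfolding int_box_def by (rule card_Pi_UNIV) auto

lemma card_int_box: "card (int_box I b :: ('n::finite \<Rightarrow> int) set) = (2 * b + 1) ^ (CARD('n) - card I)"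
proof -
  have "card (int_box I b :: ('n \<Rightarrow> int) set) = (\<Prod>j\<in>UNIV. card (if j \<in> I then {0 :: int} else {- int b..int b}))"
    unfolding int_box_def by (rule card_Pi_UNIV) auto
  also have "\<dots> = (\<Prod>j\<in>UNIV. if j \<in> I then 1 else 2 * b + 1)"
    by (rule prod.cong) auto
  also have "\<dots> = (\<Prod>j\<in>- I. 2 * b + 1)"
    by (subst prod.If_cases) (auto intro: prod.cong)
  also have "\<dots> = (2 * b + 1) ^ (CARD('n) - card I)"
    by (simp add: Compl_eq_Diff_UNIV card_Diff_subset)
  finally show ?thesis .
qed

lemma complete_square:
  fixes A b x :: real
  assumes "A \<noteq> 0"
  shows "A * (x - b / A)\<^sup>2 = A * x\<^sup>2 - 2 * x * b + A * (b / A)\<^sup>2"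
  using assms by (simp add: power2_diff algebra_simps)

lemma sum_split_two:
  fixes f :: "'n::finite \<Rightarrow> 'a::comm_monoid_add"
  assumes "i \<noteq> l"
  shows "sum f UNIV = f i + (f l + sum f (UNIV - {i, l}))"
proof -
  have "UNIV - {i, l} = UNIV - {i} - {l}" by auto
  then show ?thesis
    using assms by (simp add: sum.remove[of UNIV i] sum.remove[of "UNIV - {i}" l])
qed

lemma real_card_int_box:
  "real (card (int_box I b :: ('n::finite \<Rightarrow> int) set)) = (2 * real b + 1) ^ (CARD('n) - card I)"
  by (simp add: card_int_box add.commute)

text \<open>
  On the hyperplane \<open>k \<bullet> n = c\<close> the coordinate \<open>n\<^sub>i\<close> is an affine function of the others, and
  \<open>|n|\<^sup>2\<close> becomes a quadratic polynomial in \<open>n\<^sub>l\<close> with leading coefficient \<open>hA\<close> and minimum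
  \<open>\<rho> - hB\<close>, attained at \<open>ht\<close>, where \<open>hB\<close> and \<open>ht\<close> depend on the remaining coordinates only.
\<close>

context
  fixes k :: "'n::finite \<Rightarrow> int" and c \<rho> :: real and i l :: 'n
  assumes ki: "k i \<noteq> 0" and il: "i \<noteq> l"
begin

text \<open>The intercept of the affine function: the value of the i-th coordinate on the hyperplane
  when the l-th one is 0.\<close>

definition hmu :: "('n \<Rightarrow> int) \<Rightarrow> real"
  where "hmu g = (c - (\<Sum>j\<in>UNIV - {i, l}. of_int (k j * g j))) / of_int (k i)"

definition hA :: real
  where "hA = 1 + (of_int (k l) / of_int (k i))\<^sup>2"

definition hB :: "('n \<Rightarrow> int) \<Rightarrow> real"
  where "hB g = \<rho> - (\<Sum>j\<in>UNIV - {i, l}. (of_int (g j))\<^sup>2) - (hmu g)\<^sup>2 / hA"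

definition ht :: "('n \<Rightarrow> int) \<Rightarrow> real"
  where "ht g = hmu g * (of_int (k l) / of_int (k i)) / hA"

lemma hA_ge: "hA \<ge> 1"
  by (simp add: hA_def)

lemma hcoord:
  assumes "(\<Sum>j\<in>UNIV. of_int (k j * n j)) = c"
  shows "of_int (n i) = hmu n - of_int (k l) / of_int (k i) * of_int (n l)"
proof -
  have "(\<Sum>j\<in>UNIV. real_of_int (k j * n j)) = of_int (k i * n i) + (of_int (k l * n l) + (\<Sum>j\<in>UNIV - {i, l}. of_int (k j * n j)))"
    by (rule sum_split_two[OF il])
  then have "real_of_int (k i) * of_int (n i)
      = (c - (\<Sum>j\<in>UNIV - {i, l}. of_int (k j * n j))) - of_int (k l) * of_int (n l)"
    using assms by simp
  then show ?thesis
    using ki unfolding hmu_def by (simp add: eq_divide_eq diff_divide_distrib[symmetric] mult.commute)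
qed

lemma hnsq:
  assumes "(\<Sum>j\<in>UNIV. of_int (k j * n j)) = c"
  shows "nsq n - \<rho> = hA * (of_int (n l) - ht n)\<^sup>2 - hB n"
proof -
  let ?q = "real_of_int (k l) / of_int (k i)"
  have "nsq n = (of_int (n i))\<^sup>2 + ((of_int (n l))\<^sup>2 + (\<Sum>j\<in>UNIV - {i, l}. (of_int (n j))\<^sup>2))"
    unfolding nsq_def by (rule sum_split_two[OF il])
  moreover have "(of_int (n i))\<^sup>2 + (of_int (n l))\<^sup>2 = hA * (of_int (n l) - ht n)\<^sup>2 + (hmu n)\<^sup>2 / hA"
  proof -
    have A0: "hA \<noteq> 0" using hA_ge by simp
    have "hA * (hmu n * ?q / hA)\<^sup>2 + (hmu n)\<^sup>2 / hA = (hmu n)\<^sup>2 * (1 + ?q\<^sup>2) / hA"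
      using A0 by (simp add: field_simps power2_eq_square)
    also have "\<dots> = (hmu n)\<^sup>2" using A0 by (simp flip: hA_def)
    finally have "hA * (of_int (n l) - ht n)\<^sup>2 + (hmu n)\<^sup>2 / hA
        = hA * (of_int (n l))\<^sup>2 - 2 * of_int (n l) * (hmu n * ?q) + (hmu n)\<^sup>2"
      unfolding ht_def complete_square[OF A0] by simp
    also have "\<dots> = (of_int (n i))\<^sup>2 + (of_int (n l))\<^sup>2"
      unfolding hcoord[OF assms] by (simp add: hA_def power2_diff algebra_simps power_mult_distrib power_divide)
    finally show ?thesis ..
  qed
  ultimately show ?thesis by (simp add: hB_def)
qed

definition hproj :: "('n \<Rightarrow> int) \<Rightarrow> ('n \<Rightarrow> int)"
  where "hproj n = n(i := 0, l := 0)"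

lemma hmu_proj: "hmu (hproj n) = hmu n"
  unfolding hmu_def hproj_def using il
  by (intro arg_cong2[where f = "(/)"] arg_cong2[where f = "(-)"] sum.cong) auto

lemma hB_proj: "hB (hproj n) = hB n"
  unfolding hB_def hmu_proj
  by (intro arg_cong2[where f = "(-)"] sum.cong) (auto simp: hproj_def)

lemma ht_proj: "ht (hproj n) = ht n"
  by (simp add: ht_def hmu_proj)

definition hset :: "real \<Rightarrow> ('n \<Rightarrow> int) set"
  where "hset L = {n \<in> shell \<rho> L. (\<Sum>j\<in>UNIV. of_int (k j * n j)) = c}"

text \<open>A fibre of \<open>hproj\<close> lies on a line of the hyperplane, parametrised by the
  l-th coordinate since the i-th is determined by it. Thus a fibre injects into a one-variable
  quadratic problem.\<close>

lemma hfibre: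
  "inj_on (\<lambda>n. n l) {n \<in> hset L. hproj n = g}"
  "(\<lambda>n. n l) ` {n \<in> hset L. hproj n = g} \<subseteq> {t. \<bar>hA * (of_int t - ht g)\<^sup>2 - hB g\<bar> \<le> L}"
proof -
  show "inj_on (\<lambda>n. n l) {n \<in> hset L. hproj n = g}"
  proof (rule inj_onI)
    fix m n assume m: "m \<in> {n \<in> hset L. hproj n = g}" and n: "n \<in> {n \<in> hset L. hproj n = g}"
      and l: "m l = n l"
    have "hproj m = hproj n" using m n by auto
    have other: "m j = n j" if "j \<noteq> i" for j
      using that l fun_cong[OF \<open>hproj m = hproj n\<close>, of j] by (cases "j = l") (simp_all add: hproj_def)
    have "real_of_int (m i) = of_int (n i)"
      using hcoord[of m] hcoord[of n] m n hmu_proj[of m] hmu_proj[of n] l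
      by (simp add: hset_def)
    then have "m j = n j" for j using other by (cases "j = i") auto
    then show "m = n" by auto
  qed
  show "(\<lambda>n. n l) ` {n \<in> hset L. hproj n = g} \<subseteq> {t. \<bar>hA * (of_int t - ht g)\<^sup>2 - hB g\<bar> \<le> L}"
    using hnsq hB_proj ht_proj by (auto simp: hset_def shell_def)
qed

lemma card_hfibre_sqrt:
  assumes "L \<ge> 0"
  shows "real (card {n \<in> hset L. hproj n = g}) \<le> 2 * (sqrt (2 * L) + 1)"
proof -
  have "card {n \<in> hset L. hproj n = g} \<le> card {t. \<bar>hA * (of_int t - ht g)\<^sup>2 - hB g\<bar> \<le> L}"
    by (rule card_inj_on_le[OF hfibre quadratic_card_sqrt(1)[OF hA_ge assms]])
  then show ?thesis
    using quadratic_card_sqrt(2)[OF hA_ge assms, of "ht g" "hB g"] by linarith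
qed

lemma card_hfibre_away:
  assumes "L \<ge> 0" "T > 0" "2 * L \<le> T" "T < \<bar>hB g\<bar>"
  shows "real (card {n \<in> hset L. hproj n = g}) \<le> 2 * (2 * L / sqrt T + 1)"
proof -
  have "card {n \<in> hset L. hproj n = g} \<le> card {t. \<bar>hA * (of_int t - ht g)\<^sup>2 - hB g\<bar> \<le> L}"
    by (rule card_inj_on_le[OF hfibre quadratic_card_sqrt(1)[OF hA_ge assms(1)]])
  then show ?thesis
    using quadratic_card_away[OF hA_ge assms, of "ht g"] by linarith
qed

lemma finite_hset: "finite (hset L)"
  unfolding hset_def by (rule finite_subset[OF _ finite_shell[of \<rho> L]]) auto

lemma hproj_int_box:
  assumes "sqrt (\<rho> + L) \<le> real b" "n \<in> hset L"
  shows "hproj n \<in> int_box {i, l} b"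
proof -
  have "\<bar>n j\<bar> \<le> int b" for j
  proof -
    have "\<bar>real_of_int (n j)\<bar> \<le> sqrt (nsq n)" by (rule abs_le_sqrt_nsq)
    also have "\<dots> \<le> sqrt (\<rho> + L)"
      using assms(2) unfolding hset_def shell_def by (intro real_sqrt_le_mono) auto
    finally show ?thesis using assms(1) by linarith
  qed
  then show ?thesis by (auto simp: int_box_def hproj_def abs_le_iff minus_le_iff)
qed

text \<open>The projection leaves d - 2 free coordinates with 2 b + 1 values each, and every fibre
  is estimated by the worst case.\<close>

lemma card_hset_sqrt:
  assumes "L \<ge> 0" "sqrt (\<rho> + L) \<le> real b"
  shows "real (card (hset L)) \<le> (2 * real b + 1) ^ (CARD('n) - 2) * (2 * (sqrt (2 * L) + 1))"
proof -
  have "real (card (hset L)) \<le> real (card (int_box {i, l} b :: ('n \<Rightarrow> int) set)) * (2 * (sqrt (2 * L) + 1))"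
    by (rule card_le_fibres[of _ hproj, OF _ _ _ card_hfibre_sqrt[OF assms(1)]])
      (auto simp: finite_int_box finite_hset hproj_int_box[OF assms(2)])
  moreover have "card {i, l} = 2" using il by simp
  ultimately show ?thesis by (simp only: real_card_int_box)
qed

text \<open>\<open>hB g\<close> is \<rho> minus the squared distance of the line over g from the
  origin, so a small value means near tangency to the sphere. As a function of a third coordinate,
  \<open>- hB\<close> is again a quadratic with leading coefficient at least 1, and the vertex
  estimate applies to it.\<close>

lemma card_hB_small:
  assumes m: "m \<noteq> i" "m \<noteq> l" and T: "T \<ge> 0"
  shows "real (card {g \<in> int_box {i, l} b. \<bar>hB g\<bar> \<le> T}) \<le> (2 * real b + 1) ^ (CARD('n) - 3) * (2 * (sqrt (2 * T) + 1))"
proof -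
  let ?G = "{g \<in> int_box {i, l} b. \<bar>hB g\<bar> \<le> T}"
  define q where "q = real_of_int (k m) / of_int (k i)"
  define mu where "mu = (\<lambda>g. (c - (\<Sum>j\<in>UNIV - {i, l, m}. of_int (k j * g j))) / of_int (k i))"
  define A where "A = 1 + q\<^sup>2 / hA"
  define s0 where "s0 = (\<lambda>g. mu g * q / hA / A)"
  define B where "B = (\<lambda>g. \<rho> - (\<Sum>j\<in>UNIV - {i, l, m}. (of_int (g j))\<^sup>2) - (mu g)\<^sup>2 / hA + A * (s0 g)\<^sup>2)"
  have A: "A \<ge> 1" using hA_ge by (simp add: A_def)
  have mum: "mu (g(m := 0)) = mu g" for g :: "'n \<Rightarrow> int"
    unfolding mu_def by (intro arg_cong2[where f = "(/)"] arg_cong2[where f = "(-)"] sum.cong) auto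
  have s0m: "s0 (g(m := 0)) = s0 g" for g :: "'n \<Rightarrow> int"
    by (simp add: s0_def mum)
  have Bm: "B (g(m := 0)) = B g" for g :: "'n \<Rightarrow> int"
    unfolding B_def mum s0m by (intro arg_cong2[where f = "(-)"] arg_cong2[where f = "(+)"] sum.cong) auto
  have sumsplit: "(\<Sum>j\<in>UNIV - {i, l}. f j) = f m + (\<Sum>j\<in>UNIV - {i, l, m}. f j)" for f :: "'n \<Rightarrow> real"
  proof -
    have "UNIV - {i, l, m} = UNIV - {i, l} - {m}" by auto
    then show ?thesis using m by (simp add: sum.remove[of "UNIV - {i, l}" m])
  qed
  \<comment> \<open>\<open>hmu g\<close> is affine in the m-th coordinate with slope - q, so
    completing the square once more exhibits \<open>A\<close> and the vertex
    \<open>s0\<close>.\<close>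
  have hB: "hB g = - (A * (of_int (g m) - s0 g)\<^sup>2 - B g)" for g
  proof -
    have "hmu g = mu g - q * of_int (g m)"
      using ki unfolding hmu_def sumsplit mu_def q_def by (simp add: field_simps)
    moreover have A0: "hA \<noteq> 0" "A \<noteq> 0" using hA_ge A by auto
    have "x\<^sup>2 + (y - q * x)\<^sup>2 / hA = A * (x - y * q / hA / A)\<^sup>2 + y\<^sup>2 / hA - A * (y * q / hA / A)\<^sup>2" for x y
    proof -
      have "A * (x - y * q / hA / A)\<^sup>2 - A * (y * q / hA / A)\<^sup>2 = A * x\<^sup>2 - 2 * x * (y * q / hA)"
        unfolding complete_square[OF A0(2)] by simp
      moreover have "x\<^sup>2 + (y - q * x)\<^sup>2 / hA = A * x\<^sup>2 - 2 * x * (y * q / hA) + y\<^sup>2 / hA"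
        using A0(1) unfolding A_def by (simp add: field_simps power2_eq_square)
      ultimately show ?thesis by linarith
    qed
    from this[of "of_int (g m)" "mu g"] show ?thesis
      unfolding hB_def sumsplit calculation B_def s0_def by linarith
  qed
  have "real (card ?G) \<le> real (card (int_box {i, l, m} b :: ('n \<Rightarrow> int) set)) * (2 * (sqrt (2 * T) + 1))"
  proof (rule card_le_fibres[of _ "\<lambda>g. g(m := 0)"])
    show "finite (int_box {i, l, m} b)" by (rule finite_int_box)
    show "(\<lambda>g. g(m := 0)) ` ?G \<subseteq> int_box {i, l, m} b"
      unfolding int_box_def by clarsimp
    fix f :: "'n \<Rightarrow> int"
    let ?F = "{g \<in> ?G. g(m := 0) = f}"
    show "finite ?F" by (rule finite_subset[OF _ finite_int_box[of "{i, l}" b]]) auto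
    have "inj_on (\<lambda>g. g m) ?F"
    proof (rule inj_onI)
      fix x y assume xy: "x \<in> ?F" "y \<in> ?F" "x m = y m"
      then have "x(m := 0) = y(m := 0)" by auto
      then have "x j = y j" for j
        using xy(3) by (cases "j = m") (auto dest: fun_cong[of _ _ j])
      then show "x = y" by auto
    qed
    moreover have "(\<lambda>g. g m) ` ?F \<subseteq> {s. \<bar>A * (of_int s - s0 f)\<^sup>2 - B f\<bar> \<le> T}"
      using hB s0m Bm by auto
    ultimately have "card ?F \<le> card {s :: int. \<bar>A * (of_int s - s0 f)\<^sup>2 - B f\<bar> \<le> T}"
      using card_inj_on_le quadratic_card_sqrt(1)[OF A T] by blast
    then show "real (card ?F) \<le> 2 * (sqrt (2 * T) + 1)"
      using quadratic_card_sqrt(2)[OF A T, of "s0 f" "B f"] by linarith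
  qed
  moreover have "card {i, l, m} = 3" using m il by auto
  ultimately show ?thesis by (simp only: real_card_int_box)
qed

text \<open>The two regimes are separated at |hB| = T: nearly tangent lines are few but may carry
  long fibres, all other lines are many but carry short fibres.\<close>

lemma card_hset_two:
  assumes L: "L \<ge> 0" "sqrt (\<rho> + L) \<le> real b" and m: "m \<noteq> i" "m \<noteq> l" and T: "T > 0" "2 * L \<le> T"
  shows "real (card (hset L)) \<le>
    (2 * real b + 1) ^ (CARD('n) - 3) * (2 * (sqrt (2 * T) + 1)) * (2 * (sqrt (2 * L) + 1))
    + (2 * real b + 1) ^ (CARD('n) - 2) * (2 * (2 * L / sqrt T + 1))"
proof -
  let ?P1 = "{n \<in> hset L. \<bar>hB n\<bar> \<le> T}" and ?P2 = "{n \<in> hset L. T < \<bar>hB n\<bar>}"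
  have "card (hset L) \<le> card (?P1 \<union> ?P2)"
    by (intro card_mono) (auto simp: finite_hset)
  also have "\<dots> \<le> card ?P1 + card ?P2" by (rule card_Un_le)
  finally have "real (card (hset L)) \<le> real (card ?P1) + real (card ?P2)"
    by (simp only: of_nat_le_iff flip: of_nat_add)
  moreover have "real (card ?P1) \<le> real (card {g \<in> int_box {i, l} b. \<bar>hB g\<bar> \<le> T}) * (2 * (sqrt (2 * L) + 1))"
  proof (rule card_le_fibres[of _ hproj])
    fix g
    have "card {n \<in> ?P1. hproj n = g} \<le> card {n \<in> hset L. hproj n = g}"
      by (intro card_mono) (auto simp: finite_hset)
    then show "real (card {n \<in> ?P1. hproj n = g}) \<le> 2 * (sqrt (2 * L) + 1)"
      using card_hfibre_sqrt[OF L(1), of g] by linarith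
  qed (auto simp: finite_int_box finite_hset hB_proj hproj_int_box[OF L(2)])
  moreover have "\<dots> \<le> ((2 * real b + 1) ^ (CARD('n) - 3) * (2 * (sqrt (2 * T) + 1))) * (2 * (sqrt (2 * L) + 1))"
    using card_hB_small[OF m, of T b] T L by (intro mult_right_mono) auto
  moreover have "real (card ?P2) \<le> real (card (int_box {i, l} b :: ('n \<Rightarrow> int) set)) * (2 * (2 * L / sqrt T + 1))"
  proof (rule card_le_fibres[of _ hproj])
    fix g
    show "real (card {n \<in> ?P2. hproj n = g}) \<le> 2 * (2 * L / sqrt T + 1)"
    proof (cases "T < \<bar>hB g\<bar>")
      case True
      have "card {n \<in> ?P2. hproj n = g} \<le> card {n \<in> hset L. hproj n = g}"
        by (intro card_mono) (auto simp: finite_hset)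
      then show ?thesis using card_hfibre_away[OF L(1) T True] by linarith
    next
      case False
      then have "{n \<in> ?P2. hproj n = g} = {}" using hB_proj by auto
      then show ?thesis using L T by (simp only: card.empty) simp
    qed
  qed (auto simp: finite_int_box finite_hset hproj_int_box[OF L(2)])
  moreover have c2: "card {i, l} = 2" using il by simp
  moreover have "real (card (int_box {i, l} b :: ('n \<Rightarrow> int) set)) = (2 * real b + 1) ^ (CARD('n) - 2)"
    unfolding real_card_int_box c2 ..
  ultimately show ?thesis by (simp only:)
qed

end

section \<open>Upper and lower counts for shells of radius R\<close>

lemma sqrt_shell_le:
  fixes R a :: real
  assumes "R \<ge> 1" "a > 0"
  shows "sqrt (R\<^sup>2 + a * R) \<le> (1 + a) * R"
proof (rule real_le_lsqrt)
  have "a * R \<le> a * R\<^sup>2"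
    using assms by (simp add: power2_eq_square)
  moreover have "0 \<le> a * R\<^sup>2 + a\<^sup>2 * R\<^sup>2"
    using assms by simp
  moreover have "((1 + a) * R)\<^sup>2 = R\<^sup>2 + 2 * (a * R\<^sup>2) + a\<^sup>2 * R\<^sup>2"
    by (simp add: power2_eq_square algebra_simps)
  ultimately show "R\<^sup>2 + a * R \<le> ((1 + a) * R)\<^sup>2"
    by linarith
qed (use assms in auto)

text \<open>For d = 2 the fibre itself has the order R^(1/2). For d >= 3 the two contributions are
  R^(d-3) T^(1/2) R^(1/2) and R^(d-2) R / T^(1/2); T = R^(3/2) makes both equal to R^(d - 7/4).
  Neither k nor c enters the constants.\<close>

lemma card_hyperplane_shell_le:
  fixes a :: real
  assumes d: "CARD('n::finite) \<ge> 2" and a: "a > 0"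
  defines "\<delta> \<equiv> if CARD('n) = 2 then 1 / 2 else 3 / 4"
  shows "\<exists>C R\<^sub>0. \<forall>R\<ge>R\<^sub>0. \<forall>(k :: 'n \<Rightarrow> int) (c :: real). k \<noteq> 0 \<longrightarrow>
    real (card {n \<in> shell (R\<^sup>2) (a * R). (\<Sum>j\<in>UNIV. of_int (k j * n j)) = c})
      \<le> C * R powr (real CARD('n) - 1 - \<delta>)"
proof -
  \<comment> \<open>With b the ceiling of (1 + a) R, one has 2 b + 1 <= 2 (1 + a) R + 3, which is at
    most (5 + 2 a) R for R >= 1.\<close>
  define C1 where "C1 = 5 + 2 * a"
  define C where "C = (if CARD('n) = 2 then 2 * (sqrt (2 * a) + 1) else
    C1 ^ (CARD('n) - 3) * (2 * (sqrt 2 + 1)) * (2 * (sqrt (2 * a) + 1)) + C1 ^ (CARD('n) - 2) * (2 * (2 * a + 1)))"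
  have "real (card {n \<in> shell (R\<^sup>2) (a * R). (\<Sum>j\<in>UNIV. of_int (k j * n j)) = c})
      \<le> C * R powr (real CARD('n) - 1 - \<delta>)"
    \<comment> \<open>The bound by (2 a)^2 ensures 2 a R <= R^(3/2), the condition 2 L <= T of the
      second regime.\<close>
    if R: "R \<ge> max 1 ((2 * a)\<^sup>2)" and k: "k \<noteq> 0" for R c :: real and k :: "'n \<Rightarrow> int"
  proof -
    have R1: "R \<ge> 1" and Ra: "(2 * a)\<^sup>2 \<le> R" using R by auto
    obtain i where i: "k i \<noteq> 0" using k by (auto simp: fun_eq_iff)
    have "card {i} < CARD('n)" using d by simp
    then obtain l where il: "i \<noteq> l"
      by (metis (full_types) UNIV_eq_I insertI1 less_irrefl)
    define b where "b = nat \<lceil>(1 + a) * R\<rceil>"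
    have b0: "(1 + a) * R \<le> real b" unfolding b_def by linarith
    have b1: "2 * real b + 1 \<le> C1 * R"
    proof -
      have "0 \<le> (1 + a) * R" using a R1 by simp
      then have "real b \<le> (1 + a) * R + 1" unfolding b_def by linarith
      then show ?thesis using R1 by (simp add: C1_def algebra_simps)
    qed
    have C1: "C1 \<ge> 0" using a by (simp add: C1_def)
    have L: "a * R \<ge> 0" "sqrt (R\<^sup>2 + a * R) \<le> real b"
      using a R1 sqrt_shell_le[OF R1 a] b0 by auto
    have half: "R powr (1 / 2) = sqrt R" using R1 by (simp add: powr_half_sqrt)
    have one: "1 \<le> R powr e" if "e \<ge> 0" for e using R1 that by (simp add: ge_one_powr_ge_zero)
    have e1: "2 * (sqrt (2 * (a * R)) + 1) \<le> 2 * (sqrt (2 * a) + 1) * R powr (1 / 2)"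
      using one[of "1 / 2"] by (simp add: half real_sqrt_mult algebra_simps)
    show ?thesis
    proof (cases "CARD('n) = 2")
      case True
      then have "real (card (hset k c (R\<^sup>2) (a * R))) \<le> C * R powr (real CARD('n) - 1 - \<delta>)"
        using card_hset_sqrt[where k = k and i = i and l = l and c = c, OF i il L] e1
        unfolding C_def \<delta>_def by simp
      then show ?thesis
        unfolding hset_def[where k = k and i = i and l = l, OF i il] .
    next
      case False
      have "card {i, l} < CARD('n)" using d False il by simp
      then obtain m where m: "m \<noteq> i" "m \<noteq> l"
        by (metis (full_types) UNIV_eq_I insertCI less_irrefl)
      define T where "T = R powr (3 / 2)"
      have T0: "T > 0" using R1 by (simp add: T_def)
      have "2 * a \<le> sqrt R" using Ra a by (intro real_le_rsqrt) auto
      then have "2 * a * R \<le> R powr (1 / 2) * R powr 1"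
        using R1 by (simp add: half)
      then have LT: "2 * (a * R) \<le> T"
        unfolding T_def powr_add[symmetric] by (simp add: mult.assoc)
      have sT: "sqrt T = R powr (3 / 4)"
        unfolding T_def using R1 by (simp add: powr_half_sqrt[symmetric] powr_powr)
      have e2: "2 * (sqrt (2 * T) + 1) \<le> 2 * (sqrt 2 + 1) * R powr (3 / 4)"
        using one[of "3 / 4"] by (simp add: sT real_sqrt_mult algebra_simps)
      have "R powr (1 / 4) = R powr 1 / R powr (3 / 4)"
        by (subst powr_diff[symmetric]) simp
      then have "R / R powr (3 / 4) = R powr (1 / 4)"
        using R1 by simp
      then have "2 * (2 * (a * R) / sqrt T + 1) = 2 * (2 * a * R powr (1 / 4) + 1)"
        by (simp add: sT flip: times_divide_eq_right)
      then have e3: "2 * (2 * (a * R) / sqrt T + 1) \<le> 2 * (2 * a + 1) * R powr (1 / 4)"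
        using one[of "1 / 4"] by (simp add: algebra_simps)
      have pw: "(2 * real b + 1) ^ p \<le> C1 ^ p * R powr real p" for p
        using power_mono[OF b1, of p] R1 by (simp add: power_mult_distrib powr_realpow)
      have "real (card (hset k c (R\<^sup>2) (a * R)))
          \<le> (2 * real b + 1) ^ (CARD('n) - 3) * (2 * (sqrt (2 * T) + 1)) * (2 * (sqrt (2 * (a * R)) + 1))
            + (2 * real b + 1) ^ (CARD('n) - 2) * (2 * (2 * (a * R) / sqrt T + 1))"
        by (rule card_hset_two[where k = k and i = i and l = l, OF i il L m T0 LT])
      also have "\<dots> \<le> (C1 ^ (CARD('n) - 3) * R powr real (CARD('n) - 3)) * (2 * (sqrt 2 + 1) * R powr (3 / 4))
            * (2 * (sqrt (2 * a) + 1) * R powr (1 / 2))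
            + (C1 ^ (CARD('n) - 2) * R powr real (CARD('n) - 2)) * (2 * (2 * a + 1) * R powr (1 / 4))"
        using C1 a T0 L(1) by (intro add_mono mult_mono pw e1 e2 e3 mult_nonneg_nonneg) auto
      also have "\<dots> = C1 ^ (CARD('n) - 3) * (2 * (sqrt 2 + 1)) * (2 * (sqrt (2 * a) + 1))
              * (R powr real (CARD('n) - 3) * R powr (3 / 4) * R powr (1 / 2))
            + C1 ^ (CARD('n) - 2) * (2 * (2 * a + 1)) * (R powr real (CARD('n) - 2) * R powr (1 / 4))"
        by (simp add: mult_ac)
      also have "R powr real (CARD('n) - 3) * R powr (3 / 4) * R powr (1 / 2) = R powr (real CARD('n) - 1 - \<delta>)"
        unfolding powr_add[symmetric] using d False by (simp add: \<delta>_def of_nat_diff)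
      also have "R powr real (CARD('n) - 2) * R powr (1 / 4) = R powr (real CARD('n) - 1 - \<delta>)"
        unfolding powr_add[symmetric] using d False by (simp add: \<delta>_def of_nat_diff)
      finally show ?thesis
        unfolding hset_def[where k = k and i = i and l = l, OF i il] C_def using False by (simp only: if_False distrib_right)
    qed
  qed
  then show ?thesis by blast
qed

text \<open>All coordinates but one are chosen freely and the last one is the integer part of the s
  that would reach |n|^2 = R^2 exactly. Rounding loses up to 2 s in |n|^2, so s has to be a small
  multiple of R: coordinate m therefore takes up almost all of the radius. The d - 1 ranges have
  length of order R, which gives R^(d-1) points.\<close>

lemma card_shell_ge:
  fixes a :: real
  assumes d: "CARD('n::finite) \<ge> 2" and a: "a > 0"
  shows "\<exists>c>0. \<exists>R\<^sub>0. \<forall>R\<ge>R\<^sub>0. c * R ^ (CARD('n) - 1) \<le> real (card (shell (R\<^sup>2) (a * R) :: ('n \<Rightarrow> int) set))"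
proof -
  obtain i m :: 'n where im: "m \<noteq> i"
  proof -
    fix i :: 'n
    assume *: "\<And>m i :: 'n. m \<noteq> i \<Longrightarrow> thesis"
    have "card {i} < CARD('n)" using d by simp
    then show thesis using * by (metis (full_types) UNIV_eq_I insertI1 less_irrefl)
  qed
  \<comment> \<open>Coordinate m ranges over R (1 - \<eta>) to R (1 - \<eta> / 2), so s^2 <= 2
    \<eta> R^2, and \<eta> <= a^2 / 32 gives s <= a R / 4. The choice of \<kappa> keeps the small
    coordinates below a total of \<eta> R^2 / 2, so that |g|^2 <= R^2; c bounds the number of
    choices per coordinate from below by c R.\<close>
  define \<eta> where "\<eta> = min (1 / 2) (a\<^sup>2 / 32)"
  define \<kappa> where "\<kappa> = sqrt (\<eta> / (2 * real CARD('n)))"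
  define c where "c = min (\<eta> / 4) \<kappa>"
  have \<eta>: "\<eta> > 0" "\<eta> \<le> 1 / 2" "32 * \<eta> \<le> a\<^sup>2"
    using a by (auto simp: \<eta>_def)
  have \<kappa>: "\<kappa> > 0" "real CARD('n) * \<kappa>\<^sup>2 = \<eta> / 2"
    using \<eta> by (auto simp: \<kappa>_def)
  have c: "c > 0" using \<eta> \<kappa> by (simp add: c_def)
  have "c ^ (CARD('n) - 1) * R ^ (CARD('n) - 1) \<le> real (card (shell (R\<^sup>2) (a * R) :: ('n \<Rightarrow> int) set))"
    if R: "R \<ge> 4 / \<eta>" for R
  proof -
    have R0: "R > 0" using R \<eta> by (intro less_le_trans[OF _ R]) simp
    have R4: "\<eta> * R \<ge> 4" using R \<eta> by (simp add: field_simps)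
    define A where "A = (\<lambda>j. if j = i then {0} else if j = m then {\<lceil>R * (1 - \<eta>)\<rceil>..\<lfloor>R * (1 - \<eta> / 2)\<rfloor>}
      else {0..\<lfloor>\<kappa> * R\<rfloor>})"
    define F where "F = {g :: 'n \<Rightarrow> int. \<forall>j. g j \<in> A j}"
    define \<Phi> where "\<Phi> = (\<lambda>g :: 'n \<Rightarrow> int. g(i := \<lfloor>sqrt (R\<^sup>2 - nsq g)\<rfloor>))"
    have finA: "finite (A j)" for j by (simp add: A_def)
    have "card F = (\<Prod>j\<in>UNIV. card (A j))"
      unfolding F_def by (rule card_Pi_UNIV[OF finA])
    then have cardF: "real (card F) = (\<Prod>j\<in>UNIV. real (card (A j)))" by simp
    have "(\<Prod>j\<in>(UNIV :: 'n set). if j = i then 1 else c * R) \<le> real (card F)"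
      unfolding cardF
    proof (rule prod_mono)
      fix j
      have "c * R \<le> real (card {\<lceil>R * (1 - \<eta>)\<rceil>..\<lfloor>R * (1 - \<eta> / 2)\<rfloor>})"
      proof -
        have "c * R \<le> \<eta> / 4 * R" using R0 by (intro mult_right_mono) (auto simp: c_def)
        also have "\<dots> \<le> R * (1 - \<eta> / 2) - R * (1 - \<eta>) - 1"
          using R4 by (simp add: algebra_simps)
        also have "\<dots> \<le> of_int (\<lfloor>R * (1 - \<eta> / 2)\<rfloor> - \<lceil>R * (1 - \<eta>)\<rceil> + 1)"
          unfolding of_int_add of_int_diff by linarith
        also have "\<dots> \<le> real (card {\<lceil>R * (1 - \<eta>)\<rceil>..\<lfloor>R * (1 - \<eta> / 2)\<rfloor>})"
          by simp
        finally show ?thesis .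
      qed
      moreover have "c * R \<le> real (card {0..\<lfloor>\<kappa> * R\<rfloor>})"
      proof -
        have "c * R \<le> \<kappa> * R" using R0 by (intro mult_right_mono) (auto simp: c_def)
        also have "\<dots> \<le> of_int (\<lfloor>\<kappa> * R\<rfloor> + 1)" by linarith
        also have "\<dots> \<le> real (card {0..\<lfloor>\<kappa> * R\<rfloor>})" by simp
        finally show ?thesis .
      qed
      ultimately show "0 \<le> (if j = i then 1 else c * R) \<and> (if j = i then 1 else c * R) \<le> real (card (A j))"
        using c R0 by (auto simp: A_def)
    qed
    moreover have "(\<Prod>j\<in>(UNIV :: 'n set). if j = i then 1 else c * R) = (c * R) ^ (CARD('n) - 1)"
      by (subst prod.If_cases) (auto simp: Compl_eq_Diff_UNIV card_Diff_subset)
    moreover have "card F \<le> card (shell (R\<^sup>2) (a * R) :: ('n \<Rightarrow> int) set)"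
    proof (rule card_inj_on_le[of \<Phi>])
      show "inj_on \<Phi> F"
      proof (rule inj_onI)
        fix g f assume "g \<in> F" "f \<in> F" and eq: "\<Phi> g = \<Phi> f"
        then have "g i = 0" "f i = 0" by (auto simp: F_def A_def dest!: spec[of _ i])
        then have "g j = f j" for j
          using fun_cong[OF eq, of j] by (cases "j = i") (simp_all add: \<Phi>_def)
        then show "g = f" by auto
      qed
      show "finite (shell (R\<^sup>2) (a * R) :: ('n \<Rightarrow> int) set)" by (rule finite_shell)
      show "\<Phi> ` F \<subseteq> shell (R\<^sup>2) (a * R)"
      proof clarify
        fix g assume "g \<in> F"
        then have g: "g j \<in> A j" for j by (auto simp: F_def)
        define P where "P = \<eta> * R\<^sup>2"
        have gi: "g i = 0" using g[of i] by (simp add: A_def)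
        have gm: "R * (1 - \<eta>) \<le> of_int (g m)" "of_int (g m) \<le> R * (1 - \<eta> / 2)"
          using g[of m] im by (auto simp: A_def ceiling_le_iff le_floor_iff)
        have gj: "(real_of_int (g j))\<^sup>2 \<le> (\<kappa> * R)\<^sup>2" if "j \<noteq> m" for j
          using g[of j] that \<kappa>(1) R0 by (auto simp: A_def le_floor_iff intro!: power_mono split: if_splits)
        have "nsq g = (of_int (g m))\<^sup>2 + (\<Sum>j\<in>UNIV - {m}. (of_int (g j))\<^sup>2)"
          unfolding nsq_def by (rule sum.remove) auto
        moreover have "(\<Sum>j\<in>UNIV - {m}. (real_of_int (g j))\<^sup>2) \<le> real CARD('n) * (\<kappa> * R)\<^sup>2"
        proof -
          have "(\<Sum>j\<in>UNIV - {m}. (real_of_int (g j))\<^sup>2) \<le> (\<Sum>j\<in>UNIV - {m}. (\<kappa> * R)\<^sup>2)"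
            by (rule sum_mono) (use gj in auto)
          also have "\<dots> \<le> (\<Sum>j\<in>(UNIV :: 'n set). (\<kappa> * R)\<^sup>2)"
            by (rule sum_mono2) auto
          finally show ?thesis by simp
        qed
        moreover have "real CARD('n) * (\<kappa> * R)\<^sup>2 = P / 2"
          using \<kappa>(2) by (simp add: power_mult_distrib P_def)
        moreover have "(of_int (g m))\<^sup>2 \<le> (R * (1 - \<eta> / 2))\<^sup>2"
        proof (rule power_mono[OF gm(2)])
          have "0 \<le> R * (1 - \<eta>)" using R0 \<eta> by simp
          then show "0 \<le> real_of_int (g m)" using gm(1) by linarith
        qed
        moreover have "(R * (1 - \<eta> / 2))\<^sup>2 \<le> R\<^sup>2 - P / 2"
        proof -
          have "(1 - \<eta> / 2)\<^sup>2 \<le> 1 - \<eta> / 2"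
            using \<eta> by (simp add: power2_eq_square mult_left_le)
          then have "R\<^sup>2 * (1 - \<eta> / 2)\<^sup>2 \<le> R\<^sup>2 * (1 - \<eta> / 2)" by (intro mult_left_mono) auto
          also have "\<dots> = R\<^sup>2 - P / 2" by (simp add: P_def algebra_simps)
          finally show ?thesis unfolding power_mult_distrib .
        qed
        moreover have "(R * (1 - \<eta>))\<^sup>2 \<le> (of_int (g m))\<^sup>2"
          using gm R0 \<eta> by (intro power_mono) auto
        moreover have "R\<^sup>2 - 2 * P \<le> (R * (1 - \<eta>))\<^sup>2"
        proof -
          have "R\<^sup>2 * (1 - 2 * \<eta>) \<le> R\<^sup>2 * (1 - \<eta>)\<^sup>2"
            by (intro mult_left_mono) (auto simp: power2_diff)
          also have "R\<^sup>2 * (1 - 2 * \<eta>) = R\<^sup>2 - 2 * P" by (simp add: P_def algebra_simps)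
          finally show ?thesis unfolding power_mult_distrib .
        qed
        moreover have "(\<Sum>j\<in>UNIV - {m}. (real_of_int (g j))\<^sup>2) \<ge> 0"
          by (rule sum_nonneg) auto
        ultimately have up: "nsq g \<le> R\<^sup>2" and low: "R\<^sup>2 - nsq g \<le> 2 * P"
          by linarith+
        define s where "s = sqrt (R\<^sup>2 - nsq g)"
        have s0: "s \<ge> 0" "s\<^sup>2 = R\<^sup>2 - nsq g" using up by (auto simp: s_def)
        have "s \<le> sqrt ((a * R / 4)\<^sup>2)"
          unfolding s_def
        proof (rule real_sqrt_le_mono)
          have "2 * \<eta> * R\<^sup>2 \<le> a\<^sup>2 / 16 * R\<^sup>2" using \<eta> by (intro mult_right_mono) auto
          then show "R\<^sup>2 - nsq g \<le> (a * R / 4)\<^sup>2"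
            using low by (simp add: P_def power_mult_distrib power_divide)
        qed
        then have s1: "s \<le> a * R / 4" using a R0 by simp
        define x where "x = real_of_int \<lfloor>s\<rfloor>"
        have x: "0 \<le> x" "x \<le> s" "s - x \<le> 1"
          using s0(1) unfolding x_def by (simp, linarith, linarith)
        have "nsq (\<Phi> g) = nsq g + x\<^sup>2"
        proof -
          have "nsq (\<Phi> g) = x\<^sup>2 + (\<Sum>j\<in>UNIV - {i}. (of_int (g j))\<^sup>2)"
            unfolding nsq_def by (subst sum.remove[of _ i]) (auto simp: \<Phi>_def x_def s_def nsq_def intro!: sum.cong)
          moreover have "nsq g = (of_int (g i))\<^sup>2 + (\<Sum>j\<in>UNIV - {i}. (of_int (g j))\<^sup>2)"
            unfolding nsq_def by (rule sum.remove) auto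
          ultimately show ?thesis using gi by simp
        qed
        moreover have "x\<^sup>2 \<le> s\<^sup>2" using x by (intro power_mono) auto
        \<comment> \<open>The loss by rounding down to x, at most a R / 2 by the bound on s.\<close>
        moreover have "s\<^sup>2 - x\<^sup>2 \<le> 2 * s"
        proof -
          have "s\<^sup>2 - x\<^sup>2 = (s - x) * (s + x)" by (simp add: power2_eq_square algebra_simps)
          also have "\<dots> \<le> 1 * (s + x)" using x s0 by (intro mult_right_mono) auto
          finally show ?thesis using x by simp
        qed
        moreover have "0 < a * R" using a R0 by simp
        ultimately show "\<Phi> g \<in> shell (R\<^sup>2) (a * R)"
          using s0 s1 unfolding shell_def by (simp add: abs_le_iff)
      qed
    qed
    ultimately show ?thesis
      by (simp add: power_mult_distrib)
  qed
  then show ?thesis using c by (intro exI[of _ "c ^ (CARD('n) - 1)"]) auto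
qed

section \<open>Cells of the torus\<close>

text \<open>Fractional parts make the index independent of the representative; the cells form a
  half-open grid that partitions the torus.\<close>

definition cell_index :: "nat \<Rightarrow> 'n::finite torus \<Rightarrow> 'n \<Rightarrow> int"
  where "cell_index M X = (\<lambda>i. \<lfloor>real M * frac (rep_torus X $ i)\<rfloor>)"

definition cell :: "nat \<Rightarrow> ('n \<Rightarrow> int) \<Rightarrow> 'n::finite torus set"
  where "cell M c = {X. cell_index M X = c}"

definition cells :: "nat \<Rightarrow> ('n::finite \<Rightarrow> int) set"
  where "cells M = {c. \<forall>i. c i \<in> {0..<int M}}"

lemma finite_cells: "finite (cells M)"
  unfolding cells_def by (rule card_Pi_UNIV) simp

lemma card_cells: "card (cells M :: ('n::finite \<Rightarrow> int) set) = M ^ CARD('n)"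
  unfolding cells_def by (subst card_Pi_UNIV) auto

lemma frac_rep_torus: "frac (rep_torus (abs_torus x) $ i) = frac (x $ i)"
proof -
  have "rep_torus (abs_torus x) $ i - x $ i \<in> \<int>" by (rule rep_torus_abs_torus)
  then obtain k where "rep_torus (abs_torus x) $ i = x $ i + of_int k"
    by (metis Ints_cases add_diff_cancel_left' add.commute diff_add_cancel)
  then show ?thesis by (simp add: frac_def)
qed

lemma cell_index_abs_torus: "cell_index M (abs_torus x) i = \<lfloor>real M * frac (x $ i)\<rfloor>"
  by (simp add: cell_index_def frac_rep_torus)

text \<open>Outside the unit cell the grid index wraps around modulo M. This form handles balls that
  cross the boundary of the fundamental domain.\<close>

lemma cell_index_abs_torus_mod:
  assumes "M > 0"
  shows "cell_index M (abs_torus x) i = \<lfloor>real M * x $ i\<rfloor> mod int M"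
proof -
  have "real M * x $ i = real M * frac (x $ i) + of_int (int M * \<lfloor>x $ i\<rfloor>)"
    by (simp add: frac_def algebra_simps)
  then have "\<lfloor>real M * x $ i\<rfloor> = \<lfloor>real M * frac (x $ i)\<rfloor> + int M * \<lfloor>x $ i\<rfloor>"
    by (metis floor_add_int)
  moreover have "0 \<le> \<lfloor>real M * frac (x $ i)\<rfloor>" "\<lfloor>real M * frac (x $ i)\<rfloor> < int M"
    using assms frac_lt_1[of "x $ i"] by (auto simp: floor_less_iff)
  ultimately show ?thesis by (simp add: cell_index_abs_torus)
qed

lemma cell_index_in_cells:
  assumes "M > 0" shows "cell_index M X \<in> cells M"
  using assms frac_lt_1 by (auto simp: cells_def cell_index_def floor_less_iff)

text \<open>For 0 <= t < 1 the sublevel set is the image of a compact slab of the closed cube, hence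
  closed. Here t < 1 keeps the face x_i = 1, where the fractional part drops to 0, out of the
  slab.\<close>

lemma frac_rep_torus_measurable [measurable]:
  "(\<lambda>X :: 'n::finite torus. frac (rep_torus X $ i)) \<in> borel_measurable borel"
  unfolding borel_measurable_iff_le
proof
  fix t :: real
  let ?S = "{X \<in> space borel. frac (rep_torus X $ i) \<le> t} :: 'n torus set"
  consider "t < 0" | "1 \<le> t" | "0 \<le> t" "t < 1" by linarith
  then show "?S \<in> sets borel"
  proof cases
    case 1
    then have "?S = {}" using frac_ge_0 by (auto simp: not_le intro: less_le_trans)
    then show ?thesis by simp
  next
    case 2
    then have "?S = UNIV" using frac_lt_1 by (auto intro: less_imp_le less_le_trans)
    then show ?thesis by simp
  next
    case 3
    let ?C = "cbox 0 1 \<inter> {x :: real ^ 'n. x $ i \<le> t}"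
    have "?S = abs_torus ` ?C"
    proof (intro equalityI subsetI)
      fix X assume "X \<in> ?S"
      then have "frac_vec (rep_torus X) \<in> ?C"
        by (auto simp: mem_box_cart frac_vec_def less_imp_le frac_lt_1)
      then show "X \<in> abs_torus ` ?C"
        using abs_torus_frac_vec[of "rep_torus X"] by (metis abs_torus_rep imageI)
    next
      fix X assume "X \<in> abs_torus ` ?C"
      then obtain x where x: "X = abs_torus x" "x \<in> ?C" by auto
      then have "0 \<le> x $ i" "x $ i \<le> t" by (auto simp: mem_box_cart)
      then have "frac (x $ i) = x $ i" using 3 by (simp add: frac_eq)
      then show "X \<in> ?S" using x \<open>x $ i \<le> t\<close> by (simp add: frac_rep_torus)
    qed
    moreover have "compact ?C"
      by (intro compact_Int_closed compact_cbox closed_Collect_le continuous_on_component continuous_on_const continuous_on_id)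
    then have "closed (abs_torus ` ?C)"
      using compact_continuous_image[OF continuous_on_abs_torus] compact_imp_closed by blast
    ultimately show ?thesis by simp
  qed
qed

lemma sets_cell [measurable]: "cell M c \<in> sets borel"
proof -
  have "cell M c = {X \<in> space borel. \<forall>i. \<lfloor>real M * frac (rep_torus X $ i)\<rfloor> = c i}"
    by (auto simp: cell_def cell_index_def fun_eq_iff)
  also have "\<dots> \<in> sets borel" by measurable
  finally show ?thesis .
qed

lemma measure_cell:
  fixes c :: "'n::finite \<Rightarrow> int"
  assumes M: "M > 0" and c: "c \<in> cells M"
  shows "measure torus_vol (cell M c) = (1 / real M) ^ CARD('n)"
proof -
  have "abs_torus -` cell M c \<inter> unit_cell
      = {x. \<forall>i. (\<chi> i. of_int (c i) / real M) $ i \<le> x $ i \<and> x $ i < (\<chi> i. (of_int (c i) + 1) / real M) $ i}"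
    (is "?L = ?R")
  proof (intro equalityI subsetI)
    fix x assume "x \<in> ?L"
    then have x: "cell_index M (abs_torus x) i = c i" "0 \<le> x $ i" "x $ i < 1" for i
      by (auto simp: cell_def)
    have "\<lfloor>real M * x $ i\<rfloor> = c i" for i
      using x[of i] by (simp add: cell_index_abs_torus frac_eq)
    then have "of_int (c i) \<le> real M * x $ i \<and> real M * x $ i < of_int (c i) + 1" for i
      by (simp add: floor_eq_iff)
    then show "x \<in> ?R" using M by (simp add: field_simps)
  next
    fix x assume "x \<in> ?R"
    then have x: "of_int (c i) \<le> real M * x $ i" "real M * x $ i < of_int (c i) + 1" for i
      using M by (simp_all add: field_simps)
    have c': "0 \<le> c i" "c i + 1 \<le> int M" for i
      using c[unfolded cells_def] by (simp_all add: zless_imp_add1_zle)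
    have u: "0 \<le> x $ i" "x $ i < 1" for i
    proof -
      have "0 \<le> real M * x $ i" using x(1)[of i] c'(1)[of i] by linarith
      then show "0 \<le> x $ i" using M by (simp add: zero_le_mult_iff)
      have "real M * x $ i < real M * 1" using x(2)[of i] c'(2)[of i] by linarith
      then show "x $ i < 1" using M by simp
    qed
    have "cell_index M (abs_torus x) i = c i" for i
      using x[of i] u[of i] by (simp add: cell_index_abs_torus frac_eq floor_eq_iff)
    then show "x \<in> ?L" using u by (auto simp: cell_def)
  qed
  then have "emeasure torus_vol (cell M c) = ennreal (\<Prod>i\<in>(UNIV :: 'n set). 1 / real M)"
    using M by (simp only: emeasure_torus_vol[OF sets_cell], subst emeasure_half_open_cell)
      (auto simp: divide_right_mono add_divide_distrib)
  then show ?thesis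
    by (simp add: measure_def)
qed

section \<open>Comparison of cells and geodesic balls\<close>

lemma cell_subset_ball:
  fixes X :: "'n::finite torus"
  assumes M: "M > 0" and r: "real CARD('n) < real M * r"
  shows "cell M (cell_index M X) \<subseteq> ball X r"
proof
  fix Y assume "Y \<in> cell M (cell_index M X)"
  then have eq: "\<lfloor>real M * frac (rep_torus Y $ i)\<rfloor> = \<lfloor>real M * frac (rep_torus X $ i)\<rfloor>" for i
    by (auto simp: cell_def cell_index_def fun_eq_iff)
  let ?x = "frac_vec (rep_torus X)" and ?y = "frac_vec (rep_torus Y)"
  have "\<bar>(?x - ?y) $ i\<bar> \<le> 1 / real M" for i
  proof -
    have "\<bar>real M * frac (rep_torus X $ i) - real M * frac (rep_torus Y $ i)\<bar> \<le> 1"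
      using eq[of i] by linarith
    then have "real M * \<bar>frac (rep_torus X $ i) - frac (rep_torus Y $ i)\<bar> \<le> 1"
      by (simp add: abs_mult flip: right_diff_distrib)
    then show ?thesis using M by (simp add: frac_vec_def field_simps)
  qed
  \<comment> \<open>The Euclidean norm is estimated by the l1 norm, which is the origin of the
    condition d < M r.\<close>
  then have "(\<Sum>i\<in>UNIV. \<bar>(?x - ?y) $ i\<bar>) \<le> real CARD('n) * (1 / real M)"
    by (intro sum_bounded_above) auto
  then have "dist ?x ?y \<le> real CARD('n) / real M"
    using norm_le_l1_cart[of "?x - ?y"] by (simp add: dist_norm)
  also have "\<dots> < r" using M r by (simp add: field_simps)
  finally have "dist (abs_torus ?x) (abs_torus ?y) < r"
    using dist_abs_torus_le le_less_trans by blast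
  then show "Y \<in> ball X r" by (simp add: abs_torus_frac_vec)
qed

text \<open>With representatives at minimal distance, M x_i and M y_i differ by at most M r <= J -
  1, so their floors differ by at most J. Reduction modulo M can only identify indices.\<close>

lemma card_cell_index_ball:
  fixes X :: "'n::finite torus"
  assumes M: "M > 0" and r: "real M * r + 1 \<le> real J"
  shows "finite (cell_index M ` ball X r)" "card (cell_index M ` ball X r) \<le> (2 * J + 1) ^ CARD('n)"
proof -
  obtain x where X: "X = abs_torus x" by (cases X rule: torus_exhaust)
  define P where "P = {p :: 'n \<Rightarrow> int. \<forall>i. p i \<in> {\<lfloor>real M * x $ i\<rfloor> - int J..\<lfloor>real M * x $ i\<rfloor> + int J}}"
  have P: "finite P" "card P = (2 * J + 1) ^ CARD('n)"
  proof -
    have "card {q - int J..q + int J} = 2 * J + 1" for q :: int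
      by (simp add: nat_eq_iff)
    then show "card P = (2 * J + 1) ^ CARD('n)"
      unfolding P_def by (subst card_Pi_UNIV) simp_all
    show "finite P"
      unfolding P_def by (rule card_Pi_UNIV) simp
  qed
  have sub: "cell_index M ` ball X r \<subseteq> (\<lambda>p i. p i mod int M) ` P"
  proof clarify
    fix Y assume "Y \<in> ball X r"
    then have "dist (abs_torus x) Y < r" by (simp add: X)
    moreover obtain y where y: "Y = abs_torus y" "dist (abs_torus x) Y = dist x y"
      by (rule dist_abs_torus_attained)
    ultimately have xy: "dist x y < r" by simp
    have "\<lfloor>real M * y $ i\<rfloor> \<in> {\<lfloor>real M * x $ i\<rfloor> - int J..\<lfloor>real M * x $ i\<rfloor> + int J}" for i
    proof -
      have "\<bar>x $ i - y $ i\<bar> < r"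
        using component_le_norm_cart[of "x - y" i] xy by (simp add: dist_norm)
      then have "real M * \<bar>x $ i - y $ i\<bar> \<le> real M * r"
        by (intro mult_left_mono) auto
      then have "\<bar>real M * x $ i - real M * y $ i\<bar> \<le> real J - 1"
        using r by (simp add: abs_mult flip: right_diff_distrib)
      then show ?thesis unfolding atLeastAtMost_iff by linarith
    qed
    then have "(\<lambda>i. \<lfloor>real M * y $ i\<rfloor>) \<in> P" by (simp add: P_def)
    moreover have "cell_index M Y = (\<lambda>i. \<lfloor>real M * y $ i\<rfloor> mod int M)"
      using cell_index_abs_torus_mod[OF M] by (auto simp: y(1))
    ultimately show "cell_index M Y \<in> (\<lambda>p i. p i mod int M) ` P" by auto
  qed
  show "finite (cell_index M ` ball X r)" using sub P(1) finite_surj by blast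
  show "card (cell_index M ` ball X r) \<le> (2 * J + 1) ^ CARD('n)"
    using surj_card_le[OF P(1) sub] P(2) by simp
qed

text \<open>The cell of the centre lies in the ball, and the cells that meet the ball cover it. A
  general f is allowed because f = 1 yields the volume of the ball.\<close>

lemma ball_integral_bounds:
  fixes f :: "'n::finite torus \<Rightarrow> real"
  assumes M: "M > 0" and r: "real CARD('n) < real M * r" "real M * r + 1 \<le> real J"
    and f: "integrable torus_vol f" "\<And>X. f X \<ge> 0"
    and lo: "\<And>c. c \<in> cells M \<Longrightarrow> lo \<le> (LINT y|torus_vol. indicator (cell M c) y * f y)"
    and hi: "\<And>c. c \<in> cells M \<Longrightarrow> (LINT y|torus_vol. indicator (cell M c) y * f y) \<le> hi"
    and hi0: "0 \<le> hi"
  shows "lo \<le> (LINT y:ball X r|torus_vol. f y)"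
    and "(LINT y:ball X r|torus_vol. f y) \<le> real ((2 * J + 1) ^ CARD('n)) * hi"
proof -
  let ?T = "cell_index M ` ball X r"
  have int: "integrable torus_vol (\<lambda>y. indicator A y * f y)" if "A \<in> sets borel" for A
    using integrable_real_mult_indicator[of A torus_vol f] f(1) that by (simp add: mult.commute)
  have ballint: "(LINT y:ball X r|torus_vol. f y) = (LINT y|torus_vol. indicator (ball X r) y * f y)"
    by (simp add: set_lebesgue_integral_def)
  have "lo \<le> (LINT y|torus_vol. indicator (cell M (cell_index M X)) y * f y)"
    by (rule lo) (rule cell_index_in_cells[OF M])
  also have "\<dots> \<le> (LINT y|torus_vol. indicator (ball X r) y * f y)"
    using cell_subset_ball[OF M r(1), of X] f(2)
    by (intro integral_mono int) (auto simp: indicator_def)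
  finally show "lo \<le> (LINT y:ball X r|torus_vol. f y)" unfolding ballint .
  note T = card_cell_index_ball[OF M r(2), of X]
  have "(LINT y|torus_vol. indicator (ball X r) y * f y)
      \<le> (LINT y|torus_vol. (\<Sum>c\<in>?T. indicator (cell M c) y * f y))"
  proof (intro integral_mono int Bochner_Integration.integrable_sum)
    fix y
    show "indicator (ball X r) y * f y \<le> (\<Sum>c\<in>?T. indicator (cell M c) y * f y)"
    proof (cases "y \<in> ball X r")
      case True
      have "indicator (cell M (cell_index M y)) y * f y \<le> (\<Sum>c\<in>?T. indicator (cell M c) y * f y)"
        by (rule member_le_sum) (use True T f in auto)
      then show ?thesis using True by (simp add: cell_def)
    qed (auto intro!: sum_nonneg mult_nonneg_nonneg f)
  qed auto
  also have "\<dots> = (\<Sum>c\<in>?T. (LINT y|torus_vol. indicator (cell M c) y * f y))"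
    by (rule Bochner_Integration.integral_sum) (auto intro: int)
  also have "\<dots> \<le> real (card ?T) * hi"
    by (intro sum_bounded_above hi) (auto intro: cell_index_in_cells[OF M])
  also have "\<dots> \<le> real ((2 * J + 1) ^ CARD('n)) * hi"
    using T(2) hi0 by (intro mult_right_mono) (simp_all only: of_nat_le_iff)
  finally show "(LINT y:ball X r|torus_vol. f y) \<le> real ((2 * J + 1) ^ CARD('n)) * hi"
    unfolding ballint .
qed

text \<open>The mass on every cell agrees with the cell volume up to a relative error of 1/2. Mere
  comparability is the aim, so the error may stay fixed as h tends to 0.\<close>

definition good :: "nat \<Rightarrow> ('n::finite torus \<Rightarrow> complex) \<Rightarrow> bool"
  where "good M f \<longleftrightarrow> (\<forall>c\<in>cells M.
    \<bar>(LINT y|torus_vol. indicator (cell M c) y * (cmod (f y))\<^sup>2) - (1 / real M) ^ CARD('n)\<bar>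
      \<le> (1 / real M) ^ CARD('n) / 2)"

text \<open>With v the volume of a cell, the mass of the ball lies between v / 2 and 3 K v / 2, and
  its volume between v and K v.\<close>

lemma good_ball_average:
  fixes f :: "'n::finite torus \<Rightarrow> complex"
  assumes M: "M > 0" and r: "real CARD('n) < real M * r" "real M * r + 1 \<le> real J"
    and f: "continuous_on UNIV f" and good: "good M f"
  defines "K \<equiv> real ((2 * J + 1) ^ CARD('n))"
  shows "(LINT y:ball X r|torus_vol. (cmod (f y))\<^sup>2) / measure torus_vol (ball X r) \<in> {1 / (2 * K)..3 * K / 2}"
proof -
  let ?v = "(1 / real M) ^ CARD('n)"
  have v: "?v > 0" using M by simp
  have K: "K > 0" by (simp add: K_def)
  have bnd: "?v / 2 \<le> (LINT y|torus_vol. indicator (cell M c) y * (cmod (f y))\<^sup>2)"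
    "(LINT y|torus_vol. indicator (cell M c) y * (cmod (f y))\<^sup>2) \<le> 3 / 2 * ?v" if "c \<in> cells M" for c
  proof -
    have "\<bar>(LINT y|torus_vol. indicator (cell M c) y * (cmod (f y))\<^sup>2) - ?v\<bar> \<le> ?v / 2"
      using good that unfolding good_def by blast
    then show "?v / 2 \<le> (LINT y|torus_vol. indicator (cell M c) y * (cmod (f y))\<^sup>2)"
      "(LINT y|torus_vol. indicator (cell M c) y * (cmod (f y))\<^sup>2) \<le> 3 / 2 * ?v"
      by linarith+
  qed
  have cont: "continuous_on UNIV (\<lambda>y. (cmod (f y))\<^sup>2)"
    by (intro continuous_on_power continuous_on_norm f)
  have 1: "?v / 2 \<le> (LINT y:ball X r|torus_vol. (cmod (f y))\<^sup>2)"
    "(LINT y:ball X r|torus_vol. (cmod (f y))\<^sup>2) \<le> K * (3 / 2 * ?v)"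
    unfolding K_def using v
    by (intro ball_integral_bounds[OF M r integrable_torus_vol[OF cont] _ bnd]; simp)+
  have cellv: "(LINT y|torus_vol. indicator (cell M c) y * 1) = ?v" if "c \<in> cells M" for c :: "'n \<Rightarrow> int"
    using measure_cell[OF M that] by simp
  have "?v \<le> (LINT y:ball X r|torus_vol. 1)" "(LINT y:ball X r|torus_vol. 1) \<le> K * ?v"
    unfolding K_def using v cellv
    by (intro ball_integral_bounds[OF M r, where f = "\<lambda>_. 1" and lo = ?v and hi = ?v]; simp)+
  moreover have "(LINT y:ball X r|torus_vol. (1 :: real)) = measure torus_vol (ball X r)"
    by (simp add: set_lebesgue_integral_def)
  ultimately have 2: "?v \<le> measure torus_vol (ball X r)" "measure torus_vol (ball X r) \<le> K * ?v"
    by simp_all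
  have m: "measure torus_vol (ball X r) > 0" using 2(1) v by linarith
  have "1 / (2 * K) * measure torus_vol (ball X r) \<le> 1 / (2 * K) * (K * ?v)"
    using 2(2) K by (intro mult_left_mono) auto
  also have "\<dots> = ?v / 2" using K by simp
  finally have "1 / (2 * K) * measure torus_vol (ball X r) \<le> (LINT y:ball X r|torus_vol. (cmod (f y))\<^sup>2)"
    using 1(1) by linarith
  moreover have "3 * K / 2 * ?v \<le> 3 * K / 2 * measure torus_vol (ball X r)"
    using 2(1) K by (intro mult_left_mono) auto
  then have "(LINT y:ball X r|torus_vol. (cmod (f y))\<^sup>2) \<le> 3 * K / 2 * measure torus_vol (ball X r)"
    using 1(2) by linarith
  ultimately show ?thesis
    unfolding atLeastAtMost_iff pos_le_divide_eq[OF m] pos_divide_le_eq[OF m] by blast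
qed

section \<open>Density of the good basis functions\<close>

definition freqs :: "real \<Rightarrow> real \<Rightarrow> ('n::finite \<Rightarrow> int) set"
  where "freqs \<alpha> h = {n. 4 * pi\<^sup>2 * h\<^sup>2 * nsq n \<in> {1 - \<alpha> * h..1 + \<alpha> * h}}"

text \<open>Division of the window by 4 pi^2 h^2 gives radius R = 1 / (2 pi h) and width (\<alpha> /
  (2 pi)) R.\<close>

lemma freqs_eq_shell:
  assumes "h > 0"
  shows "freqs \<alpha> h = shell ((1 / (2 * pi * h))\<^sup>2) (\<alpha> / (2 * pi) * (1 / (2 * pi * h)))"
proof -
  have "\<bar>x - (1 / (2 * pi * h))\<^sup>2\<bar> \<le> \<alpha> / (2 * pi) * (1 / (2 * pi * h))
      \<longleftrightarrow> 4 * pi\<^sup>2 * h\<^sup>2 * x \<in> {1 - \<alpha> * h..1 + \<alpha> * h}" for x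
  proof -
    have p: "0 < 4 * pi\<^sup>2 * h\<^sup>2" using assms by simp
    have "\<bar>x - (1 / (2 * pi * h))\<^sup>2\<bar> \<le> \<alpha> / (2 * pi) * (1 / (2 * pi * h))
      \<longleftrightarrow> (4 * pi\<^sup>2 * h\<^sup>2) * \<bar>x - (1 / (2 * pi * h))\<^sup>2\<bar> \<le> (4 * pi\<^sup>2 * h\<^sup>2) * (\<alpha> / (2 * pi) * (1 / (2 * pi * h)))"
      using p by (simp only: mult_le_cancel_left_pos)
    also have "(4 * pi\<^sup>2 * h\<^sup>2) * (\<alpha> / (2 * pi) * (1 / (2 * pi * h))) = \<alpha> * h"
      using assms by (simp add: field_simps power2_eq_square)
    also have "(4 * pi\<^sup>2 * h\<^sup>2) * \<bar>x - (1 / (2 * pi * h))\<^sup>2\<bar> = \<bar>(4 * pi\<^sup>2 * h\<^sup>2) * (x - (1 / (2 * pi * h))\<^sup>2)\<bar>"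
      unfolding abs_mult[of "4 * pi\<^sup>2 * h\<^sup>2"] abs_of_pos[OF p] ..
    also have "(4 * pi\<^sup>2 * h\<^sup>2) * (x - (1 / (2 * pi * h))\<^sup>2) = 4 * pi\<^sup>2 * h\<^sup>2 * x - 1"
      using assms by (simp add: right_diff_distrib power_divide power_mult_distrib)
    finally show ?thesis by auto
  qed
  then show ?thesis by (auto simp: freqs_def shell_def)
qed

text \<open>The characters of the window are independent members of the spectral space, and the
  given basis is a spanning set with at most \<open>cfun.dim\<close> elements; the exchange lemma
  compares the two.\<close>

lemma card_freqs_le_dim:
  fixes \<psi> :: "nat \<Rightarrow> 'n::finite torus \<Rightarrow> complex"
  assumes h: "h > 0" and basis: "orthonormal_eigenbasis \<alpha> h \<psi>"
  shows "card (freqs \<alpha> h :: ('n \<Rightarrow> int) set) \<le> cfun.dim (spectral_space \<alpha> h :: ('n torus \<Rightarrow> complex) set)"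
proof -
  let ?S = "freqs \<alpha> h :: ('n \<Rightarrow> int) set"
  let ?H = "spectral_space \<alpha> h :: ('n torus \<Rightarrow> complex) set"
  have fin: "finite ?S" unfolding freqs_eq_shell[OF h] by (rule finite_shell)
  have span: "cfun.span (\<psi> ` {1..cfun.dim ?H}) = ?H"
    using basis unfolding orthonormal_eigenbasis_def Let_def by blast
  have "tchar ` ?S \<subseteq> ?H"
    unfolding spectral_space_def freqs_def
    using eigenfunction_tchar by (intro image_subsetI cfun.span_base) blast
  then have "card (tchar ` ?S) \<le> card (\<psi> ` {1..cfun.dim ?H})"
    using cfun.independent_span_bound[OF _ independent_tchar[OF fin]] span by blast
  also have "\<dots> \<le> cfun.dim ?H"
    using card_image_le[of "{1..cfun.dim ?H}" \<psi>] by simp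
  finally show ?thesis
    by (simp add: card_image inj_on_subset[OF inj_tchar])
qed

text \<open>On a cell of volume v, each failing index contributes at least (v / 2)^2 to a variance
  of at most K v. So at most 4 K / v = 4 M^d K indices fail there, and M^d cells give the second
  factor M^d.\<close>

lemma card_not_good_le:
  fixes \<psi> :: "nat \<Rightarrow> 'n::finite torus \<Rightarrow> complex"
  assumes h: "h > 0" and M: "M > 0" and basis: "orthonormal_eigenbasis \<alpha> h \<psi>"
    and K: "\<And>k :: 'n \<Rightarrow> int. k \<noteq> 0 \<Longrightarrow>
      real (card {m \<in> freqs \<alpha> h. m + k \<in> freqs \<alpha> h \<and> nsq (m + k) = nsq m}) \<le> K"
  shows "real (card {j \<in> {1..cfun.dim (spectral_space \<alpha> h :: ('n torus \<Rightarrow> complex) set)}. \<not> good M (\<psi> j)})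
    \<le> 4 * real M ^ (2 * CARD('n)) * K"
proof -
  let ?H = "spectral_space \<alpha> h :: ('n torus \<Rightarrow> complex) set"
  define J where "J = {1..cfun.dim ?H}"
  define v where "v = (1 / real M) ^ CARD('n)"
  define D where "D = (\<lambda>c j. (LINT y|torus_vol. indicator (cell M c) y * (cmod (\<psi> j y))\<^sup>2) - v)"
  define B where "B = (\<lambda>c. {j \<in> J. v / 2 < \<bar>D c j\<bar>})"
  have v: "v > 0" using M by (simp add: v_def)
  have eig: "\<exists>E\<in>{1 - \<alpha> * h..1 + \<alpha> * h}. eigenfunction h E (\<psi> j)" if "j \<in> J" for j
    using basis that unfolding orthonormal_eigenbasis_def Let_def J_def by blast
  have orth: "L2_inner (\<psi> j) (\<psi> k) = (if j = k then 1 else 0)" if "j \<in> J" "k \<in> J" for j k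
    using basis that unfolding orthonormal_eigenbasis_def Let_def J_def by blast
  have finS: "finite (freqs \<alpha> h :: ('n \<Rightarrow> int) set)"
    unfolding freqs_eq_shell[OF h] by (rule finite_shell)
  have cardB: "real (card (B c)) \<le> 4 * real M ^ CARD('n) * K" if c: "c \<in> cells M" for c
  proof -
    have a: "bdd_borel (\<lambda>X. complex_of_real (indicator (cell M c) X))"
      unfolding bdd_borel_def by (auto intro!: exI[of _ 1] borel_measurable_of_real borel_measurable_indicator sets_cell simp: indicator_def)
    have intv: "(LINT X|torus_vol. indicator (cell M c) X) = v"
      using measure_cell[OF M c] by (simp add: v_def)
    have sq: "(indicator (cell M c) X)\<^sup>2 = (indicator (cell M c) X :: real)" for X
      by (simp add: indicator_def)
    have "real (card (B c)) * (v / 2)\<^sup>2 = (\<Sum>j\<in>B c. (v / 2)\<^sup>2)" by simp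
    also have "\<dots> \<le> (\<Sum>j\<in>B c. (D c j)\<^sup>2)"
    proof (rule sum_mono)
      fix j assume "j \<in> B c"
      then have "v / 2 \<le> \<bar>D c j\<bar>" by (simp add: B_def)
      then show "(v / 2)\<^sup>2 \<le> (D c j)\<^sup>2" using v power_mono[of "v / 2" "\<bar>D c j\<bar>" 2] by simp
    qed
    also have "\<dots> \<le> (\<Sum>j\<in>J. (D c j)\<^sup>2)"
      by (rule sum_mono2) (auto simp: B_def J_def)
    also have "\<dots> \<le> K * (LINT X|torus_vol. (indicator (cell M c) X)\<^sup>2)"
      using eigenbasis_variance[where J = J and S = "freqs \<alpha> h" and a = "indicator (cell M c)" and \<psi> = \<psi> and K = K,
          OF h _ finS _ eig orth K a]
      unfolding D_def intv by (simp add: J_def freqs_def)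
    also have "\<dots> = K * v" unfolding sq intv ..
    finally have "real (card (B c)) * (v / 2)\<^sup>2 \<le> K * v" .
    then have "real (card (B c)) * v * v \<le> 4 * K * v" by (simp add: power2_eq_square)
    then have "real (card (B c)) * v \<le> 4 * K" using v by simp
    then have "real (card (B c)) \<le> 4 * K / v" using v by (simp add: pos_le_divide_eq)
    also have "\<dots> = 4 * real M ^ CARD('n) * K" by (simp add: v_def power_divide)
    finally show ?thesis .
  qed
  have "{j \<in> J. \<not> good M (\<psi> j)} \<subseteq> (\<Union>c\<in>cells M. B c)"
    by (auto simp: good_def B_def D_def v_def not_le)
  then have "card {j \<in> J. \<not> good M (\<psi> j)} \<le> card (\<Union>c\<in>cells M. B c)"
    by (intro card_mono) (auto simp: finite_cells B_def J_def)
  also have "\<dots> \<le> (\<Sum>c\<in>cells M. card (B c))" by (rule card_UN_le[OF finite_cells])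
  finally have "real (card {j \<in> J. \<not> good M (\<psi> j)}) \<le> real (\<Sum>c\<in>cells M. card (B c))"
    by (simp only: of_nat_le_iff)
  also have "\<dots> = (\<Sum>c\<in>cells M. real (card (B c)))" by simp
  also have "\<dots> \<le> real (card (cells M :: ('n \<Rightarrow> int) set)) * (4 * real M ^ CARD('n) * K)"
    by (rule sum_bounded_above) (rule cardB)
  also have "\<dots> = 4 * real M ^ (2 * CARD('n)) * K"
    by (simp add: card_cells mult_2 power_add)
  finally show ?thesis unfolding J_def .
qed

text \<open>Equality of |m + k|^2 and |m|^2 is the linear equation 2 k.m = - |k|^2, so resonant m
  lie on a hyperplane.\<close>

lemma card_resonant_le:
  assumes "k \<noteq> 0" "h > 0"
  shows "card {m \<in> freqs \<alpha> h. m + k \<in> freqs \<alpha> h \<and> nsq (m + k) = nsq m}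
    \<le> card {n \<in> freqs \<alpha> h. (\<Sum>j\<in>UNIV. real_of_int (k j * n j)) = - nsq k / 2}"
proof (rule card_mono)
  show "finite {n \<in> freqs \<alpha> h. (\<Sum>j\<in>UNIV. real_of_int (k j * n j)) = - nsq k / 2}"
    unfolding freqs_eq_shell[OF assms(2)] by (rule finite_subset[OF _ finite_shell]) auto
  have "nsq (m + k) = nsq m + 2 * (\<Sum>j\<in>UNIV. real_of_int (k j * m j)) + nsq k" for m
    unfolding nsq_def by (simp add: power2_sum sum.distrib sum_distrib_left algebra_simps)
  then show "{m \<in> freqs \<alpha> h. m + k \<in> freqs \<alpha> h \<and> nsq (m + k) = nsq m}
    \<subseteq> {n \<in> freqs \<alpha> h. (\<Sum>j\<in>UNIV. real_of_int (k j * n j)) = - nsq k / 2}"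
    by auto
qed

theorem corollary1p5:
  fixes \<alpha> \<nu> :: real
  assumes "CARD('n::finite) \<ge> 2"
    and "\<alpha> > 0"
    and "0 < \<nu>" and "\<nu> < 2 / (7 * real CARD('n) + 4)"
  shows "let N = \<lambda>h. cfun.dim (spectral_space \<alpha> h :: ('n torus \<Rightarrow> complex) set) in
    \<exists>h\<^sub>0 a\<^sub>1 a\<^sub>2. 0 < h\<^sub>0 \<and> h\<^sub>0 \<le> 1 / 2 \<and> 0 < a\<^sub>1 \<and> 0 < a\<^sub>2 \<and>
    (\<forall>\<psi> :: real \<Rightarrow> nat \<Rightarrow> 'n torus \<Rightarrow> complex.
      (\<forall>h\<in>{0<..h\<^sub>0}. orthonormal_eigenbasis \<alpha> h (\<psi> h)) \<longrightarrow>
      (\<exists>\<Lambda> :: real \<Rightarrow> nat set.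
        (\<forall>h\<in>{0<..h\<^sub>0}. \<Lambda> h \<subseteq> {1..N h}) \<and>
        ((\<lambda>h. real (card (\<Lambda> h)) / real (N h)) \<longlongrightarrow> 1) (at_right 0) \<and>
        (\<forall>h\<in>{0<..h\<^sub>0}. \<forall>x. \<forall>j\<in>\<Lambda> h.
          (LINT y:ball x (h powr \<nu>)|torus_vol. (cmod (\<psi> h j y))\<^sup>2)
              / measure torus_vol (ball x (h powr \<nu>)) \<in> {a\<^sub>1..a\<^sub>2})))"
proof -
  let ?d = "real CARD('n)"
  define N where "N = (\<lambda>h. cfun.dim (spectral_space \<alpha> h :: ('n torus \<Rightarrow> complex) set))"
  define \<delta> :: real where "\<delta> = (if CARD('n) = 2 then 1 / 2 else 3 / 4)"
  define a where "a = \<alpha> / (2 * pi)"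
  have a: "a > 0" using assms by (simp add: a_def)
  obtain C R\<^sub>0 where C: "\<And>R (k :: 'n \<Rightarrow> int) (c :: real). R \<ge> R\<^sub>0 \<Longrightarrow> k \<noteq> 0 \<Longrightarrow>
      real (card {n \<in> shell (R\<^sup>2) (a * R). (\<Sum>j\<in>UNIV. of_int (k j * n j)) = c}) \<le> C * R powr (?d - 1 - \<delta>)"
    using card_hyperplane_shell_le[OF assms(1) a, folded \<delta>_def] by blast
  obtain c R\<^sub>1 where c: "c > 0" and N_ge:
    "\<And>R. R \<ge> R\<^sub>1 \<Longrightarrow> c * R ^ (CARD('n) - 1) \<le> real (card (shell (R\<^sup>2) (a * R) :: ('n \<Rightarrow> int) set))"
    using card_shell_ge[OF assms(1) a] by blast
  define e where "e = \<delta> - 2 * ?d * \<nu>"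
  have e: "e > 0"
  proof -
    \<comment> \<open>For d = 2 the right-hand side is 4/9 <= 1/2; for d >= 3 it is below 4/7 <
      3/4.\<close>
    have "2 * ?d * \<nu> < 2 * ?d * (2 / (7 * ?d + 4))"
      using assms by (intro mult_strict_left_mono) auto
    also have "\<dots> \<le> \<delta>"
      using assms(1) by (auto simp: \<delta>_def field_simps)
    finally show ?thesis by (simp add: e_def)
  qed
  \<comment> \<open>About d / h^\<nu> cells per axis, so that a cell fits into the ball around any
    of its points; the added 1 makes d < M h^\<nu> strict. Then M h^\<nu> <= d + 2, whence
    \<open>J\<close>.\<close>
  define M where "M = (\<lambda>h. nat \<lceil>?d / h powr \<nu>\<rceil> + 1)"
  define J where "J = CARD('n) + 3"
  define K where "K = real ((2 * J + 1) ^ CARD('n))"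
  have K: "K > 0" by (simp add: K_def)
  have M: "M h > 0" "?d < real (M h) * h powr \<nu>" "real (M h) * h powr \<nu> + 1 \<le> real J"
    "real (M h) \<le> (?d + 2) * h powr (- \<nu>)" if h: "0 < h" "h \<le> 1 / 2" for h
  proof -
    let ?r = "h powr \<nu>"
    have r: "0 < ?r" "?r \<le> 1" using h assms(3) by (auto intro: powr_le1)
    have q: "0 \<le> ?d / ?r" using r by simp
    have lo: "?d / ?r < real (M h)" and up: "real (M h) \<le> ?d / ?r + 2"
      unfolding M_def using q by linarith+
    show "M h > 0" by (simp add: M_def)
    show "?d < real (M h) * ?r" using lo r by (simp add: pos_divide_less_eq)
    have "real (M h) * ?r \<le> (?d / ?r + 2) * ?r" using up r by (intro mult_right_mono) auto
    also have "\<dots> = ?d + 2 * ?r" using r by (simp add: distrib_right)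
    finally show "real (M h) * ?r + 1 \<le> real J" using r by (simp add: J_def)
    have "1 \<le> 1 / ?r" using r by simp
    then have "real (M h) \<le> ?d / ?r + 2 * (1 / ?r)" using up by linarith
    then show "real (M h) \<le> (?d + 2) * h powr (- \<nu>)"
      by (simp add: powr_minus_divide add_divide_distrib)
  qed
  \<comment> \<open>The bound for the bad indices divided by that for N(h); the factor (2
    pi)^\<delta> stems from R^(-\<delta>) = (2 pi h)^\<delta>. The absolute value is taken because
    the sign of \<open>C\<close> is not known.\<close>
  define Q where "Q = 4 * (?d + 2) ^ (2 * CARD('n)) * \<bar>C\<bar> / c * (2 * pi) powr \<delta>"
  have main: "\<exists>\<Lambda> :: real \<Rightarrow> nat set.
        (\<forall>h\<in>{0<..1 / 2}. \<Lambda> h \<subseteq> {1..N h}) \<and>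
        ((\<lambda>h. real (card (\<Lambda> h)) / real (N h)) \<longlongrightarrow> 1) (at_right 0) \<and>
        (\<forall>h\<in>{0<..1 / 2}. \<forall>x. \<forall>j\<in>\<Lambda> h.
          (LINT y:ball x (h powr \<nu>)|torus_vol. (cmod (\<psi> h j y))\<^sup>2)
              / measure torus_vol (ball x (h powr \<nu>)) \<in> {1 / (2 * K)..3 * K / 2})"
    if basis: "\<And>h. h \<in> {0<..1 / 2} \<Longrightarrow> orthonormal_eigenbasis \<alpha> h (\<psi> h)"
    for \<psi> :: "real \<Rightarrow> nat \<Rightarrow> 'n torus \<Rightarrow> complex"
  proof (intro exI conjI ballI allI)
    \<comment> \<open>With this choice the bounds on all balls hold for every h <= 1/2, uniformly
      over all eigenbases; small h matters only for the density.\<close>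
    define \<Lambda> where "\<Lambda> = (\<lambda>h. {j \<in> {1..N h}. good (M h) (\<psi> h j)})"
    show "\<Lambda> h \<subseteq> {1..N h}" for h by (auto simp: \<Lambda>_def)
    show "(LINT y:ball x (h powr \<nu>)|torus_vol. (cmod (\<psi> h j y))\<^sup>2)
              / measure torus_vol (ball x (h powr \<nu>)) \<in> {1 / (2 * K)..3 * K / 2}"
      if h: "h \<in> {0<..1 / 2}" and j: "j \<in> \<Lambda> h" for h x j
    proof -
      have "\<exists>E. eigenfunction h E (\<psi> h j)"
        using basis[OF h] j unfolding orthonormal_eigenbasis_def Let_def \<Lambda>_def N_def by blast
      then have "continuous_on UNIV (\<psi> h j)"
        by (auto simp: eigenfunction_def intro: continuous_on_C2_torus)
      then show ?thesis
        unfolding K_def using h j M[of h]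
        by (intro good_ball_average[of "M h"]) (auto simp: \<Lambda>_def)
    qed
    define R\<^sub>2 where "R\<^sub>2 = max 1 (max R\<^sub>0 R\<^sub>1)"
    \<comment> \<open>Below \<open>h\<^sub>1\<close> the radius R = 1 / (2 pi h) exceeds the
      thresholds of both lattice point counts.\<close>
    define h\<^sub>1 where "h\<^sub>1 = min (1 / 2) (1 / (2 * pi * R\<^sub>2))"
    have h1: "h\<^sub>1 > 0" by (simp add: h\<^sub>1_def R\<^sub>2_def)
    have bounds: "1 - Q * h powr e \<le> real (card (\<Lambda> h)) / real (N h)" "real (card (\<Lambda> h)) / real (N h) \<le> 1"
      if h: "0 < h" "h < h\<^sub>1" for h
    proof -
      have h12: "h \<in> {0<..1 / 2}" using h by (auto simp: h\<^sub>1_def)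
      define R where "R = 1 / (2 * pi * h)"
      have "2 * pi * R\<^sub>2 > 0" by (simp add: R\<^sub>2_def)
      moreover have "h < 1 / (2 * pi * R\<^sub>2)" using h by (simp add: h\<^sub>1_def)
      ultimately have "R > R\<^sub>2"
        using h unfolding R_def by (simp add: field_simps)
      then have R: "R \<ge> 1" "R \<ge> R\<^sub>0" "R \<ge> R\<^sub>1" by (auto simp: R\<^sub>2_def)
      have S: "freqs \<alpha> h = shell (R\<^sup>2) (a * R)"
        unfolding freqs_eq_shell[OF h(1)] R_def a_def ..
      define bad where "bad = {j \<in> {1..N h}. \<not> good (M h) (\<psi> h j)}"
      have "real (card bad) \<le> 4 * real (M h) ^ (2 * CARD('n)) * (\<bar>C\<bar> * R powr (?d - 1 - \<delta>))"
        unfolding bad_def N_def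
      proof (rule card_not_good_le[OF h(1) _ basis[OF h12]])
        show "M h > 0" using M h12 by auto
        fix k :: "'n \<Rightarrow> int" assume k: "k \<noteq> 0"
        have "real (card {m \<in> freqs \<alpha> h. m + k \<in> freqs \<alpha> h \<and> nsq (m + k) = nsq m})
          \<le> real (card {n \<in> freqs \<alpha> h. (\<Sum>j\<in>UNIV. real_of_int (k j * n j)) = - nsq k / 2})"
          using card_resonant_le[OF k h(1)] by (simp only: of_nat_le_iff)
        also have "\<dots> \<le> C * R powr (?d - 1 - \<delta>)"
          unfolding S by (rule C[OF R(2) k])
        also have "\<dots> \<le> \<bar>C\<bar> * R powr (?d - 1 - \<delta>)"
          by (intro mult_right_mono) auto
        finally show "real (card {m \<in> freqs \<alpha> h. m + k \<in> freqs \<alpha> h \<and> nsq (m + k) = nsq m})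
          \<le> \<bar>C\<bar> * R powr (?d - 1 - \<delta>)" .
      qed
      also have "\<dots> \<le> 4 * ((?d + 2) * h powr (- \<nu>)) ^ (2 * CARD('n)) * (\<bar>C\<bar> * R powr (?d - 1 - \<delta>))"
        using M(4)[of h] h12 by (intro mult_mono power_mono mult_right_mono) auto
      also have "\<dots> = 4 * (?d + 2) ^ (2 * CARD('n)) * \<bar>C\<bar> * ((h powr (- \<nu>)) ^ (2 * CARD('n)) * R powr (?d - 1 - \<delta>))"
        by (simp add: power_mult_distrib mult_ac)
      also have "(h powr (- \<nu>)) ^ (2 * CARD('n)) = h powr (- (2 * ?d * \<nu>))"
      proof -
        have "(h powr (- \<nu>)) ^ (2 * CARD('n)) = (h powr (- \<nu>)) powr real (2 * CARD('n))"
          using h by (subst powr_realpow) auto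
        then show ?thesis by (simp add: powr_powr mult_ac)
      qed
      also have "R powr (?d - 1 - \<delta>) = R ^ (CARD('n) - 1) * ((2 * pi) powr \<delta> * h powr \<delta>)"
      proof -
        have "R powr (?d - 1 - \<delta>) = R powr real (CARD('n) - 1) / R powr \<delta>"
          using assms(1) by (simp add: powr_diff of_nat_diff)
        also have "R powr real (CARD('n) - 1) = R ^ (CARD('n) - 1)"
          using R(1) by (intro powr_realpow) auto
        also have "R powr \<delta> = 1 / ((2 * pi) powr \<delta> * h powr \<delta>)"
          using h by (simp add: R_def powr_divide powr_mult)
        finally show ?thesis by simp
      qed
      also have "4 * (?d + 2) ^ (2 * CARD('n)) * \<bar>C\<bar> * (h powr (- (2 * ?d * \<nu>)) * (R ^ (CARD('n) - 1) * ((2 * pi) powr \<delta> * h powr \<delta>)))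
        = Q * c * (h powr \<delta> * h powr (- (2 * ?d * \<nu>))) * R ^ (CARD('n) - 1)"
        using c by (simp add: Q_def mult_ac)
      also have "h powr \<delta> * h powr (- (2 * ?d * \<nu>)) = h powr e"
        by (simp add: e_def flip: powr_add)
      finally have bad: "real (card bad) \<le> Q * c * h powr e * R ^ (CARD('n) - 1)" .
      have Nge: "c * R ^ (CARD('n) - 1) \<le> real (N h)"
      proof -
        have "c * R ^ (CARD('n) - 1) \<le> real (card (freqs \<alpha> h :: ('n \<Rightarrow> int) set))"
          unfolding S by (rule N_ge[OF R(3)])
        also have "\<dots> \<le> real (N h)"
          unfolding N_def using card_freqs_le_dim[OF h(1) basis[OF h12]] by (simp only: of_nat_le_iff)
        finally show ?thesis .
      qed
      have N0: "real (N h) > 0" using Nge c R(1) by (intro less_le_trans[OF _ Nge]) simp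
      have Q: "Q \<ge> 0" using c by (simp add: Q_def)
      have "real (card bad) \<le> Q * h powr e * (c * R ^ (CARD('n) - 1))"
        using bad by (simp add: mult_ac)
      also have "\<dots> \<le> Q * h powr e * real (N h)"
        using Nge Q by (intro mult_left_mono) auto
      finally have bN: "real (card bad) \<le> Q * h powr e * real (N h)" .
      have "{1..N h} = \<Lambda> h \<union> bad" by (auto simp: \<Lambda>_def bad_def)
      moreover have "card (\<Lambda> h \<union> bad) = card (\<Lambda> h) + card bad"
        by (rule card_Un_disjoint) (auto simp: \<Lambda>_def bad_def)
      ultimately have "card {1..N h} = card (\<Lambda> h) + card bad" by simp
      then have sum: "real (N h) = real (card (\<Lambda> h)) + real (card bad)" by simp
      have "(1 - Q * h powr e) * real (N h) \<le> real (card (\<Lambda> h))"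
        using bN sum by (simp add: algebra_simps)
      then show "1 - Q * h powr e \<le> real (card (\<Lambda> h)) / real (N h)" using N0 by (simp add: pos_le_divide_eq)
      show "real (card (\<Lambda> h)) / real (N h) \<le> 1" using sum N0 by (simp add: pos_divide_le_eq)
    qed
    have ev: "eventually (\<lambda>h. 0 < h \<and> h < h\<^sub>1) (at_right (0 :: real))"
      using h1 by (auto simp: eventually_at_right_field)
    have "((\<lambda>h. h powr e) \<longlongrightarrow> 0) (at_right 0)"
      using e by (intro tendsto_zero_powrI[of _ _ _ e] tendsto_ident_at tendsto_const)
        (auto simp: eventually_at_right_field intro!: exI[of _ 1])
    then have "((\<lambda>h. 1 - Q * h powr e) \<longlongrightarrow> 1 - Q * 0) (at_right 0)"
      by (intro tendsto_intros)
    then have lim: "((\<lambda>h. 1 - Q * h powr e) \<longlongrightarrow> 1) (at_right 0)" by simp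
    show "((\<lambda>h. real (card (\<Lambda> h)) / real (N h)) \<longlongrightarrow> 1) (at_right 0)"
    proof (rule tendsto_sandwich[OF _ _ lim tendsto_const])
      show "\<forall>\<^sub>F h in at_right 0. 1 - Q * h powr e \<le> real (card (\<Lambda> h)) / real (N h)"
        by (rule eventually_mono[OF ev]) (rule bounds(1), simp_all)
      show "\<forall>\<^sub>F h in at_right 0. real (card (\<Lambda> h)) / real (N h) \<le> 1"
        by (rule eventually_mono[OF ev]) (rule bounds(2), simp_all)
    qed
  qed
  have N_eq: "cfun.dim (spectral_space \<alpha> h :: ('n torus \<Rightarrow> complex) set) = N h" for h
    by (simp add: N_def)
  show ?thesis
    unfolding Let_def N_eq
  proof (rule exI[of _ "1 / 2"], rule exI[of _ "1 / (2 * K)"], rule exI[of _ "3 * K / 2"], intro conjI allI impI)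
    show "0 < (1 / 2 :: real)" "1 / 2 \<le> (1 / 2 :: real)" by simp_all
    show "0 < 1 / (2 * K)" "0 < 3 * K / 2" using K by simp_all
    fix \<psi> :: "real \<Rightarrow> nat \<Rightarrow> 'n torus \<Rightarrow> complex"
    assume "\<forall>h\<in>{0<..1 / 2}. orthonormal_eigenbasis \<alpha> h (\<psi> h)"
    from main[OF bspec[OF this]]
    show "\<exists>\<Lambda>. (\<forall>h\<in>{0<..1 / 2}. \<Lambda> h \<subseteq> {1..N h}) \<and>
        ((\<lambda>h. real (card (\<Lambda> h)) / real (N h)) \<longlongrightarrow> 1) (at_right 0) \<and>
        (\<forall>h\<in>{0<..1 / 2}. \<forall>x. \<forall>j\<in>\<Lambda> h.
          (LINT y:ball x (h powr \<nu>)|torus_vol. (cmod (\<psi> h j y))\<^sup>2)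
              / measure torus_vol (ball x (h powr \<nu>)) \<in> {1 / (2 * K)..3 * K / 2})" .
  qed
qed

end
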